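(* Suppose that $k$, $r$ and $s$ are natural numbers with $k\ge 3$, $$r\le \min\{k-2,\tfrac12(k+1)\}\quad\text{and}\quad s\ge k^2-rk+\tfrac12 r(r+3)-1.$$ Then for each $\varepsilon>0$, one has $$J_{s,k}(X)\ll X^{2s-\frac12k(k+1)+\delta_{s,k,r}+\varepsilon},$$ where $$\delta_{s,k,r}=\frac{r(r-1)(3k-2r-5)}{6(s-k+1)}.$$ In particular, when $s\ge (k-\tfrac12 r)^2+\tfrac14(r+3)^2$, one has $\delta_{s,k,r}<r^2/k$.
   Context: Natural numbers are positive integers. For natural numbers $s,k$ and a real number $X$, $J_{s,k}(X)$ denotes the number of integral solutions of the system $x_1^j+\ldots+x_s^j=y_1^j+\ldots+y_s^j$ $(1\le j\le k)$ with $1\le x_i,y_i\le X$ $(1\le i\le s)$. The notation $A\ll B$ means $|A|\le CB$ for all sufficiently large $X$, where the implicit constant $C$ may depend on $s$, $k$ and $\varepsilon$ only. *)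

theory Defs
  imports Complex_Main "HOL-Library.FuncSet"
begin

text \<open>
  A solution is a pair of extensional functions on \<open>{1..s}\<close>, so that distinct elements of the
  set below correspond to distinct integer tuples; the set is finite by
  \<open>finite_vinogradov_solutions\<close>, so its cardinality is the true number of solutions.
\<close>

definition vinogradov_solutions ::
    "nat \<Rightarrow> nat \<Rightarrow> real \<Rightarrow> ((nat \<Rightarrow> int) \<times> (nat \<Rightarrow> int)) set" where
  "vinogradov_solutions s k X =
     {(x, y).
        x \<in> {1..s} \<rightarrow>\<^sub>E {n. 1 \<le> n \<and> real_of_int n \<le> X} \<and>
        y \<in> {1..s} \<rightarrow>\<^sub>E {n. 1 \<le> n \<and> real_of_int n \<le> X} \<and>
        (\<forall>j\<in>{1..k}. (\<Sum>i=1..s. x i ^ j) = (\<Sum>i=1..s. y i ^ j))}"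

definition vinogradov_J :: "nat \<Rightarrow> nat \<Rightarrow> real \<Rightarrow> nat" where
  "vinogradov_J s k X = card (vinogradov_solutions s k X)"

definition vinogradov_delta :: "nat \<Rightarrow> nat \<Rightarrow> nat \<Rightarrow> real" where
  "vinogradov_delta s k r =
     real r * (real r - 1) * (3 * real k - 2 * real r - 5) / (6 * (real s - real k + 1))"

lemma finite_vinogradov_solutions: "finite (vinogradov_solutions s k X)"
proof -
  let ?A = "{n. 1 \<le> n \<and> real_of_int n \<le> X}"
  have "?A \<subseteq> {1..\<lfloor>X\<rfloor>}"
    by (auto simp: le_floor_iff)
  hence "finite ?A"
    using finite_subset by blast
  hence "finite (({1..s} \<rightarrow>\<^sub>E ?A) \<times> ({1..s} \<rightarrow>\<^sub>E ?A))"
    by (intro finite_cartesian_product finite_PiE) auto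
  moreover have "vinogradov_solutions s k X \<subseteq> ({1..s} \<rightarrow>\<^sub>E ?A) \<times> ({1..s} \<rightarrow>\<^sub>E ?A)"
    unfolding vinogradov_solutions_def by blast
  ultimately show ?thesis
    using finite_subset by blast
qed

end

theory Submission
  imports Defs "HOL-Analysis.Analysis" "HOL-Number_Theory.Cong"
begin

text \<open>
  The range of \<open>s\<close> lies above the critical value \<open>s = k (k + 1) / 2\<close> and \<open>\<delta> \<ge> 0\<close>, so it suffices to
  prove the main conjecture \<open>J \<lless> X powr (2 s - k (k + 1) / 2 + \<epsilon>)\<close> for these \<open>s\<close>, which follows from the
  critical case. That case is a \<open>p\<close>-adic \<open>\<ell>\<^sup>2\<close> decoupling inequality for the moment curve with a fixed
  prime \<open>p > k\<close>: an exponential sum is compared with its restrictions to the residue classes modulo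
  \<open>p ^ N\<close>, with a loss of \<open>p powr (\<epsilon> N)\<close>. The proof is the bilinear argument of Guo, Li, Yung and
  Zorin-Kranich, modelled on Wooley's nested efficient congruencing, by induction on \<open>k\<close>. In a
  bilinear form in which \<open>n\<close> runs through a class modulo \<open>p ^ a\<close> and \<open>n'\<close> through a class modulo
  \<open>p ^ b\<close> that is distinct modulo \<open>p\<close>, the second factor is locally constant in \<open>l\<close> directions, along
  which degree \<open>l\<close> decoupling refines the first class to modulus \<open>p ^ e\<close> with \<open>l e = (k - l + 1) b\<close>.
  Hoelder's inequality then passes to the bilinear forms of index \<open>k - l\<close> and \<open>l - 1\<close>. Each round
  increases the total gain by a fixed multiple of the exponent \<open>\<eta>\<close> of the best decoupling constant,
  whereas the broad-narrow reduction bounds the gain by a constant; hence \<open>\<eta> = 0\<close>.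
\<close>

section \<open>Minkowski and Holder inequalities for finite sums\<close>

text \<open>Working modulo powers of one prime makes localisation exact: restricting to a residue
  class needs no cut-off function, and local constancy holds without error terms. The modulus is
  p^(k N) because classes modulo p^N are separated by the degree k coordinate only at that
  precision. The relation l e = (k - l + 1) b balances two precisions. Centred at the second class,
  the top l coordinates begin in degree k - l + 1, hence are constant modulo p^((k - l + 1) b);
  separating classes modulo p^e by a degree l curve uses precision l e. Only the index 0 form gains
  directly: a class modulo p^b has N - b scales left, which saves \<eta> b. The other indices
  receive this gain through the interpolation, whose weights conserve the sum of all savings while
  index 0 keeps adding to it. Carrying out m rounds forces b to be at most a fixed fraction of N,
  and returning from b to modulus p costs p^((2 d + 1) b) with d = k (k + 1) / 2. It therefore
  suffices that a single index saves 2 d + 2 per unit of b; the recursion in N turns this into a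
  smaller exponent.\<close>

lemma convex_on_power_nonneg: "convex_on {0..} (\<lambda>x::real. x ^ n)"
proof (cases "even n")
  case True
  then show ?thesis
    using convex_power_even convex_on_subset by blast
next
  case False
  then show ?thesis using convex_power_odd by blast
qed

lemma power_sum_le_sum_power:
  fixes c x :: "'a \<Rightarrow> real"
  assumes "finite I" "\<And>i. i \<in> I \<Longrightarrow> c i \<ge> 0" "\<And>i. i \<in> I \<Longrightarrow> x i \<ge> 0" "(\<Sum>i\<in>I. c i) = 1"
  shows "(\<Sum>i\<in>I. c i * x i) ^ n \<le> (\<Sum>i\<in>I. c i * x i ^ n)"
proof -
  have "I \<noteq> {}" using assms(4) by auto
  from convex_on_sum[OF assms(1) this convex_on_power_nonneg assms(4)] assms(2,3)
  show ?thesis by auto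
qed

lemma powr_inverse_power:
  fixes x :: real
  assumes "x \<ge> 0" "n > 0"
  shows "(x powr (1 / real n)) ^ n = x"
proof (cases "x = 0")
  case False
  then have "x > 0" using assms by simp
  then show ?thesis using assms by (simp add: powr_realpow[symmetric] powr_powr)
qed (use assms in simp)

text \<open>By convexity of the power function, after normalising each summand.\<close>
lemma Minkowski_sum_power:
  fixes G :: "'a \<Rightarrow> 'b \<Rightarrow> real"
  assumes "finite U" "finite I" and n: "n > 0"
    and w: "\<And>u. u \<in> U \<Longrightarrow> w u \<ge> 0"
    and G: "\<And>i u. i \<in> I \<Longrightarrow> u \<in> U \<Longrightarrow> G i u \<ge> 0"
  shows "(\<Sum>u\<in>U. w u * (\<Sum>i\<in>I. G i u) ^ n)
         \<le> (\<Sum>i\<in>I. (\<Sum>u\<in>U. w u * G i u ^ n) powr (1 / real n)) ^ n"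
proof -
  define A where "A i = (\<Sum>u\<in>U. w u * G i u ^ n) powr (1 / real n)" for i
  have A0: "A i \<ge> 0" for i by (simp add: A_def)
  have An: "A i ^ n = (\<Sum>u\<in>U. w u * G i u ^ n)" if "i \<in> I" for i
  proof -
    have "0 \<le> (\<Sum>u\<in>U. w u * G i u ^ n)" using w G that by (intro sum_nonneg) auto
    then show ?thesis using n by (simp add: A_def powr_inverse_power)
  qed
  \<comment> \<open>Indices with norm \<open>A i = 0\<close> must go before dividing by
    \<open>A i\<close>; their \<open>G i u\<close> vanishes wherever the weight does not.\<close>
  define I' where "I' = {i \<in> I. A i > 0}"
  define T where "T = (\<Sum>i\<in>I'. A i)"
  have fI': "finite I'" using assms by (auto simp: I'_def)
  have T: "T = (\<Sum>i\<in>I. A i)" unfolding T_def I'_def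
    using A0 assms(2) by (intro sum.mono_neutral_left) (auto simp: order_less_le)
  have z: "w u * (\<Sum>i\<in>I. G i u) ^ n = w u * (\<Sum>i\<in>I'. G i u) ^ n" if u: "u \<in> U" for u
  proof (cases "w u = 0")
    case False
    have "G i u = 0" if "i \<in> I - I'" for i
    proof -
      have "A i = 0" "i \<in> I" using that A0[of i] by (auto simp: I'_def)
      then have "(\<Sum>u\<in>U. w u * G i u ^ n) = 0" using An n by (metis power_eq_0_iff)
      then have "w u * G i u ^ n = 0"
        using sum_nonneg_eq_0_iff[OF assms(1), of "\<lambda>u. w u * G i u ^ n"] w G \<open>i \<in> I\<close> u by auto
      then show ?thesis using False by simp
    qed
    then have "(\<Sum>i\<in>I. G i u) = (\<Sum>i\<in>I'. G i u)"
      using assms(2) by (intro sum.mono_neutral_right) (auto simp: I'_def)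
    then show ?thesis by simp
  qed simp
  have "(\<Sum>u\<in>U. w u * (\<Sum>i\<in>I'. G i u) ^ n) \<le> T ^ n"
  proof (cases "I' = {}")
    case True
    then show ?thesis using n by (simp add: T_def power_0_left)
  next
    case False
    have T0: "T > 0" unfolding T_def using False fI' by (intro sum_pos) (auto simp: I'_def)
    define K where "K u = (\<Sum>i\<in>I'. (A i / T) * (G i u / A i))" for u
    have "(\<Sum>u\<in>U. w u * (\<Sum>i\<in>I'. G i u) ^ n)
        = T ^ n * (\<Sum>u\<in>U. w u * K u ^ n)"
    proof -
      have "(\<Sum>i\<in>I'. G i u) = T * K u" for u
        unfolding K_def sum_distrib_left using T0 by (intro sum.cong) (auto simp: I'_def)
      then show ?thesis by (simp add: sum_distrib_left power_mult_distrib mult_ac)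
    qed
    also have "\<dots> \<le> T ^ n * (\<Sum>u\<in>U. w u * (\<Sum>i\<in>I'. (A i / T) * (G i u / A i) ^ n))"
      unfolding K_def using T0 A0 w G fI'
      by (intro mult_left_mono sum_mono power_sum_le_sum_power)
         (auto simp: I'_def T_def sum_divide_distrib[symmetric])
    also have "(\<Sum>u\<in>U. w u * (\<Sum>i\<in>I'. (A i / T) * (G i u / A i) ^ n))
        = (\<Sum>i\<in>I'. (A i / T) * ((\<Sum>u\<in>U. w u * G i u ^ n) / A i ^ n))"
      unfolding sum_distrib_left sum_divide_distrib
      by (subst sum.swap) (simp add: power_divide mult_ac)
    also have "\<dots> = (\<Sum>i\<in>I'. A i / T)"
      using n by (intro sum.cong) (auto simp: I'_def An[symmetric])
    also have "\<dots> = 1" using T0 by (simp add: T_def sum_divide_distrib[symmetric])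
    finally show ?thesis by simp
  qed
  moreover have "(\<Sum>u\<in>U. w u * (\<Sum>i\<in>I. G i u) ^ n) = (\<Sum>u\<in>U. w u * (\<Sum>i\<in>I'. G i u) ^ n)"
    using z by (rule sum.cong[OF refl])
  ultimately show ?thesis unfolding T A_def by simp
qed

text \<open>Weighted arithmetic-geometric mean, applied termwise after dividing \<open>f\<close> and
  \<open>g\<close> by their total masses; if either mass is zero, so is every term on the
  left.\<close>

lemma Holder_sum:
  fixes f g :: "'a \<Rightarrow> real"
  assumes "finite U" "0 < t" "t < 1"
    and f: "\<And>u. u \<in> U \<Longrightarrow> f u \<ge> 0" and g: "\<And>u. u \<in> U \<Longrightarrow> g u \<ge> 0"
  shows "(\<Sum>u\<in>U. f u powr t * g u powr (1 - t)) \<le> (\<Sum>u\<in>U. f u) powr t * (\<Sum>u\<in>U. g u) powr (1 - t)"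
proof -
  define F where "F = (\<Sum>u\<in>U. f u)"
  define G where "G = (\<Sum>u\<in>U. g u)"
  have F0: "F \<ge> 0" and G0: "G \<ge> 0" using f g by (auto simp: F_def G_def intro: sum_nonneg)
  show ?thesis
  proof (cases "F = 0 \<or> G = 0")
    case True
    then have "f u powr t * g u powr (1 - t) = 0" if "u \<in> U" for u
      using that assms sum_nonneg_eq_0_iff[OF assms(1), of f] sum_nonneg_eq_0_iff[OF assms(1), of g]
      by (auto simp: F_def G_def)
    then have "(\<Sum>u\<in>U. f u powr t * g u powr (1 - t)) = 0"
      by (intro sum.neutral) blast
    then show ?thesis by simp
  next
    case False
    then have F: "F > 0" and G: "G > 0" using F0 G0 by auto
    have "f u powr t * g u powr (1 - t)
        \<le> F powr t * G powr (1 - t) * (t * (f u / F) + (1 - t) * (g u / G))" if "u \<in> U" for u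
    proof -
      have "(f u / F) powr t * (g u / G) powr (1 - t) \<le> t * (f u / F) + (1 - t) * (g u / G)"
      proof (cases "f u = 0 \<or> g u = 0")
        case True
        then have "(f u / F) powr t * (g u / G) powr (1 - t) = 0" by (elim disjE) simp_all
        moreover have "t * (f u / F) + (1 - t) * (g u / G) \<ge> 0"
          using assms that F G by (intro add_nonneg_nonneg mult_nonneg_nonneg) auto
        ultimately show ?thesis by linarith
      next
        case False
        then have "f u / F > 0" "g u / G > 0" using assms that F G by (auto simp: order_less_le)
        then show ?thesis using Youngs_inequality_0[of t "1 - t" "f u / F" "g u / G"] assms by auto
      qed
      then have "F powr t * G powr (1 - t) * ((f u / F) powr t * (g u / G) powr (1 - t))
        \<le> F powr t * G powr (1 - t) * (t * (f u / F) + (1 - t) * (g u / G))"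
        by (intro mult_left_mono) auto
      moreover have "F powr t * G powr (1 - t) * ((f u / F) powr t * (g u / G) powr (1 - t))
        = f u powr t * g u powr (1 - t)"
        using F G f g that by (simp add: powr_divide)
      ultimately show ?thesis by simp
    qed
    then have "(\<Sum>u\<in>U. f u powr t * g u powr (1 - t))
        \<le> (\<Sum>u\<in>U. F powr t * G powr (1 - t) * (t * (f u / F) + (1 - t) * (g u / G)))"
      by (rule sum_mono)
    also have "\<dots> = F powr t * G powr (1 - t) * (t * (F / F) + (1 - t) * (G / G))"
      by (simp add: F_def G_def sum.distrib sum_distrib_left[symmetric]
          sum_divide_distrib[symmetric])
    also have "\<dots> = F powr t * G powr (1 - t)" using F G by simp
    finally show ?thesis by (simp add: F_def G_def)
  qed
qed

section \<open>Exponential sums over a finite torus\<close>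

definition ee :: "int \<Rightarrow> int \<Rightarrow> complex" where
  "ee q z = cis (2 * pi * (real_of_int z / real_of_int q))"

lemma ee_add: "ee q (x + y) = ee q x * ee q y"
  by (simp add: ee_def cis_mult add_divide_distrib ring_distribs)

lemma norm_ee [simp]: "norm (ee q z) = 1"
  by (simp add: ee_def)

lemma ee_dvd:
  assumes "q dvd z"
  shows "ee q z = 1"
proof -
  obtain c where c: "z = q * c" using assms by blast
  show ?thesis
  proof (cases "q = 0")
    case False
    then have "ee q z = cis (2 * pi * real_of_int c)" by (simp add: ee_def c)
    also have "\<dots> = 1" by (rule cis_multiple_2pi) auto
    finally show ?thesis .
  qed (simp add: ee_def c)
qed

lemma ee_cong:
  assumes "[x = y] (mod q)"
  shows "ee q x = ee q y"
proof -
  have "q dvd x - y" using assms by (simp add: cong_iff_dvd_diff)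
  then have "ee q (y + (x - y)) = ee q y" by (subst ee_add) (simp add: ee_dvd)
  then show ?thesis by simp
qed

lemma ee_mult: "r \<noteq> 0 \<Longrightarrow> ee (r * q) (r * z) = ee q z"
  by (simp add: ee_def)

definition torus :: "nat \<Rightarrow> int \<Rightarrow> (nat \<Rightarrow> int) set" where
  "torus k q = {1..k} \<rightarrow>\<^sub>E {0..<q}"

lemma finite_torus [simp]: "finite (torus k q)"
  by (simp add: torus_def finite_PiE)

lemma card_torus: "q \<ge> 0 \<Longrightarrow> real (card (torus k q)) = real_of_int q ^ k"
  by (simp add: torus_def card_PiE)

text \<open>Frequencies are arbitrary integer tuples of which only the residues of the coordinates
  \<open>1..k\<close> should matter. Periodic functions descend to (Z/q)^k, so translations can be
  written without reducing modulo \<open>q\<close>.\<close>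

definition periodic :: "nat \<Rightarrow> int \<Rightarrow> ((nat \<Rightarrow> int) \<Rightarrow> 'a) \<Rightarrow> bool" where
  "periodic k q F \<longleftrightarrow> (\<forall>u u'. (\<forall>j\<in>{1..k}. [u j = u' j] (mod q)) \<longrightarrow> F u = F u')"

lemma sum_torus_shift:
  assumes "q > 0" and F: "periodic k q F"
  shows "(\<Sum>u\<in>torus k q. F (\<lambda>j. u j + v j)) = (\<Sum>u\<in>torus k q. F u)"
proof (rule sum.reindex_bij_witness[where
      i = "\<lambda>u. restrict (\<lambda>j. (u j - v j) mod q) {1..k}" and
      j = "\<lambda>u. restrict (\<lambda>j. (u j + v j) mod q) {1..k}"])
  fix u assume u: "u \<in> torus k q"
  have r: "u j mod q = u j" if "j \<in> {1..k}" for j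
    using u that by (auto simp: torus_def PiE_iff)
  have x: "u j = undefined" if "j \<notin> {1..k}" for j
    using u that by (auto simp: torus_def)
  show "restrict (\<lambda>j. (restrict (\<lambda>j. (u j + v j) mod q) {1..k} j - v j) mod q) {1..k} = u"
    using r x by (auto simp: fun_eq_iff mod_simps)
  show "restrict (\<lambda>j. (restrict (\<lambda>j. (u j - v j) mod q) {1..k} j + v j) mod q) {1..k} = u"
    using r x by (auto simp: fun_eq_iff mod_simps)
  show "restrict (\<lambda>j. (u j + v j) mod q) {1..k} \<in> torus k q"
    "restrict (\<lambda>j. (u j - v j) mod q) {1..k} \<in> torus k q"
    using assms(1) by (auto simp: torus_def)
  show "F (restrict (\<lambda>j. (u j + v j) mod q) {1..k}) = F (\<lambda>j. u j + v j)"
    using F unfolding periodic_def by (auto simp: cong_def)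
qed

definition exp_sum :: "int \<Rightarrow> nat \<Rightarrow> (nat \<Rightarrow> int poly) \<Rightarrow> (int \<Rightarrow> complex) \<Rightarrow> int set \<Rightarrow> (nat \<Rightarrow> int) \<Rightarrow>
    complex" where
  "exp_sum q k \<phi> c S u = (\<Sum>n\<in>S. c n * ee q (\<Sum>j=1..k. u j * poly (\<phi> j) n))"

lemma exp_sum_empty [simp]: "exp_sum q k \<phi> c {} u = 0"
  by (simp add: exp_sum_def)

lemma periodic_exp_sum: "periodic k q (exp_sum q k \<phi> c S)"
  unfolding periodic_def exp_sum_def
proof (intro allI impI sum.cong refl arg_cong2[where f = "(*)"] ee_cong cong_sum cong_mult)
  fix u u' :: "nat \<Rightarrow> int" and j
  assume "\<forall>j\<in>{1..k}. [u j = u' j] (mod q)" "j \<in> {1..k}"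
  then show "[u j = u' j] (mod q)" by blast
qed auto

text \<open>The phase \<open>B\<close> common to all \<open>n\<close> factors out and disappears in
  absolute values. What remains is \<open>E n\<close>, later either a lower-degree curve or
  zero.\<close>

lemma exp_sum_shift:
  assumes "\<And>n. n \<in> S \<Longrightarrow> [(\<Sum>j=1..k. v j * poly (\<phi> j) n) = B + E n] (mod q)"
  shows "exp_sum q k \<phi> c S (\<lambda>j. u j + v j)
       = ee q B * (\<Sum>n\<in>S. c n * ee q (\<Sum>j=1..k. u j * poly (\<phi> j) n) * ee q (E n))"
  unfolding exp_sum_def sum_distrib_left
proof (rule sum.cong)
  fix n assume n: "n \<in> S"
  have "ee q (\<Sum>j=1..k. (u j + v j) * poly (\<phi> j) n)
      = ee q (\<Sum>j=1..k. u j * poly (\<phi> j) n) * ee q (\<Sum>j=1..k. v j * poly (\<phi> j) n)"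
    by (simp add: ee_add ring_distribs sum.distrib)
  also have "ee q (\<Sum>j=1..k. v j * poly (\<phi> j) n) = ee q B * ee q (E n)"
    using ee_cong[OF assms[OF n]] by (simp add: ee_add)
  finally show "c n * ee q (\<Sum>j=1..k. (u j + v j) * poly (\<phi> j) n) =
      ee q B * (c n * ee q (\<Sum>j=1..k. u j * poly (\<phi> j) n) * ee q (E n))"
    by simp
qed simp

lemma triangle_pos: "k > 0 \<Longrightarrow> triangle k > 0"
  by (cases k) simp_all

lemma real_triangle: "real (triangle k) = real k * (real k + 1) / 2"
proof -
  have "real (triangle k) = real (k * Suc k) / 2"
    unfolding triangle_def by (subst real_of_nat_div) auto
  then show ?thesis by (simp add: algebra_simps)
qed

section \<open>Residue classes, moments and the decoupling inequality\<close>

definition residue_part :: "int set \<Rightarrow> int \<Rightarrow> int \<Rightarrow> int set" where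
  "residue_part S m z = {n \<in> S. [n = z] (mod m)}"

lemma finite_residue_part [simp]: "finite S \<Longrightarrow> finite (residue_part S m z)"
  by (simp add: residue_part_def)

text \<open>The weight is there for the bilinear step, where it is a power of the second
  factor.\<close>

definition moment :: "int \<Rightarrow> nat \<Rightarrow> (nat \<Rightarrow> int poly) \<Rightarrow> (int \<Rightarrow> complex) \<Rightarrow> ((nat \<Rightarrow> int) \<Rightarrow> real) \<Rightarrow> nat
    \<Rightarrow> int set \<Rightarrow> real" where
  "moment q k \<phi> c w d S = (\<Sum>u\<in>torus k q. w u * norm (exp_sum q k \<phi> c S u) ^ (2 * d))"

text \<open>Each term is the squared weighted L^(2d) norm of the sum over one residue class, so this
  is the square of the right side of an \<ell>^2 decoupling inequality.\<close>

definition energy :: "int \<Rightarrow> nat \<Rightarrow> (nat \<Rightarrow> int poly) \<Rightarrow> (int \<Rightarrow> complex) \<Rightarrow> ((nat \<Rightarrow> int) \<Rightarrow> real) \<Rightarrow> nat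
    \<Rightarrow> int \<Rightarrow> int set \<Rightarrow> real" where
  "energy q k \<phi> c w d M S = (\<Sum>z\<in>{0..<M}. moment q k \<phi> c w d (residue_part S M z) powr (1 / real d))"

text \<open>
  Curves of polynomials congruent to \<open>x, x ^ 2, \<dots>, x ^ k\<close> modulo \<open>p\<close>. Unlike the moment curve itself,
  this class is stable, up to linear changes of the frequency variables, under restriction to a
  residue class and under the projections that occur in the lower-degree step.
\<close>
definition moment_like :: "int \<Rightarrow> nat \<Rightarrow> (nat \<Rightarrow> int poly) \<Rightarrow> bool" where
  "moment_like p k \<phi> \<longleftrightarrow> (\<forall>j\<in>{1..k}. [:p:] dvd \<phi> j - monom 1 j)"

text \<open>
  \<open>V\<close> bounds the power \<open>k (k + 1) = 2 * triangle k\<close> of the usual decoupling constant. The moments are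
  sums rather than averages over the torus, which is harmless as both sides are homogeneous in them.
\<close>
definition decoupling :: "int \<Rightarrow> nat \<Rightarrow> nat \<Rightarrow> real \<Rightarrow> bool" where
  "decoupling p k N V \<longleftrightarrow> (\<forall>\<phi> c S. moment_like p k \<phi> \<longrightarrow> finite S \<longrightarrow>
     moment (p ^ (k * N)) k \<phi> c (\<lambda>_. 1) (triangle k) S
       \<le> V * energy (p ^ (k * N)) k \<phi> c (\<lambda>_. 1) (triangle k) (p ^ N) S ^ triangle k)"

lemma moment_nonneg: "(\<And>u. w u \<ge> 0) \<Longrightarrow> moment q k \<phi> c w d S \<ge> 0"
  unfolding moment_def by (intro sum_nonneg) auto

lemma energy_nonneg: "energy q k \<phi> c w d M S \<ge> 0"
  unfolding energy_def by (intro sum_nonneg) auto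

text \<open>
  Translating the frequency \<open>u\<close> along the vectors \<open>T i\<close> leaves the weight unchanged and turns the
  exponential sum into one over the degree \<open>l\<close> curve \<open>\<psi>\<close>. Decouple this on each fibre and
  recombine the fibres with Minkowski's inequality.
\<close>
lemma fibre_decoupling:
  assumes decoupling: "decoupling p l N V" and p: "prime p" and V: "V \<ge> 0" and l: "l > 0"
    and psi: "moment_like p l \<psi>" and q: "q = r * p ^ (l * N)" and r: "r > 0" and fS: "finite S"
    and S: "\<And>n. n \<in> S \<Longrightarrow> [n = \<xi>] (mod p ^ a)"
    and T: "\<And>i m. i \<in> {1..l} \<Longrightarrow>
      [(\<Sum>j=1..k. T i j * poly (\<phi> j) (\<xi> + p ^ a * m)) = B i + r * poly (\<psi> i) m] (mod q)"
    and w: "periodic k q w" "\<And>u. w u \<ge> 0"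
    and wT: "\<And>u h. w (\<lambda>j. u j + (\<Sum>i=1..l. h i * T i j)) = w u"
  shows "moment q k \<phi> c w (triangle l) S \<le> V * energy q k \<phi> c w (triangle l) (p ^ (a + N)) S ^
      triangle l"
proof -
  define d where "d = triangle l"
  have d: "d > 0" using l by (simp add: d_def triangle_pos)
  have p0: "p > 0" using p by (simp add: prime_gt_0_int)
  define q' where "q' = p ^ (l * N)"
  have q': "q' > 0" using p0 by (simp add: q'_def)
  have qq: "q = r * q'" by (simp add: q q'_def)
  have q0: "q > 0" using q' r by (simp add: qq)
  define g where "g n = (n - \<xi>) div p ^ a" for n
  have g: "n = \<xi> + p ^ a * g n" if "n \<in> S" for n
    using S[OF that] by (simp add: g_def cong_iff_dvd_diff)
  \<comment> \<open>For fixed \<open>u\<close> its phase is absorbed into the coefficients, which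
    \<open>decoupling\<close> leaves arbitrary.\<close>
  define c' where "c' u m = c (\<xi> + p ^ a * m) * ee q (\<Sum>j=1..k. u j * poly (\<phi> j) (\<xi> + p ^ a * m))"
      for u m
  define sh where "sh h u = (\<lambda>j. u j + (\<Sum>i=1..l. h i * T i j))" for h u :: "nat \<Rightarrow> int"
  have inj: "inj_on g S" by (rule inj_onI) (metis g)
  have key: "norm (exp_sum q k \<phi> c X (sh h u)) = norm (exp_sum q' l \<psi> (c' u) (g ` X) h)"
    if X: "X \<subseteq> S" for X h u
  proof -
    have "exp_sum q k \<phi> c X (sh h u) = ee q (\<Sum>i=1..l. h i * B i) *
        (\<Sum>n\<in>X. c n * ee q (\<Sum>j=1..k. u j * poly (\<phi> j) n) * ee q (r *
            (\<Sum>i=1..l. h i * poly (\<psi> i) (g n))))"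
      unfolding sh_def
    proof (rule exp_sum_shift)
      fix n assume "n \<in> X"
      then have n: "n = \<xi> + p ^ a * g n" using g X by blast
      have "(\<Sum>j=1..k. (\<Sum>i=1..l. h i * T i j) * poly (\<phi> j) n)
          = (\<Sum>i=1..l. h i * (\<Sum>j=1..k. T i j * poly (\<phi> j) n))"
        unfolding sum_distrib_left sum_distrib_right by (subst sum.swap) (simp add: mult_ac)
      also have "[\<dots> = (\<Sum>i=1..l. h i * (B i + r * poly (\<psi> i) (g n)))] (mod q)"
        using T[of _ "g n"] n by (intro cong_sum cong_mult) auto
      also have "(\<Sum>i=1..l. h i * (B i + r * poly (\<psi> i) (g n))) =
          (\<Sum>i=1..l. h i * B i) + r * (\<Sum>i=1..l. h i * poly (\<psi> i) (g n))"
        by (simp add: ring_distribs sum.distrib sum_distrib_left mult_ac)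
      finally show "[(\<Sum>j=1..k. (\<Sum>i=1..l. h i * T i j) * poly (\<phi> j) n)
          = (\<Sum>i=1..l. h i * B i) + r * (\<Sum>i=1..l. h i * poly (\<psi> i) (g n))] (mod q)" .
    qed
    also have "(\<Sum>n\<in>X. c n * ee q (\<Sum>j=1..k. u j * poly (\<phi> j) n) * ee q (r *
        (\<Sum>i=1..l. h i * poly (\<psi> i) (g n))))
        = (\<Sum>n\<in>X. c' u (g n) * ee q' (\<Sum>i=1..l. h i * poly (\<psi> i) (g n)))"
    proof (rule sum.cong)
      fix n assume "n \<in> X"
      then have n: "n = \<xi> + p ^ a * g n" using g X by blast
      show "c n * ee q (\<Sum>j=1..k. u j * poly (\<phi> j) n) * ee q (r * (\<Sum>i=1..l. h i * poly (\<psi> i) (g n)))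
        = c' u (g n) * ee q' (\<Sum>i=1..l. h i * poly (\<psi> i) (g n))"
        using r unfolding c'_def n[symmetric] by (simp add: qq ee_mult)
    qed simp
    also have "\<dots> = exp_sum q' l \<psi> (c' u) (g ` X) h"
      unfolding exp_sum_def using inj_on_subset[OF inj X] by (simp add: sum.reindex)
    finally show ?thesis by (simp add: norm_mult)
  qed
  \<comment> \<open>By translation invariance every shift \<open>h\<close> returns the full moment,
    so summing over the fibres produces \<open>H\<close> on both sides, where it cancels.\<close>
  define H where "H = real (card (torus l q'))"
  have H: "H > 0" using q' by (simp add: H_def card_torus)
  have avg: "(\<Sum>u\<in>torus k q. w u * moment q' l \<psi> (c' u) (\<lambda>_. 1) d (g ` X))
      = H * moment q k \<phi> c w d X"
    if X: "X \<subseteq> S" for X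
  proof -
    have "(\<Sum>u\<in>torus k q. w u * moment q' l \<psi> (c' u) (\<lambda>_. 1) d (g ` X))
        = (\<Sum>u\<in>torus k q. \<Sum>h\<in>torus l q'. w (sh h u) * norm (exp_sum q k \<phi> c X (sh h u)) ^ (2 * d))"
      using wT by (simp add: moment_def sum_distrib_left key[OF X]) (simp add: sh_def)
    also have "\<dots> = (\<Sum>h\<in>torus l q'. \<Sum>u\<in>torus k q. w (sh h u) * norm (exp_sum q k \<phi> c X (sh h u)) ^
        (2 * d))"
      by (rule sum.swap)
    also have "\<dots> = (\<Sum>h\<in>torus l q'. moment q k \<phi> c w d X)"
    proof (intro sum.cong refl)
      have "periodic k q (\<lambda>u. w u * norm (exp_sum q k \<phi> c X u) ^ (2 * d))"
        using w(1) periodic_exp_sum[of k q \<phi> c X] unfolding periodic_def by metis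
      from sum_torus_shift[OF q0 this]
      show "(\<Sum>u\<in>torus k q. w (sh h u) * norm (exp_sum q k \<phi> c X (sh h u)) ^ (2 * d))
          = moment q k \<phi> c w d X" for h
        unfolding sh_def moment_def .
    qed
    finally show ?thesis by (simp add: H_def)
  qed
  define M where "M = p ^ (a + N)"
  have M0: "M > 0" using p0 by (simp add: M_def)
  have resg: "residue_part (g ` S) (p ^ N) z = g ` residue_part S M (\<xi> + p ^ a * z)" for z
  proof -
    have "[n = \<xi> + p ^ a * z] (mod M) \<longleftrightarrow> [g n = z] (mod p ^ N)" if "n \<in> S" for n
    proof -
      have "[n = \<xi> + p ^ a * z] (mod M) \<longleftrightarrow> p ^ a * p ^ N dvd p ^ a * (g n - z)"
        by (subst g[OF that]) (simp add: cong_iff_dvd_diff M_def power_add ring_distribs)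
      also have "\<dots> \<longleftrightarrow> p ^ N dvd g n - z" using p0 by simp
      finally show ?thesis by (simp add: cong_iff_dvd_diff)
    qed
    then show ?thesis by (auto simp: residue_part_def)
  qed
  define A where "A z = moment q k \<phi> c w d (residue_part S M z)" for z
  have A0: "A z \<ge> 0" for z unfolding A_def using w by (intro moment_nonneg) auto
  \<comment> \<open>Classes modulo \<open>p ^ N\<close> of the rescaled variable inject into classes
    modulo \<open>p ^ (a + N)\<close>; further classes can only enlarge the energy.\<close>
  have le: "(\<Sum>z\<in>{0..<p ^ N}. A (\<xi> + p ^ a * z) powr (1 / real d))
      \<le> (\<Sum>z\<in>{0..<M}. A z powr (1 / real d))"
  proof -
    define f where "f z = (\<xi> + p ^ a * z) mod M" for z
    have fA: "A (f z) = A (\<xi> + p ^ a * z)" for z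
      by (simp add: A_def residue_part_def f_def cong_def)
    have finj: "inj_on f {0..<p ^ N}"
    proof (rule inj_onI)
      fix x y assume xy: "x \<in> {0..<p ^ N}" "y \<in> {0..<p ^ N}" "f x = f y"
      then have "p ^ a * p ^ N dvd p ^ a * (x - y)"
        by (simp add: f_def mod_eq_dvd_iff M_def power_add ring_distribs)
      then have "p ^ N dvd x - y" using p0 by simp
      then have "x mod p ^ N = y mod p ^ N" by (simp add: mod_eq_dvd_iff)
      then show "x = y" using xy by simp
    qed
    have "(\<Sum>z\<in>{0..<p ^ N}. A (\<xi> + p ^ a * z) powr (1 / real d))
        = (\<Sum>z\<in>f ` {0..<p ^ N}. A z powr (1 / real d))"
      using finj by (simp add: sum.reindex fA)
    also have "\<dots> \<le> (\<Sum>z\<in>{0..<M}. A z powr (1 / real d))"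
      using M0 by (intro sum_mono2) (auto simp: f_def)
    finally show ?thesis .
  qed
  have "H * moment q k \<phi> c w d S = (\<Sum>u\<in>torus k q. w u * moment q' l \<psi> (c' u) (\<lambda>_. 1) d (g ` S))"
    by (rule avg[symmetric]) simp
  also have "\<dots> \<le> (\<Sum>u\<in>torus k q. w u * (V * energy q' l \<psi> (c' u) (\<lambda>_. 1) d (p ^ N) (g ` S) ^ d))"
    using decoupling psi fS w unfolding decoupling_def d_def q'_def
        by (intro sum_mono mult_left_mono) auto
  also have "\<dots> = V * (\<Sum>u\<in>torus k q. w u * (\<Sum>z\<in>{0..<p ^ N}. moment q' l \<psi> (c' u) (\<lambda>_. 1) d
      (g ` residue_part S M (\<xi> + p ^ a * z)) powr (1 / real d)) ^ d)"
    by (simp add: energy_def resg sum_distrib_left mult_ac)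
  also have "\<dots> \<le> V * (\<Sum>z\<in>{0..<p ^ N}. (\<Sum>u\<in>torus k q. w u * (moment q' l \<psi> (c' u) (\<lambda>_. 1) d
      (g ` residue_part S M (\<xi> + p ^ a * z)) powr (1 / real d)) ^ d) powr (1 / real d)) ^ d"
    using V d w by (intro mult_left_mono Minkowski_sum_power) auto
  also have "\<dots> = V * (\<Sum>z\<in>{0..<p ^ N}. (H * A (\<xi> + p ^ a * z)) powr (1 / real d)) ^ d"
  proof -
    have "(\<Sum>u\<in>torus k q. w u * (moment q' l \<psi> (c' u) (\<lambda>_. 1) d (g ` residue_part S M (\<xi> + p ^ a
        * z)) powr (1 / real d)) ^ d)
       = (\<Sum>u\<in>torus k q. w u * moment q' l \<psi> (c' u) (\<lambda>_. 1) d (g ` residue_part S M (\<xi> + p ^ a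
           * z)))" for z
      using d by (simp add: powr_inverse_power moment_nonneg)
    moreover have "(\<Sum>u\<in>torus k q. w u * moment q' l \<psi> (c' u) (\<lambda>_. 1) d (g ` residue_part S M
        (\<xi> + p ^ a * z))) = H * A (\<xi> + p ^ a * z)" for z
      unfolding A_def by (rule avg) (auto simp: residue_part_def)
    ultimately show ?thesis by simp
  qed
  also have "\<dots> = V * (H * (\<Sum>z\<in>{0..<p ^ N}. A (\<xi> + p ^ a * z) powr (1 / real d)) ^ d)"
    using H A0 d by (simp add: powr_mult sum_distrib_left[symmetric] power_mult_distrib
        powr_inverse_power)
  also have "V * (H * (\<Sum>z\<in>{0..<p ^ N}. A (\<xi> + p ^ a * z) powr (1 / real d)) ^ d)
      \<le> H * (V * (\<Sum>z\<in>{0..<M}. A z powr (1 / real d)) ^ d)"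
    using V H le by (simp add: mult_ac power_mono sum_nonneg mult_left_mono)
  finally have "H * moment q k \<phi> c w d S \<le> H * (V * (\<Sum>z\<in>{0..<M}. A z powr (1 / real d)) ^ d)" .
  then show ?thesis using H by (simp add: d_def energy_def A_def M_def)
qed

section \<open>Changes of variables modulo prime powers\<close>

lemma const_dvd_pcompose:
  fixes f g :: "int poly"
  assumes "[:p:] dvd f"
  shows "[:p:] dvd pcompose f g"
proof -
  obtain h where "f = [:p:] * h" using assms by blast
  then have "pcompose f g = [:p:] * pcompose h g" by (simp add: pcompose_smult)
  then show ?thesis by (metis dvd_triv_left)
qed

lemma pcompose_power: "pcompose (f ^ n) g = pcompose f g ^ n"
  by (induction n) (simp_all add: pcompose_mult pcompose_1)

lemma pderiv_sum_poly: "pderiv (\<Sum>i\<in>I. f i) = (\<Sum>i\<in>I. pderiv (f i))"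
  by (induction I rule: infinite_finite_induct) (simp_all add: pderiv_add)

lemma pcompose_shift_back: "pcompose (pcompose f [:\<theta>, 1:]) [:- \<theta>, 1:] = (f :: int poly)"
proof -
  have "pcompose [:\<theta>, 1:] [:- \<theta>, 1:] = ([:0, 1:] :: int poly)" by (simp add: pcompose_pCons)
  then show ?thesis by (simp add: pcompose_assoc[symmetric])
qed

text \<open>Injectivity modulo \<open>p\<close> lifts to \<open>p ^ B\<close>, where by finiteness it gives surjectivity.\<close>
lemma inverse_mod_prime_power:
  fixes M :: "nat \<Rightarrow> nat \<Rightarrow> int"
  assumes I: "finite I" and p: "prime p"
    and inj: "\<forall>v. (\<forall>i\<in>I. p dvd (\<Sum>j\<in>I. v j * M j i)) \<longrightarrow> (\<forall>j\<in>I. p dvd v j)"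
  shows "\<exists>T. \<forall>i\<in>I. \<forall>i'\<in>I. [(\<Sum>j\<in>I. T i j * M j i') = (if i = i' then 1 else 0)] (mod p ^ B)"
proof -
  have p0: "p > 0" using p by (simp add: prime_gt_0_int)
  have injB: "(\<And>i. i \<in> I \<Longrightarrow> p ^ B dvd (\<Sum>j\<in>I. v j * M j i)) \<Longrightarrow> j \<in> I \<Longrightarrow> p ^ B dvd v j" for B v j
  proof (induction B arbitrary: v j)
    case (Suc B)
    have pv: "p dvd v j" if "j \<in> I" for j
    proof (rule inj[rule_format, OF _ that])
      fix i assume "i \<in> I"
      from Suc.prems(1)[OF this] show "p dvd (\<Sum>j\<in>I. v j * M j i)"
        using dvd_mult_left by auto
    qed
    define v' where "v' j = v j div p" for j
    have v': "v j = p * v' j" if "j \<in> I" for j using pv[OF that] by (simp add: v'_def)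
    have "p ^ B dvd (\<Sum>j\<in>I. v' j * M j i)" if "i \<in> I" for i
    proof -
      have "(\<Sum>j\<in>I. v j * M j i) = p * (\<Sum>j\<in>I. v' j * M j i)"
        by (simp add: sum_distrib_left v' mult_ac)
      with Suc.prems(1)[OF that] show ?thesis using p0 by simp
    qed
    then have "p ^ B dvd v' j" using Suc.IH Suc.prems(2) by blast
    then show ?case using v'[OF Suc.prems(2)] by simp
  qed simp
  define q where "q = p ^ B"
  have q: "q > 0" using p0 by (simp add: q_def)
  define A where "A = I \<rightarrow>\<^sub>E {0..<q}"
  define F where "F v = restrict (\<lambda>i. (\<Sum>j\<in>I. v j * M j i) mod q) I" for v
  have fA: "finite A" using I by (simp add: A_def finite_PiE)
  have "F ` A \<subseteq> A" using q by (auto simp: F_def A_def)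
  moreover have "inj_on F A"
  proof (rule inj_onI)
    fix v w assume vw: "v \<in> A" "w \<in> A" "F v = F w"
    have d: "q dvd v j - w j" if "j \<in> I" for j
    proof (unfold q_def, rule injB[OF _ that])
      fix i assume i: "i \<in> I"
      have "F v i = F w i" using vw by simp
      then have "q dvd (\<Sum>j\<in>I. v j * M j i) - (\<Sum>j\<in>I. w j * M j i)"
        using i by (simp add: F_def mod_eq_dvd_iff)
      then show "p ^ B dvd (\<Sum>j\<in>I. (v j - w j) * M j i)"
        by (simp add: q_def ring_distribs sum_subtractf)
    qed
    show "v = w"
    proof (rule PiE_ext)
      show "v \<in> I \<rightarrow>\<^sub>E {0..<q}" "w \<in> I \<rightarrow>\<^sub>E {0..<q}" using vw by (auto simp: A_def)
      fix j assume j: "j \<in> I"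
      then have "v j mod q = w j mod q" using d by (simp add: mod_eq_dvd_iff)
      moreover have "v j mod q = v j" "w j mod q = w j" using j vw by (auto simp: A_def PiE_iff)
      ultimately show "v j = w j" by simp
    qed
  qed
  ultimately have surj: "F ` A = A" using fA by (intro endo_inj_surj)
  have "\<exists>v. \<forall>i'\<in>I. [(\<Sum>j\<in>I. v j * M j i') = (if i = i' then 1 else 0)] (mod q)" for i
  proof -
    have "restrict (\<lambda>i'. (if i = i' then 1 else 0) mod q) I \<in> F ` A"
      unfolding surj using q by (auto simp: A_def)
    then obtain v where v: "F v = restrict (\<lambda>i'. (if i = i' then 1 else 0) mod q) I" by force
    have "[(\<Sum>j\<in>I. v j * M j i') = (if i = i' then 1 else 0)] (mod q)" if "i' \<in> I" for i'
      using fun_cong[OF v, of i'] that by (simp add: F_def cong_def)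
    then show ?thesis by blast
  qed
  then show ?thesis unfolding q_def by metis
qed

lemma poly_sum_upto:
  fixes f :: "int poly"
  assumes "degree f \<le> D"
  shows "poly f x = (\<Sum>i\<le>D. coeff f i * x ^ i)"
  unfolding poly_altdef
  by (intro sum.mono_neutral_left) (use assms in \<open>auto simp: coeff_eq_0\<close>)

text \<open>Under x = p^a m the term of degree i' gains p^(a i'). Degrees 1 to \<open>l\<close>
  other than \<open>i\<close> vanish modulo \<open>p ^ B\<close>, and beyond \<open>l\<close> the
  gain exceeds p^(a i) by at least one factor \<open>p\<close> because \<open>a \<ge> 1\<close>.
  After extracting p^(a i), \<open>monom 1 i\<close> is left modulo \<open>p\<close>, as
  \<open>moment_like\<close> demands.\<close>

lemma rescale_poly:
  fixes Y :: "int poly"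
  assumes Y: "\<And>i'. i' \<in> {1..l} \<Longrightarrow> [coeff Y i' = (if i = i' then 1 else 0)] (mod p ^ B)"
    and i: "i \<in> {1..l}" and a: "a \<ge> 1"
  shows "\<exists>\<psi>. [:p:] dvd \<psi> - monom 1 i \<and> (\<forall>m. [poly Y (p ^ a * m) = poly Y 0 + p ^ (a * i)
      * poly \<psi> m] (mod p ^ B))"
proof -
  define D where "D = degree Y + l"
  define h where "h = (\<Sum>i'\<in>{l+1..D}. monom (coeff Y i' * p ^ (a * i' - a * i)) i')"
  have "[:p:] dvd h"
    unfolding h_def
  proof (intro dvd_sum)
    fix i' assume i': "i' \<in> {l+1..D}"
    have "a * i < a * i'" using i i' a by auto
    then obtain e where "a * i' - a * i = Suc e" by (metis Suc_diff_Suc)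
    then have "coeff Y i' * p ^ (a * i' - a * i) = p * (coeff Y i' * p ^ e)" by simp
    then show "[:p:] dvd monom (coeff Y i' * p ^ (a * i' - a * i)) i'"
      by (auto simp: const_poly_dvd_iff)
  qed
  moreover have "[poly Y (p ^ a * m) = poly Y 0 + p ^ (a * i) * poly (monom 1 i + h) m]
      (mod p ^ B)" for m
  proof -
    have "poly Y (p ^ a * m) = (\<Sum>i'\<le>D. coeff Y i' * (p ^ a * m) ^ i')"
      by (rule poly_sum_upto) (simp add: D_def)
    also have "{..D} = insert 0 ({1..l} \<union> {l+1..D})" by (auto simp: D_def)
    also have "(\<Sum>i'\<in>\<dots>. coeff Y i' * (p ^ a * m) ^ i')
        = poly Y 0 + ((\<Sum>i'\<in>{1..l}. coeff Y i' * (p ^ a * m) ^ i')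
        + (\<Sum>i'\<in>{l+1..D}. coeff Y i' * (p ^ a * m) ^ i'))"
      by (simp add: sum.union_disjoint poly_0_coeff_0)
    also have "[\<dots> = poly Y 0 + ((\<Sum>i'\<in>{1..l}. (if i = i' then 1 else 0) * (p ^ a * m) ^ i')
        + (\<Sum>i'\<in>{l+1..D}. coeff Y i' * (p ^ a * m) ^ i'))] (mod p ^ B)"
      by (intro cong_add cong_refl cong_sum cong_mult Y)
    also have "(\<Sum>i'\<in>{1..l}. (if i = i' then 1 else 0) * (p ^ a * m) ^ i') = p ^ (a * i) * m ^ i"
    proof -
      have "(\<Sum>i'\<in>{1..l}. (if i = i' then 1 else 0) * (p ^ a * m) ^ i')
          = (\<Sum>i'\<in>{1..l}. if i = i' then (p ^ a * m) ^ i' else 0)"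
        by (intro sum.cong) auto
      also have "\<dots> = (p ^ a * m) ^ i" using i by simp
      finally show ?thesis by (simp add: power_mult_distrib power_mult)
    qed
    also have "(\<Sum>i'\<in>{l+1..D}. coeff Y i' * (p ^ a * m) ^ i') = p ^ (a * i) * poly h m"
      unfolding h_def poly_sum sum_distrib_left
    proof (rule sum.cong)
      fix i' assume i': "i' \<in> {l+1..D}"
      then have "a * i' = a * i + (a * i' - a * i)" using i by auto
      then have "p ^ (a * i') = p ^ (a * i) * p ^ (a * i' - a * i)" by (metis power_add)
      then show "coeff Y i' * (p ^ a * m) ^ i'
          = p ^ (a * i) * poly (monom (coeff Y i' * p ^ (a * i' - a * i)) i') m"
        by (simp add: poly_monom power_mult_distrib power_mult mult_ac)
    qed simp
    finally show ?thesis by (simp add: poly_monom ring_distribs)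
  qed
  ultimately show ?thesis by (intro exI[of _ "monom 1 i + h"]) auto
qed

text \<open>At multiples of \<open>p ^ b\<close> every term of degree at least \<open>g\<close> is
  divisible by p^(g b). This is the source of the local constancy of the second factor.\<close>

lemma poly_cong_const:
  fixes Y :: "int poly"
  assumes Y: "\<And>i. i \<in> {1..<g} \<Longrightarrow> p ^ B dvd coeff Y i" and g: "g * b \<le> B"
  shows "[poly Y (p ^ b * t) = poly Y 0] (mod p ^ (g * b))"
proof -
  have "poly Y (p ^ b * t) = (\<Sum>i\<le>degree Y. coeff Y i * (p ^ b * t) ^ i)"
    by (rule poly_sum_upto) simp
  also have "{..degree Y} = insert 0 {1..degree Y}" by auto
  also have "(\<Sum>i\<in>\<dots>. coeff Y i * (p ^ b * t) ^ i) = poly Y 0 + (\<Sum>i\<in>{1..degree Y}. coeff Y i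
      * (p ^ b * t) ^ i)"
    by (simp add: poly_0_coeff_0)
  also have "[\<dots> = poly Y 0 + 0] (mod p ^ (g * b))"
  proof (intro cong_add cong_refl)
    have "p ^ (g * b) dvd (\<Sum>i\<in>{1..degree Y}. coeff Y i * (p ^ b * t) ^ i)"
    proof (intro dvd_sum)
      fix i assume i: "i \<in> {1..degree Y}"
      show "p ^ (g * b) dvd coeff Y i * (p ^ b * t) ^ i"
      proof (cases "i < g")
        case True
        have "p ^ (g * b) dvd p ^ B" using g by (rule le_imp_power_dvd)
        also have "p ^ B dvd coeff Y i" using Y True i by auto
        finally show ?thesis by simp
      next
        case False
        then have "p ^ (g * b) dvd p ^ (i * b)" by (intro le_imp_power_dvd) auto
        also have "p ^ (i * b) dvd (p ^ b * t) ^ i"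
            by (simp add: power_mult_distrib power_mult mult.commute)
        finally show ?thesis by simp
      qed
    qed
    then show "[(\<Sum>i\<in>{1..degree Y}. coeff Y i * (p ^ b * t) ^ i) = 0] (mod p ^ (g * b))"
      by (simp add: cong_0_iff)
  qed
  finally show ?thesis by simp
qed

text \<open>Modulo \<open>p\<close> the recentred curve is a translate of x, ..., x^k, and
  translation is invertible up to constants: a combination without nonconstant coefficients can be
  translated back. Inverting the matrix modulo \<open>p ^ B\<close> gives coordinates x^j plus a
  constant plus terms above degree \<open>k\<close>; the latter are only divisible by
  \<open>p\<close>.\<close>

lemma moment_like_dual:
  assumes p: "prime p" and phi: "moment_like p k \<phi>"
  shows "\<exists>S. (\<forall>j\<in>{1..k}. \<forall>i\<in>{1..k}.
      [coeff (\<Sum>j'=1..k. smult (S j j') (pcompose (\<phi> j') [:\<eta>, 1:])) i = (if j = i then 1 else 0)]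
          (mod p ^ B)) \<and>
    (\<forall>j. \<forall>i>k. p dvd coeff (\<Sum>j'=1..k. smult (S j j') (pcompose (\<phi> j') [:\<eta>, 1:])) i)"
proof -
  define M where "M j i = coeff (pcompose (\<phi> j) [:\<eta>, 1:]) i" for j i
  have Mc: "[M j i = coeff (pcompose (monom 1 j) [:\<eta>, 1:]) i] (mod p)" if "j \<in> {1..k}" for j i
  proof -
    have "[:p:] dvd pcompose (\<phi> j - monom 1 j) [:\<eta>, 1:]"
      using phi that by (intro const_dvd_pcompose) (auto simp: moment_like_def)
    then show ?thesis by (simp add: M_def const_poly_dvd_iff pcompose_diff cong_iff_dvd_diff)
  qed
  have deg: "coeff (pcompose (monom 1 j) [:\<eta>, 1:]) i = (0 :: int)" if "j \<le> k" "i > k" for i j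
    using that by (intro coeff_eq_0) (simp add: degree_pcompose degree_monom_eq)
  have inj: "p dvd v j" if v: "\<And>i. i \<in> {1..k} \<Longrightarrow> p dvd (\<Sum>j\<in>{1..k}. v j * M j i)"
      and j: "j \<in> {1..k}" for v j
  proof -
    define G where "G = (\<Sum>j=1..k. monom (v j) j)"
    have cG: "coeff (pcompose G [:\<eta>, 1:]) i
        = (\<Sum>j=1..k. v j * coeff (pcompose (monom 1 j) [:\<eta>, 1:]) i)" for i
    proof -
      have "G = (\<Sum>j=1..k. smult (v j) (monom 1 j))" by (simp add: G_def smult_monom)
      then show ?thesis by (simp add: pcompose_sum pcompose_smult coeff_sum)
    qed
    have "[:p:] dvd pcompose G [:\<eta>, 1:] - [:coeff (pcompose G [:\<eta>, 1:]) 0:]"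
      unfolding const_poly_dvd_iff
    proof
      fix i
      show "p dvd coeff (pcompose G [:\<eta>, 1:] - [:coeff (pcompose G [:\<eta>, 1:]) 0:]) i"
      proof (cases "i = 0")
        case False
        then have *: "coeff (pcompose G [:\<eta>, 1:] - [:coeff (pcompose G [:\<eta>, 1:]) 0:]) i
            = coeff (pcompose G [:\<eta>, 1:]) i"
          by (cases i) auto
        show ?thesis
        proof (cases "i \<le> k")
          case True
          have "[(\<Sum>j\<in>{1..k}. v j * M j i) = coeff (pcompose G [:\<eta>, 1:]) i] (mod p)"
            unfolding cG by (intro cong_sum cong_mult Mc) auto
          then show ?thesis using v[of i] True False * by (auto simp: cong_dvd_iff)
        next
          case False
          then have "coeff (pcompose G [:\<eta>, 1:]) i = 0" unfolding cG using deg
              by (intro sum.neutral) auto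
          then show ?thesis using * by simp
        qed
      qed simp
    qed
    from const_dvd_pcompose[OF this, of "[:- \<eta>, 1:]"]
    have "[:p:] dvd G - [:coeff (pcompose G [:\<eta>, 1:]) 0:]"
      by (simp only: pcompose_diff pcompose_shift_back pcompose_const)
    then have "p dvd coeff (G - [:coeff (pcompose G [:\<eta>, 1:]) 0:]) j"
      unfolding const_poly_dvd_iff by blast
    moreover have "coeff (G - [:coeff (pcompose G [:\<eta>, 1:]) 0:]) j = v j"
      using j by (cases j) (auto simp: G_def coeff_sum)
    ultimately show ?thesis by simp
  qed
  obtain S where S: "\<forall>i\<in>{1..k}. \<forall>i'\<in>{1..k}. [(\<Sum>j\<in>{1..k}. S i j * M j i')
      = (if i = i' then 1 else 0)] (mod p ^ B)"
    using inverse_mod_prime_power[of "{1..k}" p M B] p inj by auto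
  show ?thesis
  proof (intro exI[of _ S] conjI ballI allI impI)
    fix j i assume "j \<in> {1..k}" "i \<in> {1..k}"
    then show "[coeff (\<Sum>j'=1..k. smult (S j j') (pcompose (\<phi> j') [:\<eta>, 1:])) i
        = (if j = i then 1 else 0)] (mod p ^ B)"
      using S by (simp add: coeff_sum M_def)
  next
    fix j i :: nat assume i: "i > k"
    have "p dvd M j' i" if "j' \<in> {1..k}" for j'
      using Mc[OF that, of i] deg[of j' i] i that by (simp add: cong_0_iff)
    then show "p dvd coeff (\<Sum>j'=1..k. smult (S j j') (pcompose (\<phi> j') [:\<eta>, 1:])) i"
      by (auto simp: coeff_sum M_def intro!: dvd_sum)
  qed
qed

text \<open>The p-adic form of affine rescaling. Row \<open>i\<close> naturally carries p^(a i);
  multiplying it by p^(k a - a i) gives all rows the common factor p^(k a), since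
  \<open>fibre_decoupling\<close> works with a single factor \<open>r\<close>.\<close>

lemma moment_like_rescale:
  assumes p: "prime p" and phi: "moment_like p k \<phi>" and a: "a \<ge> 1"
  shows "\<exists>T \<psi> C. moment_like p k \<psi> \<and> (\<forall>i\<in>{1..k}. \<forall>m. [(\<Sum>j=1..k. T i j * poly (\<phi> j) (\<xi> + p ^ a
      * m)) = C i + p ^ (k * a) * poly (\<psi> i) m] (mod p ^ B))"
proof -
  obtain S where S: "\<And>j i. j \<in> {1..k} \<Longrightarrow> i \<in> {1..k} \<Longrightarrow>
      [coeff (\<Sum>j'=1..k. smult (S j j') (pcompose (\<phi> j') [:\<xi>, 1:])) i = (if j = i then 1 else 0)]
          (mod p ^ B)"
    using moment_like_dual[OF p phi, of \<xi> B] by blast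
  define Y where "Y j = (\<Sum>j'=1..k. smult (S j j') (pcompose (\<phi> j') [:\<xi>, 1:]))" for j
  have "\<forall>i\<in>{1..k}. \<exists>\<psi>. [:p:] dvd \<psi> - monom 1 i \<and> (\<forall>m. [poly (Y i) (p ^ a * m)
      = poly (Y i) 0 + p ^ (a * i) * poly \<psi> m] (mod p ^ B))"
  proof
    fix i assume i: "i \<in> {1..k}"
    show "\<exists>\<psi>. [:p:] dvd \<psi> - monom 1 i \<and> (\<forall>m. [poly (Y i) (p ^ a * m) = poly (Y i) 0 + p ^ (a * i)
        * poly \<psi> m] (mod p ^ B))"
      by (rule rescale_poly[OF _ i a]) (use S[OF i] in \<open>simp add: Y_def\<close>)
  qed
  then obtain \<psi> where psi: "\<And>i. i \<in> {1..k} \<Longrightarrow> [:p:] dvd \<psi> i - monom 1 i"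
    "\<And>i m. i \<in> {1..k} \<Longrightarrow> [poly (Y i) (p ^ a * m) = poly (Y i) 0 + p ^ (a * i) * poly (\<psi> i) m]
        (mod p ^ B)"
    unfolding bchoice_iff by blast
  have "moment_like p k \<psi>" using psi(1) by (simp add: moment_like_def)
  moreover have "[(\<Sum>j=1..k. (p ^ (k * a - a * i) * S i j) * poly (\<phi> j) (\<xi> + p ^ a * m))
      = p ^ (k * a - a * i) * poly (Y i) 0 + p ^ (k * a) * poly (\<psi> i) m] (mod p ^ B)"
          if i: "i \<in> {1..k}" for i m
  proof -
    define e where "e = k * a - a * i"
    have e: "e + a * i = k * a" using i by (simp add: e_def mult.commute)
    have "(\<Sum>j=1..k. (p ^ e * S i j) * poly (\<phi> j) (\<xi> + p ^ a * m)) = p ^ e * poly (Y i) (p ^ a * m)"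
      by (simp add: Y_def poly_sum poly_pcompose sum_distrib_left mult_ac)
    also have "[\<dots> = p ^ e * (poly (Y i) 0 + p ^ (a * i) * poly (\<psi> i) m)] (mod p ^ B)"
      by (intro cong_mult cong_refl psi i)
    also have "p ^ e * (poly (Y i) 0 + p ^ (a * i) * poly (\<psi> i) m)
        = p ^ e * poly (Y i) 0 + p ^ (k * a) * poly (\<psi> i) m"
      by (simp add: e[symmetric] power_add ring_distribs)
    finally show ?thesis by (simp add: e_def)
  qed
  ultimately show ?thesis
    by (intro exI[of _ "\<lambda>i j. p ^ (k * a - a * i) * S i j"] exI[of _ \<psi>]
        exI[of _ "\<lambda>i. p ^ (k * a - a * i) * poly (Y i) 0"]) blast
qed

text \<open>Modulo \<open>p\<close>, \<open>W\<close> is a unit as a formal power series, so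
  multiplying by it does not change the order of vanishing at 0.\<close>

lemma dvd_coeff_mult_cancel:
  fixes W V :: "int poly"
  assumes p: "prime p" and W: "\<not> p dvd coeff W 0" and WV: "\<And>i. i < l \<Longrightarrow> p dvd coeff (W * V) i"
  shows "i < l \<Longrightarrow> p dvd coeff V i"
proof (induction i rule: less_induct)
  case (less i)
  have "coeff (W * V) i = coeff W 0 * coeff V i + (\<Sum>j=1..i. coeff W j * coeff V (i - j))"
    unfolding coeff_mult atMost_atLeast0 by (subst sum.atLeast_Suc_atMost) auto
  moreover have "p dvd (\<Sum>j=1..i. coeff W j * coeff V (i - j))"
    using less by (intro dvd_sum dvd_mult less.IH) auto
  ultimately have "p dvd coeff W 0 * coeff V i"
    using WV[OF less.prems] by (metis dvd_add_left_iff)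
  then show ?case using p W by (simp add: prime_dvd_mult_iff)
qed

text \<open>
  The derivative of \<open>\<Sum>j. v j * x ^ (k - l + j)\<close> is \<open>x ^ (k - l) * U\<close> with \<open>degree U < l\<close>, and modulo \<open>p\<close> it
  vanishes to order \<open>l\<close> at the unit \<open>\<theta>\<close>; hence \<open>U\<close> vanishes. The factors \<open>k - l + j < p\<close> are units.
\<close>
lemma top_coeffs_inj:
  assumes p: "prime p" "int k < p" and l: "l \<le> k" and th: "\<not> p dvd \<theta>"
    and v: "\<And>i. i \<in> {1..l} \<Longrightarrow> p dvd coeff (pcompose (\<Sum>j=1..l. monom (v j) (k - l + j)) [:\<theta>, 1:]) i"
    and j: "j \<in> {1..l}"
  shows "p dvd v j"
proof -
  define G where "G = (\<Sum>j=1..l. monom (v j) (k - l + j))"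
  define U where "U = (\<Sum>j=1..l. monom (int (k - l + j) * v j) (j - 1))"
  have "pderiv G = monom 1 (k - l) * U"
    unfolding G_def U_def pderiv_sum_poly sum_distrib_left
    by (intro sum.cong) (auto simp: pderiv_monom mult_monom)
  moreover have "pderiv (pcompose G [:\<theta>, 1:]) = pcompose (pderiv G) [:\<theta>, 1:]"
    by (simp add: pderiv_pcompose pderiv_pCons)
  ultimately have *: "pderiv (pcompose G [:\<theta>, 1:]) = [:\<theta>, 1:] ^ (k - l) * pcompose U [:\<theta>, 1:]"
    by (simp add: pcompose_mult monom_altdef pcompose_power pcompose_pCons)
  have "p dvd coeff (pcompose U [:\<theta>, 1:]) i" for i
  proof (cases "i < l")
    case True
    show ?thesis
    proof (rule dvd_coeff_mult_cancel[OF p(1) _ _ True])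
      have "coeff ([:\<theta>, 1:] ^ (k - l)) 0 = \<theta> ^ (k - l)" by (simp add: coeff_0_power)
      then show "\<not> p dvd coeff ([:\<theta>, 1:] ^ (k - l)) 0"
        using th p(1) prime_dvd_power by metis
      fix i assume "i < l"
      then show "p dvd coeff ([:\<theta>, 1:] ^ (k - l) * pcompose U [:\<theta>, 1:]) i"
        unfolding *[symmetric] coeff_pderiv using v[of "Suc i"] by (simp add: G_def)
    qed
  next
    case False
    have "degree U \<le> l - 1"
      unfolding U_def by (intro degree_sum_le) (auto intro: order.trans[OF degree_monom_le])
    then have "degree (pcompose U [:\<theta>, 1:]) < i" using False j by (auto simp: degree_pcompose)
    then show ?thesis by (simp add: coeff_eq_0)
  qed
  then have "[:p:] dvd pcompose U [:\<theta>, 1:]" by (simp add: const_poly_dvd_iff)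
  from const_dvd_pcompose[OF this, of "[:-\<theta>, 1:]"] have "[:p:] dvd U"
    by (simp only: pcompose_shift_back)
  then have "p dvd coeff U (j - 1)" by (simp only: const_poly_dvd_iff)
  also have "coeff U (j - 1) = (\<Sum>i=1..l. if i = j then int (k - l + i) * v i else 0)"
    unfolding U_def coeff_sum using j by (intro sum.cong) auto
  also have "\<dots> = int (k - l + j) * v j" using j by simp
  finally have "p dvd int (k - l + j) * v j" .
  moreover have "\<not> p dvd int (k - l + j)"
    using p j l by (intro zdvd_not_zless) auto
  ultimately show ?thesis using p(1) by (simp add: prime_dvd_mult_iff)
qed

text \<open>
  The top \<open>l\<close> coordinates of the curve centred at \<open>\<eta>\<close> are constant to high order near \<open>\<eta>\<close>, but
  parametrise a nondegenerate degree \<open>l\<close> curve near any \<open>\<xi>\<close> distinct from \<open>\<eta>\<close> modulo \<open>p\<close>.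
\<close>
lemma moment_like_project:
  assumes p: "prime p" "int k < p" and phi: "moment_like p k \<phi>" and a: "a \<ge> 1" and l: "l \<le> k"
    and xe: "\<not> p dvd \<xi> - \<eta>" and L: "(k - l + 1) * b \<le> B" and B: "B \<ge> 1"
  shows "\<exists>T \<psi> C C'. moment_like p l \<psi> \<and>
    (\<forall>i\<in>{1..l}. \<forall>m. [(\<Sum>j=1..k. T i j * poly (\<phi> j) (\<xi> + p ^ a * m))
        = C i + p ^ (B - (k - l + 1) * b + l * a) * poly (\<psi> i) m] (mod p ^ B)) \<and>
    (\<forall>i\<in>{1..l}. \<forall>n. [n = \<eta>] (mod p ^ b) \<longrightarrow>
       [(\<Sum>j=1..k. T i j * poly (\<phi> j) n) = C' i] (mod p ^ B))"
proof -
  define \<theta> where "\<theta> = \<xi> - \<eta>"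
  define L where "L = (k - l + 1) * b"
  obtain S where S: "\<And>j i. j \<in> {1..k} \<Longrightarrow> i \<in> {1..k} \<Longrightarrow>
      [coeff (\<Sum>j'=1..k. smult (S j j') (pcompose (\<phi> j') [:\<eta>, 1:])) i = (if j = i then 1 else 0)]
          (mod p ^ B)"
    and S': "\<And>j i. i > k \<Longrightarrow> p dvd coeff (\<Sum>j'=1..k. smult (S j j') (pcompose (\<phi> j') [:\<eta>, 1:])) i"
    using moment_like_dual[OF p(1) phi, of \<eta> B] by blast
  define Y where "Y j = (\<Sum>j'=1..k. smult (S j j') (pcompose (\<phi> j') [:\<eta>, 1:]))" for j
  note S = S[folded Y_def] and S' = S'[folded Y_def]
  \<comment> \<open>Recentring at \<open>\<xi> = \<eta> + \<theta>\<close>: the coordinates that are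
    flat at \<open>\<eta>\<close> are now expanded where the first class lives.\<close>
  define X where "X j = pcompose (Y (k - l + j)) [:\<theta>, 1:]" for j
  define M where "M j i = coeff (X j) i" for j i
  have Ymon: "[:p:] dvd Y j - monom 1 j - [:coeff (Y j) 0:]" if j: "j \<in> {1..k}" for j
    unfolding const_poly_dvd_iff
  proof
    fix i
    consider "i = 0" | "i \<in> {1..k}" | "i > k" by force
    then show "p dvd coeff (Y j - monom 1 j - [:coeff (Y j) 0:]) i"
    proof cases
      case 1
      then show ?thesis using j by simp
    next
      case 2
      have "p dvd p ^ B" using B by simp
      with S[OF j 2] have "p dvd coeff (Y j) i - (if j = i then 1 else 0)"
        using cong_iff_dvd_diff dvd_trans by blast
      moreover have "coeff (Y j - monom 1 j - [:coeff (Y j) 0:]) i = coeff (Y j) i - (if j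
          = i then 1 else 0)"
        using 2 by (cases i) auto
      ultimately show ?thesis by simp
    next
      case 3
      then have "coeff (Y j - monom 1 j - [:coeff (Y j) 0:]) i = coeff (Y j) i"
        using j by (cases i) auto
      then show ?thesis using S'[OF 3] by (simp only:)
    qed
  qed
  have inj: "p dvd v j" if v: "\<And>i. i \<in> {1..l} \<Longrightarrow> p dvd (\<Sum>j\<in>{1..l}. v j * M j i)"
      and j: "j \<in> {1..l}" for v j
  proof (rule top_coeffs_inj[OF p l xe[folded \<theta>_def] _ j])
    fix i assume i: "i \<in> {1..l}"
    have "[M j i = coeff (pcompose (monom 1 (k - l + j)) [:\<theta>, 1:]) i] (mod p)" if "j \<in> {1..l}" for j
    proof -
      have "[:p:] dvd pcompose (Y (k - l + j) - monom 1 (k - l + j) - [:coeff (Y (k - l + j)) 0:])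
          [:\<theta>, 1:]"
        by (rule const_dvd_pcompose, rule Ymon) (use that l in auto)
      then have "[:p:] dvd X j - pcompose (monom 1 (k - l + j)) [:\<theta>, 1:] - [:coeff (Y (k - l + j))
          0:]"
        by (simp only: X_def pcompose_diff pcompose_const)
      then have "p dvd coeff (X j - pcompose (monom 1 (k - l + j)) [:\<theta>, 1:] -
          [:coeff (Y (k - l + j)) 0:]) i"
        unfolding const_poly_dvd_iff by blast
      then show ?thesis using i by (cases i) (auto simp: M_def cong_iff_dvd_diff)
    qed
    then have "[(\<Sum>j\<in>{1..l}. v j * M j i) = (\<Sum>j\<in>{1..l}. v j * coeff (pcompose (monom 1 (k - l + j))
        [:\<theta>, 1:]) i)] (mod p)"
      by (intro cong_sum cong_mult) auto
    moreover have "(\<Sum>j\<in>{1..l}. v j * coeff (pcompose (monom 1 (k - l + j)) [:\<theta>, 1:]) i)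
        = coeff (pcompose (\<Sum>j=1..l. monom (v j) (k - l + j)) [:\<theta>, 1:]) i"
    proof -
      have "(\<Sum>j=1..l. monom (v j) (k - l + j)) = (\<Sum>j=1..l. smult (v j) (monom 1 (k - l + j)))"
        by (simp add: smult_monom)
      then show ?thesis by (simp add: pcompose_sum pcompose_smult coeff_sum)
    qed
    ultimately show "p dvd coeff (pcompose (\<Sum>j=1..l. monom (v j) (k - l + j)) [:\<theta>, 1:]) i"
      using v[OF i] by (simp add: cong_dvd_iff)
  qed
  obtain T' where T': "\<forall>i\<in>{1..l}. \<forall>i'\<in>{1..l}. [(\<Sum>j\<in>{1..l}. T' i j * M j i')
      = (if i = i' then 1 else 0)] (mod p ^ B)"
    using inverse_mod_prime_power[of "{1..l}" p M B] p(1) inj by auto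
  define Z where "Z i = (\<Sum>j=1..l. smult (T' i j) (X j))" for i
  have "\<forall>i\<in>{1..l}. \<exists>\<psi>. [:p:] dvd \<psi> - monom 1 i \<and> (\<forall>m. [poly (Z i) (p ^ a * m)
      = poly (Z i) 0 + p ^ (a * i) * poly \<psi> m] (mod p ^ B))"
  proof
    fix i assume i: "i \<in> {1..l}"
    show "\<exists>\<psi>. [:p:] dvd \<psi> - monom 1 i \<and> (\<forall>m. [poly (Z i) (p ^ a * m) = poly (Z i) 0 + p ^ (a * i)
        * poly \<psi> m] (mod p ^ B))"
      by (rule rescale_poly[OF _ i a]) (use T' i in \<open>simp add: Z_def coeff_sum M_def\<close>)
  qed
  then obtain \<psi> where psi: "\<And>i. i \<in> {1..l} \<Longrightarrow> [:p:] dvd \<psi> i - monom 1 i"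
    "\<And>i m. i \<in> {1..l} \<Longrightarrow> [poly (Z i) (p ^ a * m) = poly (Z i) 0 + p ^ (a * i) * poly (\<psi> i) m]
        (mod p ^ B)"
    unfolding bchoice_iff by blast
  \<comment> \<open>The factor p^(B - L) turns constancy modulo p^L near \<open>\<eta>\<close> into
    constancy modulo p^B; p^(l a - a i) equalises the rows near \<open>\<xi>\<close>, as in
    \<open>moment_like_rescale\<close>.\<close>
  define T where "T i j = p ^ (B - L + (l * a - a * i)) * (\<Sum>j'=1..l. T' i j' * S (k - l + j') j)"
      for i j
  have Teval: "(\<Sum>j=1..k. T i j * poly (\<phi> j) (\<eta> + t)) = p ^ (B - L + (l * a - a * i)) *
      (\<Sum>j'=1..l. T' i j' * poly (Y (k - l + j')) t)" for i t
  proof -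
    have "(\<Sum>j=1..k. T i j * poly (\<phi> j) (\<eta> + t)) = p ^ (B - L + (l * a - a * i)) *
        (\<Sum>j=1..k. \<Sum>j'=1..l. T' i j' * S (k - l + j') j * poly (\<phi> j) (\<eta> + t))"
      by (simp add: T_def sum_distrib_left sum_distrib_right mult_ac)
    also have "(\<Sum>j=1..k. \<Sum>j'=1..l. T' i j' * S (k - l + j') j * poly (\<phi> j) (\<eta> + t))
        = (\<Sum>j'=1..l. T' i j' * poly (Y (k - l + j')) t)"
      by (subst sum.swap) (simp add: Y_def poly_sum poly_pcompose sum_distrib_left mult_ac)
    finally show ?thesis .
  qed
  show ?thesis
  proof (intro exI conjI ballI allI impI)
    show "moment_like p l \<psi>" using psi(1) by (simp add: moment_like_def)
  next
    fix i m assume i: "i \<in> {1..l}"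
    define e where "e = l * a - a * i"
    have e: "e + a * i = l * a" using i by (simp add: e_def mult.commute)
    have "(\<Sum>j=1..k. T i j * poly (\<phi> j) (\<eta> + (\<theta> + p ^ a * m))) = p ^ (B - L + e) * poly (Z i)
        (p ^ a * m)"
      unfolding Teval by (simp add: Z_def X_def poly_sum poly_pcompose e_def)
    also have "[\<dots> = p ^ (B - L + e) * (poly (Z i) 0 + p ^ (a * i) * poly (\<psi> i) m)] (mod p ^ B)"
      by (intro cong_mult cong_refl psi i)
    also have "p ^ (B - L + e) * (poly (Z i) 0 + p ^ (a * i) * poly (\<psi> i) m)
        = p ^ (B - L + e) * poly (Z i) 0 + p ^ (B - L + l * a) * poly (\<psi> i) m"
      by (simp add: e[symmetric] power_add ring_distribs)
    finally show "[(\<Sum>j=1..k. T i j * poly (\<phi> j) (\<xi> + p ^ a * m))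
        = p ^ (B - L + (l * a - a * i)) * poly (Z i) 0 + p ^ (B - (k - l + 1) * b + l * a)
            * poly (\<psi> i) m] (mod p ^ B)"
      by (simp add: e_def \<theta>_def L_def add.assoc)
  next
    fix i n assume i: "i \<in> {1..l}" and n: "[n = \<eta>] (mod p ^ b)"
    obtain t where t: "n = \<eta> + p ^ b * t"
      using n by (metis cong_iff_lin cong_sym)
    have Yc: "[poly (Y (k - l + j')) (p ^ b * t) = poly (Y (k - l + j')) 0] (mod p ^ L)"
        if j': "j' \<in> {1..l}" for j'
      unfolding L_def
    proof (rule poly_cong_const)
      fix i assume i: "i \<in> {1..<k - l + 1}"
      have "k - l + j' \<in> {1..k}" "i \<in> {1..k}" "k - l + j' \<noteq> i" using i j' l by auto
      with S[OF this(1,2)] have "[coeff (Y (k - l + j')) i = 0] (mod p ^ B)" by simp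
      then show "p ^ B dvd coeff (Y (k - l + j')) i" by (simp add: cong_0_iff)
    qed (rule assms)
    define D where "D x = (\<Sum>j'=1..l. T' i j' * poly (Y (k - l + j')) x)" for x
    have "[D (p ^ b * t) = D 0] (mod p ^ L)"
      unfolding D_def by (intro cong_sum cong_mult Yc) auto
    then have "p ^ B dvd p ^ (B - L) * (D (p ^ b * t) - D 0)"
    proof -
      assume "[D (p ^ b * t) = D 0] (mod p ^ L)"
      then have "p ^ L dvd D (p ^ b * t) - D 0" by (simp add: cong_iff_dvd_diff)
      then have "p ^ (B - L) * p ^ L dvd p ^ (B - L) * (D (p ^ b * t) - D 0)"
          by (rule mult_dvd_mono[OF dvd_refl])
      moreover have "p ^ (B - L) * p ^ L = p ^ B" using L by (simp add: L_def power_add[symmetric])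
      ultimately show ?thesis by simp
    qed
    then have "p ^ B dvd p ^ (l * a - a * i) * (p ^ (B - L) * (D (p ^ b * t) - D 0))"
        by (rule dvd_mult)
    then have "[p ^ (B - L + (l * a - a * i)) * D (p ^ b * t) = p ^ (B - L + (l * a - a * i))
        * D 0] (mod p ^ B)"
      by (simp add: cong_iff_dvd_diff power_add algebra_simps)
    then show "[(\<Sum>j=1..k. T i j * poly (\<phi> j) n) = p ^ (B - L + (l * a - a * i)) *
        (\<Sum>j'=1..l. T' i j' * poly (Y (k - l + j')) 0)] (mod p ^ B)"
      unfolding t Teval by (simp add: D_def)
  qed
qed

section \<open>Bilinear estimates and lower-degree decoupling\<close>

lemma sum_power_le_power_sum:
  fixes x :: "'a \<Rightarrow> real"
  assumes "finite I" "\<And>i. i \<in> I \<Longrightarrow> x i \<ge> 0" "n > 0"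
  shows "(\<Sum>i\<in>I. x i ^ n) \<le> (\<Sum>i\<in>I. x i) ^ n"
proof -
  obtain m where n: "n = Suc m" using assms(3) gr0_implies_Suc by blast
  have "(\<Sum>i\<in>I. x i ^ n) \<le> (\<Sum>i\<in>I. x i * (\<Sum>i\<in>I. x i) ^ m)"
    unfolding n power_Suc using assms
    by (intro sum_mono mult_left_mono power_mono member_le_sum) auto
  also have "\<dots> = (\<Sum>i\<in>I. x i) ^ n" by (simp add: n sum_distrib_right)
  finally show ?thesis .
qed

lemma power_sum_le_card_mult:
  fixes x :: "'a \<Rightarrow> real"
  assumes "finite I" "\<And>i. i \<in> I \<Longrightarrow> x i \<ge> 0" "n > 0"
  shows "(\<Sum>i\<in>I. x i) ^ n \<le> real (card I) ^ n * (\<Sum>i\<in>I. x i ^ n)"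
proof (cases "I = {}")
  case False
  define c where "c = real (card I)"
  have c: "c \<ge> 1" using False assms(1) by (simp add: c_def Suc_le_eq card_gt_0_iff)
  have "(\<Sum>i\<in>I. (1 / c) * x i) ^ n \<le> (\<Sum>i\<in>I. (1 / c) * x i ^ n)"
    using c assms by (intro power_sum_le_sum_power) (auto simp: c_def)
  then have "(\<Sum>i\<in>I. x i) ^ n / c ^ n \<le> (\<Sum>i\<in>I. x i ^ n) / c"
    by (simp add: sum_divide_distrib[symmetric] power_divide)
  also have "\<dots> \<le> (\<Sum>i\<in>I. x i ^ n)"
    using c divide_left_mono[of 1 c "\<Sum>i\<in>I. x i ^ n"] assms by (simp add: sum_nonneg)
  finally show ?thesis using c by (simp add: c_def divide_le_eq mult.commute)
qed (use assms in \<open>simp add: power_0_left\<close>)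

text \<open>For positive \<open>X\<close> and \<open>Y\<close> this is linearity of the exponents.
  The positivity conditions on the exponents handle \<open>X = 0\<close> or \<open>Y = 0\<close>:
  they exclude 0^0 = 1, so both sides vanish.\<close>

lemma power_interpolation:
  fixes X Y :: real
  assumes "X \<ge> 0" "Y \<ge> 0" "0 < t" "t < 1" "A > 0" "B > 0" "A1 > 0 \<or> A2 > 0" "B1 > 0 \<or> B2 > 0"
    and A: "real A = t * real A1 + (1 - t) * real A2" and B: "real B = t * real B1 + (1 - t)
        * real B2"
  shows "X ^ A * Y ^ B = (X ^ A1 * Y ^ B1) powr t * (X ^ A2 * Y ^ B2) powr (1 - t)"
proof (cases "X = 0 \<or> Y = 0")
  case True
  then show ?thesis using assms(3-8) by (auto simp: power_0_left)
next
  case False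
  then have XY: "X > 0" "Y > 0" using assms by auto
  have "(X ^ A1 * Y ^ B1) powr t * (X ^ A2 * Y ^ B2) powr (1 - t)
      = (X powr (t * real A1) * X powr ((1 - t) * real A2)) * (Y powr (t * real B1)
          * Y powr ((1 - t) * real B2))"
    using XY by (simp add: powr_mult powr_realpow[symmetric] powr_powr mult_ac)
  also have "\<dots> = X powr real A * Y powr real B"
    by (simp only: A B powr_add)
  finally show ?thesis using XY by (simp add: powr_realpow)
qed

lemma moment_empty: "d > 0 \<Longrightarrow> moment q k \<phi> c w d {} = 0"
  by (simp add: moment_def power_0_left)

lemma residue_part_twice:
  assumes "M1 dvd M" "z \<in> {0..<M1}"
  shows "residue_part (residue_part S M1 z) M \<zeta> = (if \<zeta> mod M1 = z then residue_part S M \<zeta> else {})"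
proof -
  have "[n = z] (mod M1) \<longleftrightarrow> \<zeta> mod M1 = z" if "[n = \<zeta>] (mod M)" for n
  proof -
    have "[n = \<zeta>] (mod M1)" using that assms(1) by (rule cong_dvd_modulus)
    then show ?thesis using assms(2) by (auto simp: cong_def)
  qed
  then show ?thesis by (auto simp: residue_part_def)
qed

text \<open>Each class modulo \<open>M\<close> meets only one class modulo \<open>M1\<close>, and
  empty intersections have moment zero because \<open>d > 0\<close>. This additivity lets bounds on
  classes be summed without loss.\<close>

lemma energy_split:
  assumes "M1 dvd M" "M1 > 0" "d > 0"
  shows "(\<Sum>z\<in>{0..<M1}. energy q k \<phi> c w d M (residue_part S M1 z)) = energy q k \<phi> c w d M S"
proof -
  define A where "A S = moment q k \<phi> c w d S powr (1 / real d)" for S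
  have "(\<Sum>z\<in>{0..<M1}. energy q k \<phi> c w d M (residue_part S M1 z)) = (\<Sum>z\<in>{0..<M1}. \<Sum>\<zeta>\<in>{0..<M}.
      if \<zeta> mod M1 = z then A (residue_part S M \<zeta>) else 0)"
    unfolding energy_def A_def[symmetric]
    by (intro sum.cong refl) (auto simp: residue_part_twice[OF assms(1)] A_def moment_empty[OF
        assms(3)])
  also have "\<dots> = (\<Sum>\<zeta>\<in>{0..<M}. \<Sum>z\<in>{0..<M1}. if \<zeta> mod M1 = z then A (residue_part S M \<zeta>) else 0)"
    by (rule sum.swap)
  also have "\<dots> = (\<Sum>\<zeta>\<in>{0..<M}. A (residue_part S M \<zeta>))"
    using assms(2) by (intro sum.cong) auto
  finally show ?thesis by (simp add: energy_def A_def)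
qed

lemma energy_part_le:
  assumes "M1 dvd M" "M1 > 0" "d > 0" "z \<in> {0..<M1}"
  shows "energy q k \<phi> c w d M (residue_part S M1 z) \<le> energy q k \<phi> c w d M S"
  unfolding energy_split[OF assms(1-3), symmetric, of q k \<phi> c w S]
  using assms(4) by (intro member_le_sum) (auto simp: energy_nonneg)

lemma exp_sum_split:
  assumes "finite S" "M > 0"
  shows "exp_sum q k \<phi> c S u = (\<Sum>z\<in>{0..<M}. exp_sum q k \<phi> c (residue_part S M z) u)"
proof -
  have "residue_part S M z = {n \<in> S. n mod M = z}" if "z \<in> {0..<M}" for z
    using that by (auto simp: residue_part_def cong_def)
  then have "(\<Sum>z\<in>{0..<M}. exp_sum q k \<phi> c (residue_part S M z) u)
     = (\<Sum>z\<in>{0..<M}. \<Sum>n\<in>{n \<in> S. n mod M = z}. c n * ee q (\<Sum>j=1..k. u j * poly (\<phi> j) n))"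
    by (simp add: exp_sum_def)
  also have "\<dots> = exp_sum q k \<phi> c S u"
    unfolding exp_sum_def using assms by (intro sum.group) auto
  finally show ?thesis by simp
qed

abbreviation curve_energy :: "int \<Rightarrow> nat \<Rightarrow> nat \<Rightarrow> (nat \<Rightarrow> int poly) \<Rightarrow> (int \<Rightarrow> complex) \<Rightarrow> int set \<Rightarrow>
    real" where
  "curve_energy p k N \<phi> c S \<equiv> energy (p ^ (k * N)) k \<phi> c (\<lambda>_. 1) (triangle k) (p ^ N) S"

text \<open>A class modulo \<open>p ^ a\<close> rescales to a full problem with \<open>N - a\<close>
  scales, the modulus losing exactly the factor \<open>p ^ (k * a)\<close>.\<close>

lemma decoupling_class:
  assumes p: "prime p" and k: "k > 0" and decoupling: "decoupling p k (N - a) V" and V: "V \<ge> 0"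
      and a: "a \<le> N"
    and phi: "moment_like p k \<phi>" and S: "finite S" "\<And>n. n \<in> S \<Longrightarrow> [n = \<xi>] (mod p ^ a)"
  shows "moment (p ^ (k * N)) k \<phi> c (\<lambda>_. 1) (triangle k) S \<le> V * curve_energy p k N \<phi> c S ^
      triangle k"
proof (cases "a = 0")
  case True
  then show ?thesis using decoupling phi S by (simp add: decoupling_def)
next
  case False
  then have "a \<ge> 1" by simp
  from moment_like_rescale[OF p phi this] obtain T \<psi> C where psi: "moment_like p k \<psi>" and
    T: "\<And>i m. i \<in> {1..k} \<Longrightarrow> [(\<Sum>j=1..k. T i j * poly (\<phi> j) (\<xi> + p ^ a * m)) = C i + p ^ (k * a)
        * poly (\<psi> i) m] (mod p ^ (k * N))"
    by blast
  have "a + (N - a) = N" using a by simp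
  have "moment (p ^ (k * N)) k \<phi> c (\<lambda>_. 1) (triangle k) S
      \<le> V * energy (p ^ (k * N)) k \<phi> c (\<lambda>_. 1) (triangle k) (p ^ (a + (N - a))) S ^ triangle k"
  proof (rule fibre_decoupling[OF decoupling p V k psi _ _ S(1) S(2) T])
    have "k * N = k * a + k * (N - a)" using a by (simp add: distrib_left[symmetric])
    then show "p ^ (k * N) = p ^ (k * a) * p ^ (k * (N - a))" by (simp add: power_add)
    show "p ^ (k * a) > 0" using p by (simp add: prime_gt_0_int)
  qed (auto simp: periodic_def)
  then show ?thesis using a by simp
qed

text \<open>The two exponents add up to the critical exponent k (k + 1), and the first is the
  critical exponent of degree \<open>l\<close>, so that degree \<open>l\<close> decoupling fits it.
  That \<open>p\<close> does not divide \<open>\<xi> - \<eta>\<close> is the transversality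
  condition.\<close>

definition bilinear_decoupling :: "int \<Rightarrow> nat \<Rightarrow> nat \<Rightarrow> nat \<Rightarrow> nat \<Rightarrow> nat \<Rightarrow> real \<Rightarrow> bool" where
  "bilinear_decoupling p k N l a b V \<longleftrightarrow> (\<forall>\<phi> c S S' \<xi> \<eta>. moment_like p k \<phi> \<longrightarrow> finite S \<longrightarrow> finite S' \<longrightarrow>
     (\<forall>n\<in>S. [n = \<xi>] (mod p ^ a)) \<longrightarrow> (\<forall>n\<in>S'. [n = \<eta>] (mod p ^ b)) \<longrightarrow> \<not> p dvd \<xi> - \<eta> \<longrightarrow>
     (\<Sum>u\<in>torus k (p ^ (k * N)). norm (exp_sum (p ^ (k * N)) k \<phi> c S u) ^ (2 * triangle l) *
        norm (exp_sum (p ^ (k * N)) k \<phi> c S' u) ^ (2 * (triangle k - triangle l)))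
     \<le> V * (curve_energy p k N \<phi> c S ^ triangle l * curve_energy p k N \<phi> c S' ^ (triangle k -
         triangle l)))"

lemma bilinear_decouplingD:
  assumes "bilinear_decoupling p k N l a b V" "moment_like p k \<phi>" "finite S" "finite S'"
    "\<And>n. n \<in> S \<Longrightarrow> [n = \<xi>] (mod p ^ a)" "\<And>n. n \<in> S' \<Longrightarrow> [n = \<eta>] (mod p ^ b)" "\<not> p dvd \<xi> - \<eta>"
  shows "(\<Sum>u\<in>torus k (p ^ (k * N)). norm (exp_sum (p ^ (k * N)) k \<phi> c S u) ^ (2 * triangle l) *
        norm (exp_sum (p ^ (k * N)) k \<phi> c S' u) ^ (2 * (triangle k - triangle l)))
     \<le> V * (curve_energy p k N \<phi> c S ^ triangle l * curve_energy p k N \<phi> c S' ^ (triangle k -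
         triangle l))"
  using assms unfolding bilinear_decoupling_def by blast

lemma bilinear_decouplingI:
  assumes "\<And>\<phi> c S S' \<xi> \<eta>. moment_like p k \<phi> \<Longrightarrow> finite S \<Longrightarrow> finite S' \<Longrightarrow>
     (\<And>n. n \<in> S \<Longrightarrow> [n = \<xi>] (mod p ^ a)) \<Longrightarrow> (\<And>n. n \<in> S' \<Longrightarrow> [n = \<eta>] (mod p ^ b)) \<Longrightarrow> \<not> p dvd \<xi> - \<eta> \<Longrightarrow>
     (\<Sum>u\<in>torus k (p ^ (k * N)). norm (exp_sum (p ^ (k * N)) k \<phi> c S u) ^ (2 * triangle l) *
        norm (exp_sum (p ^ (k * N)) k \<phi> c S' u) ^ (2 * (triangle k - triangle l)))
     \<le> V * (curve_energy p k N \<phi> c S ^ triangle l * curve_energy p k N \<phi> c S' ^ (triangle k -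
         triangle l))"
  shows "bilinear_decoupling p k N l a b V"
  using assms unfolding bilinear_decoupling_def by blast

lemma triangle_less: "l < k \<Longrightarrow> triangle l < triangle k"
proof -
  assume "l < k"
  then have "real l * (real l + 1) < real k * (real k + 1)" by (intro mult_strict_mono) auto
  then have "real (triangle l) < real (triangle k)" by (simp add: real_triangle)
  then show ?thesis by simp
qed

lemma not_dvd_diff_cong:
  fixes p :: int
  assumes "[n = z] (mod p)" "[n = \<xi>] (mod p)" "\<not> p dvd \<xi> - \<eta>"
  shows "\<not> p dvd z - \<eta>"
proof
  assume "p dvd z - \<eta>"
  moreover have "p dvd (n - z) - (n - \<xi>)"
    using assms(1,2) by (intro dvd_diff[of p "n - z"]) (simp_all add: cong_iff_dvd_diff)
  ultimately have "p dvd (z - \<eta>) + ((n - z) - (n - \<xi>))" by (rule dvd_add)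
  then show False using assms(3) by (simp add: algebra_simps)
qed

text \<open>The power of the second factor is the weight in \<open>fibre_decoupling\<close>,
  invariant along the directions from \<open>moment_like_project\<close>. The bilinear hypothesis is
  then applied to each class modulo \<open>p ^ e\<close> of the first set, and the pieces recombine
  by \<open>energy_split\<close>.\<close>

lemma bilinear_decouple:
  assumes p: "prime p" "int k < p" and l: "1 \<le> l" "l < k" and a: "1 \<le> a" "a \<le> e" and e: "e \<le> N"
    and eb: "l * e = (k - l + 1) * b"
    and decoupling: "decoupling p l (e - a) W" and bilinear_decoupling: "bilinear_decoupling p k N
        l e b V" and W: "W \<ge> 0" and V: "V \<ge> 0"
  shows "bilinear_decoupling p k N l a b (W * V)"
proof (rule bilinear_decouplingI)
  fix \<phi> c S S' \<xi> \<eta>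
  assume phi: "moment_like p k \<phi>" and S: "finite S" "\<And>n. n \<in> S \<Longrightarrow> [n = \<xi>] (mod p ^ a)"
    and S': "finite S'" "\<And>n. n \<in> S' \<Longrightarrow> [n = \<eta>] (mod p ^ b)" and xe: "\<not> p dvd \<xi> - \<eta>"
  have p0: "p > 0" using p by (simp add: prime_gt_0_int)
  define B where "B = k * N"
  define q where "q = p ^ B"
  define d where "d = triangle l"
  define d' where "d' = triangle k - triangle l"
  have d: "d > 0" and dk: "triangle k > 0" using l by (auto simp: d_def triangle_pos)
  have LB: "(k - l + 1) * b \<le> B"
    unfolding eb[symmetric] B_def using l e by (intro mult_mono) auto
  have B1: "B \<ge> 1" using l a e by (auto simp: B_def Suc_le_eq)
  define w where "w u = norm (exp_sum q k \<phi> c S' u) ^ (2 * d')" for u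
  from moment_like_project[OF p phi a(1) less_imp_le[OF l(2)] xe LB B1] obtain T \<psi> C C' where psi:
      "moment_like p l \<psi>"
    and T: "\<And>i m. i \<in> {1..l} \<Longrightarrow> [(\<Sum>j=1..k. T i j * poly (\<phi> j) (\<xi> + p ^ a * m))
        = C i + p ^ (B - (k - l + 1) * b + l * a) * poly (\<psi> i) m] (mod p ^ B)"
    and T': "\<And>i n. i \<in> {1..l} \<Longrightarrow> [n = \<eta>] (mod p ^ b) \<Longrightarrow>
       [(\<Sum>j=1..k. T i j * poly (\<phi> j) n) = C' i] (mod p ^ B)"
    by blast
  have "moment q k \<phi> c w d S \<le> W * energy q k \<phi> c w d (p ^ (a + (e - a))) S ^ d"
    unfolding d_def
  proof (rule fibre_decoupling[OF decoupling p(1) W _ psi _ _ S(1) S(2) T[folded q_def]])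
    \<comment> \<open>By \<open>eb\<close>, the precision to which the second factor is constant
      equals the precision \<open>l * e\<close> that degree \<open>l\<close> decoupling down to
      scale \<open>e\<close> consumes, so the modulus factors exactly.\<close>
    have "B - (k - l + 1) * b + l * a + l * (e - a) = B"
      unfolding eb[symmetric] diff_mult_distrib2
      using LB[unfolded eb[symmetric]] mult_le_mono2[OF a(2), of l] by linarith
    then show "q = p ^ (B - (k - l + 1) * b + l * a) * p ^ (l * (e - a))"
      by (simp add: q_def power_add[symmetric])
    show "p ^ (B - (k - l + 1) * b + l * a) > 0" using p0 by simp
    show "periodic k q w"
      using periodic_exp_sum[of k q \<phi> c S'] unfolding periodic_def w_def by metis
    show "w u \<ge> 0" for u by (simp add: w_def)
    show "w (\<lambda>j. u j + (\<Sum>i = 1..l. h i * T i j)) = w u" for u h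
    proof -
      have "exp_sum q k \<phi> c S' (\<lambda>j. u j + (\<Sum>i = 1..l. h i * T i j))
          = ee q (\<Sum>i=1..l. h i * C' i) * (\<Sum>n\<in>S'. c n * ee q (\<Sum>j=1..k. u j * poly (\<phi> j) n) * ee q 0)"
      proof (rule exp_sum_shift)
        fix n assume n: "n \<in> S'"
        have "(\<Sum>j=1..k. (\<Sum>i=1..l. h i * T i j) * poly (\<phi> j) n)
            = (\<Sum>i=1..l. h i * (\<Sum>j=1..k. T i j * poly (\<phi> j) n))"
          unfolding sum_distrib_left sum_distrib_right by (subst sum.swap) (simp add: mult_ac)
        also have "[\<dots> = (\<Sum>i=1..l. h i * C' i)] (mod q)"
          unfolding q_def using S'(2)[OF n] by (intro cong_sum cong_mult T') auto
        finally show "[(\<Sum>j=1..k. (\<Sum>i=1..l. h i * T i j) * poly (\<phi> j) n) = (\<Sum>i=1..l. h i * C' i)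
            + 0] (mod q)"
          by simp
      qed
      then show ?thesis by (simp add: w_def norm_mult ee_dvd) (simp add: exp_sum_def)
    qed
  qed (use l in auto)
  also have "a + (e - a) = e" using a by simp
  also have "W * energy q k \<phi> c w d (p ^ e) S ^ d \<le>
      W * ((V * curve_energy p k N \<phi> c S' ^ d') powr (1 / real d) * curve_energy p k N \<phi> c S) ^ d"
  proof (intro mult_left_mono power_mono W energy_nonneg)
    have "energy q k \<phi> c w d (p ^ e) S \<le>
      (\<Sum>z\<in>{0..<p ^ e}. (V * curve_energy p k N \<phi> c S' ^ d') powr (1 / real d) * curve_energy p k N
          \<phi> c (residue_part S (p ^ e) z))"
      unfolding energy_def[of q k \<phi> c w]
    proof (rule sum_mono)
      fix z assume z: "z \<in> {0..<p ^ e}"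
      define R where "R = residue_part S (p ^ e) z"
      show "moment q k \<phi> c w d (residue_part S (p ^ e) z) powr (1 / real d) \<le>
        (V * curve_energy p k N \<phi> c S' ^ d') powr (1 / real d) * curve_energy p k N \<phi> c
            (residue_part S (p ^ e) z)"
        unfolding R_def[symmetric]
      proof (cases "R = {}")
        case True
        then show "moment q k \<phi> c w d R powr (1 / real d) \<le> (V * curve_energy p k N \<phi> c S' ^ d')
            powr (1 / real d) * curve_energy p k N \<phi> c R"
          using d by (simp add: moment_empty energy_nonneg)
      next
        case False
        \<comment> \<open>A common element shows that \<open>z\<close> and \<open>\<xi>\<close>
          agree modulo \<open>p\<close>, so transversality passes to the subclass.\<close>
        then obtain n where n: "n \<in> S" "[n = z] (mod p ^ e)" by (auto simp: R_def residue_part_def)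
        have nz: "[n = z] (mod p)" by (rule cong_dvd_modulus[OF n(2)]) (use a in auto)
        have "[n = \<xi>] (mod p)" by (rule cong_dvd_modulus[OF S(2)[OF n(1)]]) (use a in auto)
        from not_dvd_diff_cong[OF nz this xe] have ze: "\<not> p dvd z - \<eta>" .
        have "(\<Sum>u\<in>torus k q. norm (exp_sum q k \<phi> c R u) ^ (2 * d) * w u)
            \<le> V * (curve_energy p k N \<phi> c R ^ d * curve_energy p k N \<phi> c S' ^ d')"
          unfolding w_def q_def B_def d_def d'_def
          by (rule bilinear_decouplingD[OF bilinear_decoupling phi _ S'(1) _ S'(2) ze])
              (use S(1) in \<open>auto simp: R_def residue_part_def\<close>)
        then have "moment q k \<phi> c w d R \<le> V * (curve_energy p k N \<phi> c R ^ d * curve_energy p k N \<phi>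
            c S' ^ d')"
          by (simp only: moment_def mult.commute[of "w _"])
        then have "moment q k \<phi> c w d R powr (1 / real d)
            \<le> (V * (curve_energy p k N \<phi> c R ^ d * curve_energy p k N \<phi> c S' ^ d')) powr
            (1 / real d)"
          by (intro powr_mono2) (auto intro!: moment_nonneg simp: w_def)
        also have "\<dots> = (V * curve_energy p k N \<phi> c S' ^ d') powr (1 / real d)
            * (curve_energy p k N \<phi> c R ^ d) powr (1 / real d)"
          using V by (simp add: powr_mult energy_nonneg mult_ac)
        also have "(curve_energy p k N \<phi> c R ^ d) powr (1 / real d) = curve_energy p k N \<phi> c R"
          using d by (simp add: energy_nonneg powr_realpow'[symmetric] powr_powr)
        finally show "moment q k \<phi> c w d R powr (1 / real d)
            \<le> (V * curve_energy p k N \<phi> c S' ^ d') powr (1 / real d) * curve_energy p k N \<phi> c R" .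
      qed
    qed
    also have "\<dots> = (V * curve_energy p k N \<phi> c S' ^ d') powr (1 / real d) * curve_energy p k N \<phi> c
        S"
      unfolding sum_distrib_left[symmetric] using p0 e dk
          by (subst energy_split) (auto intro: le_imp_power_dvd)
    finally show "energy q k \<phi> c w d (p ^ e) S \<le> (V * curve_energy p k N \<phi> c S' ^ d') powr
        (1 / real d) * curve_energy p k N \<phi> c S" .
  qed
  also have "\<dots> = W * V * (curve_energy p k N \<phi> c S ^ d * curve_energy p k N \<phi> c S' ^ d')"
    using d V by (simp add: power_mult_distrib powr_inverse_power energy_nonneg)
  finally have "(\<Sum>u\<in>torus k q. norm (exp_sum q k \<phi> c S u) ^ (2 * d) * w u) \<le> \<dots>"
    by (simp only: moment_def mult.commute[of "w _"])
  then show "(\<Sum>u\<in>torus k (p ^ (k * N)). norm (exp_sum (p ^ (k * N)) k \<phi> c S u) ^ (2 * triangle l) *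
        norm (exp_sum (p ^ (k * N)) k \<phi> c S' u) ^ (2 * (triangle k - triangle l)))
     \<le> W * V * (curve_energy p k N \<phi> c S ^ triangle l * curve_energy p k N \<phi> c S' ^ (triangle k -
         triangle l))"
    by (simp only: w_def q_def B_def d_def d'_def)
qed

section \<open>Interpolation and the broad-narrow reduction\<close>

lemma decoupling_mono:
  assumes "decoupling p k N V" "V \<le> V'"
  shows "decoupling p k N V'"
  unfolding decoupling_def
proof (intro allI impI)
  fix \<phi> c S assume "moment_like p k \<phi>" "finite (S :: int set)"
  then have "moment (p ^ (k * N)) k \<phi> c (\<lambda>_. 1) (triangle k) S \<le> V * curve_energy p k N \<phi> c S ^
      triangle k"
    using assms(1) by (simp add: decoupling_def)
  also have "\<dots> \<le> V' * curve_energy p k N \<phi> c S ^ triangle k"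
    using assms(2) by (intro mult_right_mono) (simp_all add: energy_nonneg)
  finally show "moment (p ^ (k * N)) k \<phi> c (\<lambda>_. 1) (triangle k) S \<le> V' * curve_energy p k N \<phi> c S
      ^ triangle k" .
qed

lemma bilinear_mono:
  assumes "bilinear_decoupling p k N l a b V" "V \<le> V'"
  shows "bilinear_decoupling p k N l a b V'"
proof (rule bilinear_decouplingI)
  fix \<phi> c S S' \<xi> \<eta>
  assume *: "moment_like p k \<phi>" "finite S" "finite S'" "\<And>n. n \<in> S \<Longrightarrow> [n = \<xi>] (mod p ^ a)"
    "\<And>n. n \<in> S' \<Longrightarrow> [n = \<eta>] (mod p ^ b)" "\<not> p dvd \<xi> - \<eta>"
  note bilinear_decouplingD[OF assms(1) this, of c]
  also have "V * (curve_energy p k N \<phi> c S ^ triangle l * curve_energy p k N \<phi> c S' ^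
      (triangle k - triangle l))
     \<le> V' * (curve_energy p k N \<phi> c S ^ triangle l * curve_energy p k N \<phi> c S' ^ (triangle k -
         triangle l))"
    by (intro mult_right_mono assms(2)) (simp add: energy_nonneg)
  finally show "(\<Sum>u\<in>torus k (p ^ (k * N)). norm (exp_sum (p ^ (k * N)) k \<phi> c S u) ^ (2 * triangle
      l) *
        norm (exp_sum (p ^ (k * N)) k \<phi> c S' u) ^ (2 * (triangle k - triangle l)))
     \<le> V' * (curve_energy p k N \<phi> c S ^ triangle l * curve_energy p k N \<phi> c S' ^ (triangle k -
         triangle l))" by simp
qed

text \<open>With the roles of the two sets exchanged, index \<open>k - l\<close> puts the exponent
  \<open>triangle k - triangle (k - l)\<close> on the first sum. It exceeds
  \<open>triangle (l - 1)\<close> by l (k - l + 1), while \<open>triangle l\<close> exceeds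
  \<open>triangle (l - 1)\<close> by l; this fixes the weight \<open>t\<close>.\<close>

lemma bilinear_Holder:
  assumes l: "1 \<le> l" "l < k" and 1: "bilinear_decoupling p k N (k - l) b e V1"
      and 2: "bilinear_decoupling p k N (l - 1) e b V2"
    and V: "V1 \<ge> 0" "V2 \<ge> 0" and t: "t = 1 / real (k - l + 1)"
  shows "bilinear_decoupling p k N l e b (V1 powr t * V2 powr (1 - t))"
proof (rule bilinear_decouplingI)
  fix \<phi> c S S' \<xi> \<eta>
  assume phi: "moment_like p k \<phi>" and S: "finite S" "\<And>n. n \<in> S \<Longrightarrow> [n = \<xi>] (mod p ^ e)"
    and S': "finite S'" "\<And>n. n \<in> S' \<Longrightarrow> [n = \<eta>] (mod p ^ b)" and xe: "\<not> p dvd \<xi> - \<eta>"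
  define q where "q = p ^ (k * N)"
  define d where "d = triangle k"
  define X where "X u = norm (exp_sum q k \<phi> c S u)" for u
  define Y where "Y u = norm (exp_sum q k \<phi> c S' u)" for u
  define x where "x = curve_energy p k N \<phi> c S"
  define y where "y = curve_energy p k N \<phi> c S'"
  have xy: "x \<ge> 0" "y \<ge> 0" by (simp_all add: x_def y_def energy_nonneg)
  have XY: "X u \<ge> 0" "Y u \<ge> 0" for u by (simp_all add: X_def Y_def)
  have t01: "0 < t" "t < 1" using l by (auto simp: t)
  have lt: "triangle l < d" "triangle (l - 1) < d" "triangle (k - l) < d" "0 < triangle l" "0
      < triangle (k - l)"
    using l by (auto simp: d_def triangle_less triangle_pos)
  have kl: "real (k - l + 1) = real k - real l + 1" using l by simp
  have tt: "t * (real k - real l + 1) = 1" using l by (simp add: t kl)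
  have A: "real (triangle l) = t * real (d - triangle (k - l)) + (1 - t) * real (triangle (l - 1))"
  proof -
    have "real (d - triangle (k - l)) - real (triangle (l - 1)) = real l * (real k - real l + 1)"
      using lt l by (simp add: of_nat_diff d_def real_triangle field_simps)
    then have "t * (real (d - triangle (k - l)) - real (triangle (l - 1)))
        = real l * (t * (real k - real l + 1))"
      by (simp add: mult_ac)
    moreover have "real (triangle l) - real (triangle (l - 1)) = real l"
      using l by (simp add: of_nat_diff real_triangle field_simps)
    ultimately show ?thesis unfolding tt by (simp add: algebra_simps)
  qed
  have B: "real (d - triangle l) = t * real (triangle (k - l)) + (1 - t)
      * real (d - triangle (l - 1))"
    using A lt by (simp add: of_nat_diff algebra_simps)
  have 1: "(\<Sum>u\<in>torus k q. Y u ^ (2 * triangle (k - l)) * X u ^ (2 * (d - triangle (k - l))))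
      \<le> V1 * (y ^ triangle (k - l) * x ^ (d - triangle (k - l)))"
    unfolding X_def Y_def q_def d_def x_def y_def
    by (rule bilinear_decouplingD[OF 1 phi S'(1) S(1) S'(2) S(2)]) (use xe in \<open>auto simp:
        dvd_diff_commute\<close>)
  have 2: "(\<Sum>u\<in>torus k q. X u ^ (2 * triangle (l - 1)) * Y u ^ (2 * (d - triangle (l - 1))))
      \<le> V2 * (x ^ triangle (l - 1) * y ^ (d - triangle (l - 1)))"
    unfolding X_def Y_def q_def d_def x_def y_def
    by (rule bilinear_decouplingD[OF 2 phi S(1) S'(1) S(2) S'(2) xe])
  have "(\<Sum>u\<in>torus k q. X u ^ (2 * triangle l) * Y u ^ (2 * (d - triangle l)))
     = (\<Sum>u\<in>torus k q. (Y u ^ (2 * triangle (k - l)) * X u ^ (2 * (d - triangle (k - l)))) powr t *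
           (X u ^ (2 * triangle (l - 1)) * Y u ^ (2 * (d - triangle (l - 1)))) powr (1 - t))"
  proof (rule sum.cong)
    fix u
    show "X u ^ (2 * triangle l) * Y u ^ (2 * (d - triangle l))
        = (Y u ^ (2 * triangle (k - l)) * X u ^ (2 * (d - triangle (k - l)))) powr t *
           (X u ^ (2 * triangle (l - 1)) * Y u ^ (2 * (d - triangle (l - 1)))) powr (1 - t)"
      unfolding mult.commute[of "Y u ^ (2 * triangle (k - l))"]
      using A B lt by (intro power_interpolation XY t01) (auto simp: algebra_simps)
  qed simp
  also have "\<dots> \<le> (\<Sum>u\<in>torus k q. Y u ^ (2 * triangle (k - l)) * X u ^ (2 * (d - triangle (k - l))))
      powr t *
      (\<Sum>u\<in>torus k q. X u ^ (2 * triangle (l - 1)) * Y u ^ (2 * (d - triangle (l - 1)))) powr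
          (1 - t)"
    using XY by (intro Holder_sum t01) auto
  also have "\<dots> \<le> (V1 * (y ^ triangle (k - l) * x ^ (d - triangle (k - l)))) powr t
      * (V2 * (x ^ triangle (l - 1) * y ^ (d - triangle (l - 1)))) powr (1 - t)"
    using t01 XY by (intro mult_mono powr_mono2 1 2) (auto intro!: sum_nonneg)
  also have "\<dots> = V1 powr t * V2 powr (1 - t) *
     ((x ^ (d - triangle (k - l)) * y ^ triangle (k - l)) powr t * (x ^ triangle (l - 1)
         * y ^ (d - triangle (l - 1))) powr (1 - t))"
    using V xy by (simp add: powr_mult mult_ac)
  also have "(x ^ (d - triangle (k - l)) * y ^ triangle (k - l)) powr t * (x ^ triangle (l - 1)
      * y ^ (d - triangle (l - 1))) powr (1 - t)
     = x ^ triangle l * y ^ (d - triangle l)"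
    using lt by (intro power_interpolation[symmetric] xy t01 A B) auto
  finally show "(\<Sum>u\<in>torus k (p ^ (k * N)). norm (exp_sum (p ^ (k * N)) k \<phi> c S u) ^ (2 * triangle
      l) *
        norm (exp_sum (p ^ (k * N)) k \<phi> c S' u) ^ (2 * (triangle k - triangle l)))
     \<le> V1 powr t * V2 powr (1 - t) * (curve_energy p k N \<phi> c S ^ triangle l * curve_energy p k N \<phi>
         c S' ^ (triangle k - triangle l))"
    by (simp add: X_def Y_def x_def y_def q_def d_def)
qed

text \<open>At index 0 the first factor has exponent zero, so a second class modulo
  \<open>p ^ b\<close> is estimated by rescaling alone. The missing \<open>b\<close> scales are the
  source of all savings.\<close>

lemma bilinear_zero:
  assumes p: "prime p" and k: "k > 0" and decoupling: "decoupling p k (N - b) V" and V: "V \<ge> 0"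
      and b: "b \<le> N"
  shows "bilinear_decoupling p k N 0 a b V"
proof (rule bilinear_decouplingI)
  fix \<phi> c S S' \<xi> \<eta>
  assume "moment_like p k \<phi>" "finite S'" "\<And>n. n \<in> S' \<Longrightarrow> [n = \<eta>] (mod p ^ b)"
  from decoupling_class[OF p k decoupling V b this]
  show "(\<Sum>u\<in>torus k (p ^ (k * N)). norm (exp_sum (p ^ (k * N)) k \<phi> c S u) ^ (2 * triangle 0) *
        norm (exp_sum (p ^ (k * N)) k \<phi> c S' u) ^ (2 * (triangle k - triangle 0)))
     \<le> V * (curve_energy p k N \<phi> c S ^ triangle 0 * curve_energy p k N \<phi> c S' ^ (triangle k -
         triangle 0))"
    by (simp add: moment_def triangle_def)
qed

text \<open>Hoelder separates the two factors completely. This starts the iteration, with no saving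
  for positive index.\<close>

lemma bilinear_trivial:
  assumes p: "prime p" and l: "1 \<le> l" "l < k"
    and 1: "decoupling p k (N - a) V1" and 2: "decoupling p k (N - b) V2"
    and V: "V1 \<ge> 0" "V2 \<ge> 0" and ab: "a \<le> N" "b \<le> N" and t: "t
        = real (triangle l) / real (triangle k)"
  shows "bilinear_decoupling p k N l a b (V1 powr t * V2 powr (1 - t))"
proof (rule bilinear_decouplingI)
  fix \<phi> c S S' \<xi> \<eta>
  assume phi: "moment_like p k \<phi>" and S: "finite S" "\<And>n. n \<in> S \<Longrightarrow> [n = \<xi>] (mod p ^ a)"
    and S': "finite S'" "\<And>n. n \<in> S' \<Longrightarrow> [n = \<eta>] (mod p ^ b)"
  define q where "q = p ^ (k * N)"
  define d where "d = triangle k"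
  define X where "X u = norm (exp_sum q k \<phi> c S u)" for u
  define Y where "Y u = norm (exp_sum q k \<phi> c S' u)" for u
  define x where "x = curve_energy p k N \<phi> c S"
  define y where "y = curve_energy p k N \<phi> c S'"
  have xy: "x \<ge> 0" "y \<ge> 0" by (simp_all add: x_def y_def energy_nonneg)
  have XY: "X u \<ge> 0" "Y u \<ge> 0" for u by (simp_all add: X_def Y_def)
  have lt: "triangle l < d" "0 < triangle l" "0 < d"
    using l by (auto simp: d_def triangle_less triangle_pos)
  then have t01: "0 < t" "t < 1" by (auto simp: t d_def)
  have A: "real (triangle l) = t * real d + (1 - t) * real 0"
    and B: "real (d - triangle l) = t * real 0 + (1 - t) * real d"
    using lt by (simp_all add: t d_def of_nat_diff field_simps)
  have k: "k > 0" using l by simp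
  have 1: "(\<Sum>u\<in>torus k q. X u ^ (2 * d) * Y u ^ (2 * 0)) \<le> V1 * (x ^ d * y ^ 0)"
    using decoupling_class[OF p k 1 V(1) ab(1) phi S]
        by (simp add: X_def moment_def q_def d_def x_def)
  have 2: "(\<Sum>u\<in>torus k q. X u ^ (2 * 0) * Y u ^ (2 * d)) \<le> V2 * (x ^ 0 * y ^ d)"
    using decoupling_class[OF p k 2 V(2) ab(2) phi S']
        by (simp add: Y_def moment_def q_def d_def y_def)
  have "(\<Sum>u\<in>torus k q. X u ^ (2 * triangle l) * Y u ^ (2 * (d - triangle l)))
     = (\<Sum>u\<in>torus k q. (X u ^ (2 * d) * Y u ^ (2 * 0)) powr t * (X u ^ (2 * 0) * Y u ^ (2 * d))
         powr (1 - t))"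
    using A B lt by (intro sum.cong power_interpolation XY t01) (auto simp: algebra_simps)
  also have "\<dots> \<le> (\<Sum>u\<in>torus k q. X u ^ (2 * d) * Y u ^ (2 * 0)) powr t *
      (\<Sum>u\<in>torus k q. X u ^ (2 * 0) * Y u ^ (2 * d)) powr (1 - t)"
    using XY by (intro Holder_sum t01) auto
  also have "\<dots> \<le> (V1 * (x ^ d * y ^ 0)) powr t * (V2 * (x ^ 0 * y ^ d)) powr (1 - t)"
    using t01 XY by (intro mult_mono powr_mono2 1 2) (auto intro!: sum_nonneg)
  also have "\<dots> = V1 powr t * V2 powr (1 - t) * ((x ^ d * y ^ 0) powr t * (x ^ 0 * y ^ d) powr
      (1 - t))"
    using V xy by (simp add: powr_mult mult_ac)
  also have "(x ^ d * y ^ 0) powr t * (x ^ 0 * y ^ d) powr (1 - t)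
      = x ^ triangle l * y ^ (d - triangle l)"
    using lt by (intro power_interpolation[symmetric] xy t01 A B) auto
  finally show "(\<Sum>u\<in>torus k (p ^ (k * N)). norm (exp_sum (p ^ (k * N)) k \<phi> c S u) ^ (2 * triangle
      l) *
        norm (exp_sum (p ^ (k * N)) k \<phi> c S' u) ^ (2 * (triangle k - triangle l)))
     \<le> V1 powr t * V2 powr (1 - t) * (curve_energy p k N \<phi> c S ^ triangle l * curve_energy p k N \<phi>
         c S' ^ (triangle k - triangle l))"
    by (simp add: X_def Y_def x_def y_def q_def d_def)
qed

section \<open>Crude changes of scale and the broad-narrow reduction\<close>

lemma norm_sum_power_le:
  fixes f :: "'a \<Rightarrow> complex"
  assumes "finite I" "n > 0"
  shows "norm (\<Sum>i\<in>I. f i) ^ n \<le> real (card I) ^ n * (\<Sum>i\<in>I. norm (f i) ^ n)"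
proof -
  have "norm (\<Sum>i\<in>I. f i) ^ n \<le> (\<Sum>i\<in>I. norm (f i)) ^ n"
    by (intro power_mono norm_sum) auto
  also have "\<dots> \<le> real (card I) ^ n * (\<Sum>i\<in>I. norm (f i) ^ n)"
    using assms by (intro power_sum_le_card_mult) auto
  finally show ?thesis .
qed

text \<open>Used with \<open>b0 = 1\<close> to return from a fine second class to the classes modulo
  \<open>p\<close> of the broad-narrow step. The loss comes from the power of a sum of
  \<open>p ^ b\<close> terms, plus one factor \<open>p ^ b\<close> for bounding the energy of each
  class by the whole.\<close>

lemma bilinear_refine:
  assumes p: "prime p" and l: "1 \<le> l" "l < k" and b: "b0 \<le> b" "1 \<le> b0" "b \<le> N"
    and bilinear_decoupling: "bilinear_decoupling p k N l a b V" and V: "V \<ge> 0"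
  shows "bilinear_decoupling p k N l a b0 (real_of_int (p ^ b) ^ (2 * triangle k + 1) * V)"
proof (rule bilinear_decouplingI)
  fix \<phi> c S S' \<xi> \<eta>
  assume phi: "moment_like p k \<phi>" and S: "finite S" "\<And>n. n \<in> S \<Longrightarrow> [n = \<xi>] (mod p ^ a)"
    and S': "finite S'" "\<And>n. n \<in> S' \<Longrightarrow> [n = \<eta>] (mod p ^ b0)" and xe: "\<not> p dvd \<xi> - \<eta>"
  have p0: "p > 0" using p by (simp add: prime_gt_0_int)
  define q where "q = p ^ (k * N)"
  define Q where "Q = triangle k - triangle l"
  define M where "M = p ^ b"
  have M: "M > 0" "real_of_int M \<ge> 1" using p0 by (auto simp: M_def)
  have MN: "M dvd p ^ N" using b by (auto simp: M_def intro: le_imp_power_dvd)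
  have Q: "Q > 0" "Q \<le> triangle k" using triangle_less[OF l(2)] by (auto simp: Q_def)
  have dk: "triangle k > 0" using l by (simp add: triangle_pos)
  define X where "X u = norm (exp_sum q k \<phi> c S u) ^ (2 * triangle l)" for u
  define Y where "Y z u = norm (exp_sum q k \<phi> c (residue_part S' M z) u) ^ (2 * Q)" for z u
  define x where "x = curve_energy p k N \<phi> c S ^ triangle l"
  define y where "y = curve_energy p k N \<phi> c S' ^ Q"
  have x0: "x \<ge> 0" "y \<ge> 0" by (auto simp: x_def y_def energy_nonneg)
  have each: "(\<Sum>u\<in>torus k q. X u * Y z u) \<le> V * (x * y)" if z: "z \<in> {0..<M}" for z
  proof (cases "residue_part S' M z = {}")
    case True
    then have "Y z u = 0" for u using Q by (simp add: Y_def power_0_left)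
    then show ?thesis using V x0 by simp
  next
    case False
    then obtain n where n: "n \<in> S'" "[n = z] (mod M)" by (auto simp: residue_part_def)
    have nz: "[n = z] (mod p)" by (rule cong_dvd_modulus[OF n(2)]) (use b in \<open>auto simp: M_def\<close>)
    have "[n = \<eta>] (mod p)" by (rule cong_dvd_modulus[OF S'(2)[OF n(1)]]) (use b in auto)
    from not_dvd_diff_cong[OF nz this, of \<xi>] xe have ze: "\<not> p dvd \<xi> - z"
      by (simp add: dvd_diff_commute)
    have "(\<Sum>u\<in>torus k q. X u * Y z u) \<le> V * (x * curve_energy p k N \<phi> c (residue_part S' M z) ^ Q)"
      unfolding X_def Y_def x_def q_def Q_def
      by (rule bilinear_decouplingD[OF bilinear_decoupling phi S(1) _ S(2) _ ze]) (use S' in \<open>auto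
          simp: residue_part_def M_def\<close>)
    also have "\<dots> \<le> V * (x * y)"
      unfolding y_def using V x0 M MN dk z
      by (intro mult_left_mono power_mono energy_part_le energy_nonneg) auto
    finally show ?thesis .
  qed
  have "(\<Sum>u\<in>torus k q. X u * norm (exp_sum q k \<phi> c S' u) ^ (2 * Q))
     \<le> (\<Sum>u\<in>torus k q. X u * (real_of_int M ^ (2 * Q) * (\<Sum>z\<in>{0..<M}. Y z u)))"
  proof (intro sum_mono mult_left_mono)
    fix u
    have "norm (\<Sum>z\<in>{0..<M}. exp_sum q k \<phi> c (residue_part S' M z) u) ^ (2 * Q)
      \<le> real (card {0..<M}) ^ (2 * Q) * (\<Sum>z\<in>{0..<M}. norm (exp_sum q k \<phi> c (residue_part S' M z)
          u) ^ (2 * Q))"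
      using Q by (intro norm_sum_power_le) auto
    then show "norm (exp_sum q k \<phi> c S' u) ^ (2 * Q) \<le> real_of_int M ^ (2 * Q) *
        (\<Sum>z\<in>{0..<M}. Y z u)"
      using M S' by (simp add: exp_sum_split[symmetric] Y_def)
  qed (simp add: X_def)
  also have "\<dots> = real_of_int M ^ (2 * Q) * (\<Sum>z\<in>{0..<M}. \<Sum>u\<in>torus k q. X u * Y z u)"
    unfolding sum_distrib_left by (subst sum.swap) (simp add: mult_ac)
  also have "\<dots> \<le> real_of_int M ^ (2 * Q) * (\<Sum>z\<in>{0..<M}. V * (x * y))"
    using M by (intro mult_left_mono sum_mono each) auto
  also have "\<dots> = real_of_int M ^ (2 * Q + 1) * (V * (x * y))"
    using M by simp
  also have "\<dots> \<le> real_of_int M ^ (2 * triangle k + 1) * (V * (x * y))"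
    using M Q V x0 by (intro mult_right_mono power_increasing) auto
  finally show "(\<Sum>u\<in>torus k (p ^ (k * N)). norm (exp_sum (p ^ (k * N)) k \<phi> c S u) ^ (2 * triangle
      l) *
        norm (exp_sum (p ^ (k * N)) k \<phi> c S' u) ^ (2 * (triangle k - triangle l)))
     \<le> real_of_int (p ^ b) ^ (2 * triangle k + 1) * V * (curve_energy p k N \<phi> c S ^ triangle l
         * curve_energy p k N \<phi> c S' ^ (triangle k - triangle l))"
    by (simp add: X_def x_def y_def q_def Q_def M_def mult_ac)
qed

lemma sum_moment_le_energy:
  assumes "M > 0" "d > 0"
  shows "(\<Sum>z\<in>{0..<M}. moment q k \<phi> c (\<lambda>_. 1) d (residue_part S M z))
      \<le> energy q k \<phi> c (\<lambda>_. 1) d M S ^ d"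
proof -
  have "(\<Sum>z\<in>{0..<M}. moment q k \<phi> c (\<lambda>_. 1) d (residue_part S M z))
    = (\<Sum>z\<in>{0..<M}. (moment q k \<phi> c (\<lambda>_. 1) d (residue_part S M z) powr (1 / real d)) ^ d)"
    using assms by (simp add: powr_inverse_power moment_nonneg)
  also have "\<dots> \<le> energy q k \<phi> c (\<lambda>_. 1) d M S ^ d"
    unfolding energy_def using assms by (intro sum_power_le_power_sum) auto
  finally show ?thesis .
qed

text \<open>The triangle inequality over \<open>p ^ N\<close> classes. It provides a finite exponent
  to start from and covers small \<open>N\<close> in the recursion.\<close>

lemma decoupling_trivial:
  assumes p: "prime p" and k: "k > 0"
  shows "decoupling p k N (real_of_int p ^ (2 * triangle k * N))"
  unfolding decoupling_def
proof (intro allI impI)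
  fix \<phi> c S assume S: "finite (S :: int set)"
  have p0: "p > 0" using p by (simp add: prime_gt_0_int)
  define q where "q = p ^ (k * N)"
  define d where "d = triangle k"
  have d: "d > 0" using k by (simp add: d_def triangle_pos)
  define M where "M = p ^ N"
  have M: "M > 0" using p0 by (simp add: M_def)
  have "moment q k \<phi> c (\<lambda>_. 1) d S \<le> (\<Sum>u\<in>torus k q. real_of_int M ^ (2 * d) *
      (\<Sum>z\<in>{0..<M}. norm (exp_sum q k \<phi> c (residue_part S M z) u) ^ (2 * d)))"
    unfolding moment_def
  proof (intro sum_mono)
    fix u
    have "norm (\<Sum>z\<in>{0..<M}. exp_sum q k \<phi> c (residue_part S M z) u) ^ (2 * d)
      \<le> real (card {0..<M}) ^ (2 * d) * (\<Sum>z\<in>{0..<M}. norm (exp_sum q k \<phi> c (residue_part S M z) u)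
          ^ (2 * d))"
      using d by (intro norm_sum_power_le) auto
    then show "1 * norm (exp_sum q k \<phi> c S u) ^ (2 * d) \<le> real_of_int M ^ (2 * d) *
        (\<Sum>z\<in>{0..<M}. norm (exp_sum q k \<phi> c (residue_part S M z) u) ^ (2 * d))"
      using M S by (simp add: exp_sum_split[symmetric])
  qed
  also have "\<dots> = real_of_int M ^ (2 * d) * (\<Sum>z\<in>{0..<M}. moment q k \<phi> c (\<lambda>_. 1) d (residue_part S M
      z))"
    unfolding sum_distrib_left moment_def by (subst sum.swap) simp
  also have "\<dots> \<le> real_of_int M ^ (2 * d) * energy q k \<phi> c (\<lambda>_. 1) d M S ^ d"
    using M d by (intro mult_left_mono sum_moment_le_energy) auto
  finally show "moment (p ^ (k * N)) k \<phi> c (\<lambda>_. 1) (triangle k) S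
      \<le> real_of_int p ^ (2 * triangle k * N) * curve_energy p k N \<phi> c S ^ triangle k"
    by (simp add: q_def d_def M_def power_mult[symmetric] mult.commute)
qed

text \<open>
  The diagonal term has constant \<open>1 + \<epsilon>\<close>, not merely a bounded one, so that the recursion in \<open>N\<close>
  loses nothing even though \<open>p\<close> stays fixed.
\<close>
lemma broad_narrow:
  fixes \<epsilon> :: real
  assumes e: "\<epsilon> > 0" and n: "n > 0" and AB: "A + B > 0"
  obtains K where "K \<ge> 0" "\<And>(y :: 'a \<Rightarrow> complex) I. finite I \<Longrightarrow> card I = n \<Longrightarrow>
     norm (\<Sum>i\<in>I. y i) ^ (A + B) \<le> (1 + \<epsilon>) * (\<Sum>i\<in>I. norm (y i) ^ (A + B))
        + K * (\<Sum>i\<in>I. \<Sum>j\<in>I - {i}. norm (y i) ^ A * norm (y j) ^ B)"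
proof -
  define D where "D = A + B"
  define \<delta> where "\<delta> = (1 + \<epsilon>) powr (1 / real D) - 1"
  have D: "D > 0" using AB by (simp add: D_def)
  have d: "\<delta> > 0" using e D by (simp add: \<delta>_def)
  have dD: "(1 + \<delta>) ^ D = 1 + \<epsilon>" using e D by (simp add: \<delta>_def powr_inverse_power)
  \<comment> \<open>If the largest term is below \<open>F / (1 + \<delta>)\<close>, the others sum
    to more than \<open>F * (\<delta> / (1 + \<delta>)) = n * \<kappa> * F\<close>, so one of them
    is at least \<open>\<kappa> * F\<close>, and so is the largest.\<close>
  define \<kappa> where "\<kappa> = \<delta> / ((1 + \<delta>) * real n)"
  have ka: "\<kappa> > 0" using d n by (simp add: \<kappa>_def)
  show thesis
  proof (rule that[of "1 / \<kappa> ^ D"])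
    show "1 / \<kappa> ^ D \<ge> 0" using ka by simp
    fix y :: "'a \<Rightarrow> complex" and I :: "'a set" assume I: "finite I" "card I = n"
    define F where "F = norm (\<Sum>i\<in>I. y i)"
    define G where "G = (\<Sum>i\<in>I. \<Sum>j\<in>I - {i}. norm (y i) ^ A * norm (y j) ^ B)"
    have F0: "F \<ge> 0" by (simp add: F_def)
    have G0: "G \<ge> 0" unfolding G_def by (intro sum_nonneg) auto
    have "I \<noteq> {}" using I n by auto
    then have "Max ((\<lambda>i. norm (y i)) ` I) \<in> (\<lambda>i. norm (y i)) ` I" using I(1) by (intro Max_in) auto
    then obtain z where "z \<in> I" and zM: "norm (y z) = Max ((\<lambda>i. norm (y i)) ` I)" by auto
    then have z: "z \<in> I" "\<And>i. i \<in> I \<Longrightarrow> norm (y i) \<le> norm (y z)"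
      unfolding zM using I(1) by auto
    show "norm (\<Sum>i\<in>I. y i) ^ (A + B) \<le> (1 + \<epsilon>) * (\<Sum>i\<in>I. norm (y i) ^ (A + B))
        + 1 / \<kappa> ^ D * (\<Sum>i\<in>I. \<Sum>j\<in>I - {i}. norm (y i) ^ A * norm (y j) ^ B)"
      unfolding F_def[symmetric] G_def[symmetric] D_def[symmetric]
    proof (cases "F \<le> (1 + \<delta>) * norm (y z)")
      case True
      then have "F ^ D \<le> ((1 + \<delta>) * norm (y z)) ^ D" using F0 by (rule power_mono)
      also have "\<dots> = (1 + \<epsilon>) * norm (y z) ^ D" by (simp add: power_mult_distrib dD)
      also have "\<dots> \<le> (1 + \<epsilon>) * (\<Sum>i\<in>I. norm (y i) ^ D)"
        using z I e by (intro mult_left_mono member_le_sum) auto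
      also have "\<dots> \<le> \<dots> + 1 / \<kappa> ^ D * G" using G0 ka by simp
      finally show "F ^ D \<le> (1 + \<epsilon>) * (\<Sum>i\<in>I. norm (y i) ^ D) + 1 / \<kappa> ^ D * G" .
    next
      case False
      then have F: "F > (1 + \<delta>) * norm (y z)" by simp
      then have Fpos: "F > 0" using d by (smt (verit) mult_nonneg_nonneg norm_ge_zero)
      have "F \<le> (\<Sum>i\<in>I. norm (y i))" unfolding F_def by (rule norm_sum)
      also have "\<dots> = norm (y z) + (\<Sum>i\<in>I - {z}. norm (y i))"
        using I z by (simp add: sum.remove)
      finally have 1: "F - norm (y z) \<le> (\<Sum>i\<in>I - {z}. norm (y i))" by simp
      have "norm (y z) < F / (1 + \<delta>)" using F d by (simp add: pos_less_divide_eq mult.commute)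
      moreover have "F - F / (1 + \<delta>) = F * (\<delta> / (1 + \<delta>))" using d by (simp add: field_simps)
      ultimately have 2: "F * (\<delta> / (1 + \<delta>)) < (\<Sum>i\<in>I - {z}. norm (y i))" using 1 by linarith
      have "\<exists>i\<in>I - {z}. norm (y i) \<ge> \<kappa> * F"
      proof (rule ccontr)
        assume "\<not> ?thesis"
        then have "\<forall>i\<in>I - {z}. norm (y i) \<le> \<kappa> * F" by (meson linear)
        then have "(\<Sum>i\<in>I - {z}. norm (y i)) \<le> (\<Sum>i\<in>I - {z}. \<kappa> * F)" by (intro sum_mono) blast
        also have "\<dots> \<le> real n * (\<kappa> * F)"
          using ka Fpos I z by (simp add: card_Diff_singleton)
        also have "\<dots> = F * (\<delta> / (1 + \<delta>))" using n by (simp add: \<kappa>_def)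
        finally show False using 2 by simp
      qed
      then obtain i where i: "i \<in> I - {z}" "norm (y i) \<ge> \<kappa> * F" by blast
      then have iz: "norm (y z) \<ge> \<kappa> * F" using z(2)[of i] by auto
      have "\<kappa> ^ D * F ^ D = (\<kappa> * F) ^ A * (\<kappa> * F) ^ B"
        by (simp add: D_def power_add power_mult_distrib mult_ac)
      also have "\<dots> \<le> norm (y z) ^ A * norm (y i) ^ B"
        using i iz ka Fpos by (intro mult_mono power_mono) auto
      also have "\<dots> \<le> (\<Sum>j\<in>I - {z}. norm (y z) ^ A * norm (y j) ^ B)"
        using i I by (intro member_le_sum) auto
      also have "\<dots> \<le> G"
        unfolding G_def using z I
        by (intro member_le_sum[of z I "\<lambda>i. \<Sum>j\<in>I - {i}. norm (y i) ^ A * norm (y j) ^ B"])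
            (auto intro: sum_nonneg)
      finally have "F ^ D \<le> 1 / \<kappa> ^ D * G" using ka by (simp add: field_simps)
      moreover have "0 \<le> (1 + \<epsilon>) * (\<Sum>i\<in>I. norm (y i) ^ D)" using e
          by (intro mult_nonneg_nonneg sum_nonneg) auto
      ultimately show "F ^ D \<le> (1 + \<epsilon>) * (\<Sum>i\<in>I. norm (y i) ^ D) + 1 / \<kappa> ^ D * G" by linarith
    qed
  qed
qed

text \<open>Split into classes modulo \<open>p\<close>: a single class rescales to
  \<open>N - 1\<close>, and two different classes are transversal. \<open>K\<close> is chosen before
  \<open>N\<close>, which is what makes this a recursion in \<open>N\<close>; the factor p^2 bounds
  the number of pairs.\<close>

lemma decoupling_broad_narrow:
  assumes p: "prime p" and l: "1 \<le> l" "l < k" and e: "\<epsilon> > 0"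
  obtains K where "K \<ge> 0" "\<And>N V1 V2. 1 \<le> N \<Longrightarrow> V1 \<ge> 0 \<Longrightarrow> V2 \<ge> 0 \<Longrightarrow>
     decoupling p k (N - 1) V1 \<Longrightarrow> bilinear_decoupling p k N l 1 1 V2
         \<Longrightarrow> decoupling p k N ((1 + \<epsilon>) * V1 + K * V2)"
proof -
  have p0: "p > 0" using p by (simp add: prime_gt_0_int)
  have k: "k > 0" and dk: "triangle k > 0" using l by (auto simp: triangle_pos)
  have lk: "triangle l < triangle k" using triangle_less[OF l(2)] .
  define A where "A = 2 * triangle l"
  define B where "B = 2 * (triangle k - triangle l)"
  have AB: "A + B = 2 * triangle k" using lk by (simp add: A_def B_def)
  obtain K where K: "K \<ge> 0" "\<And>(y :: int \<Rightarrow> complex) I. finite I \<Longrightarrow> card I = nat p \<Longrightarrow>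
     norm (\<Sum>i\<in>I. y i) ^ (A + B) \<le> (1 + \<epsilon>) * (\<Sum>i\<in>I. norm (y i) ^ (A + B))
        + K * (\<Sum>i\<in>I. \<Sum>j\<in>I - {i}. norm (y i) ^ A * norm (y j) ^ B)"
    using broad_narrow[OF e, of "nat p" A B] p0 dk AB by auto
  show thesis
  proof (rule that[of "K * (real_of_int p * real_of_int p)"])
    show "0 \<le> K * (real_of_int p * real_of_int p)" using K(1) by simp
    fix N V1 V2 assume N: "1 \<le> N" and V: "V1 \<ge> 0" "V2 \<ge> 0"
      and decoupling: "decoupling p k (N - 1) V1" and bilinear_decoupling: "bilinear_decoupling p
          k N l 1 1 V2"
    show "decoupling p k N ((1 + \<epsilon>) * V1 + K * (real_of_int p * real_of_int p) * V2)"
      unfolding decoupling_def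
    proof (intro allI impI)
      fix \<phi> c S assume phi: "moment_like p k \<phi>" and S: "finite (S :: int set)"
      define q where "q = p ^ (k * N)"
      define y where "y z u = norm (exp_sum q k \<phi> c (residue_part S p z) u)" for z u
      define E where "E = curve_energy p k N \<phi> c S"
      define E' where "E' z = curve_energy p k N \<phi> c (residue_part S p z)" for z
      have E0: "E \<ge> 0" "\<And>z. E' z \<ge> 0" by (auto simp: E_def E'_def energy_nonneg)
      have pN: "p dvd p ^ N" using N by simp
      have sumE: "(\<Sum>z\<in>{0..<p}. E' z) = E"
        unfolding E_def E'_def using p0 dk by (intro energy_split pN) auto
      have E'E: "E' z \<le> E" if "z \<in> {0..<p}" for z
        unfolding E_def E'_def using p0 dk that by (intro energy_part_le pN) auto
      have 1: "(\<Sum>u\<in>torus k q. y z u ^ (A + B)) \<le> V1 * E' z ^ triangle k" for z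
        using decoupling_class[OF p k decoupling V(1) N phi, of "residue_part S p z" z c] S
        by (auto simp: residue_part_def y_def q_def AB E'_def moment_def)
      have 2: "(\<Sum>u\<in>torus k q. y z u ^ A * y z' u ^ B) \<le> V2 * E ^ triangle k"
        if z: "z \<in> {0..<p}" "z' \<in> {0..<p} - {z}" for z z'
      proof -
        have "\<not> p dvd z - z'"
        proof
          assume "p dvd z - z'"
          then have "z mod p = z' mod p" by (simp add: mod_eq_dvd_iff)
          then show False using z by auto
        qed
        then have "(\<Sum>u\<in>torus k q. y z u ^ A * y z' u ^ B)
            \<le> V2 * (E' z ^ triangle l * E' z' ^ (triangle k - triangle l))"
          unfolding y_def q_def A_def B_def E'_def
          by (intro bilinear_decouplingD[OF bilinear_decoupling phi]) (use S in \<open>auto simp: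
              residue_part_def\<close>)
        also have "\<dots> \<le> V2 * (E ^ triangle l * E ^ (triangle k - triangle l))"
          using E0 E'E z V by (intro mult_left_mono mult_mono power_mono) auto
        also have "E ^ triangle l * E ^ (triangle k - triangle l) = E ^ triangle k"
          using lk by (simp add: power_add[symmetric])
        finally show ?thesis .
      qed
      have "moment q k \<phi> c (\<lambda>_. 1) (triangle k) S
          \<le> (\<Sum>u\<in>torus k q. (1 + \<epsilon>) * (\<Sum>z\<in>{0..<p}. y z u ^ (A + B))
          + K * (\<Sum>z\<in>{0..<p}. \<Sum>z'\<in>{0..<p} - {z}. y z u ^ A * y z' u ^ B))"
        unfolding moment_def y_def
        using K(2)[of "{0..<p}"] p0 by (intro sum_mono) (simp add: exp_sum_split[OF S p0] AB)
      also have "\<dots> = (1 + \<epsilon>) * (\<Sum>z\<in>{0..<p}. \<Sum>u\<in>torus k q. y z u ^ (A + B))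
          + K * (\<Sum>z\<in>{0..<p}. \<Sum>z'\<in>{0..<p} - {z}. \<Sum>u\<in>torus k q. y z u ^ A * y z' u ^ B)"
      proof -
        have "(\<Sum>u\<in>torus k q. \<Sum>z\<in>{0..<p}. \<Sum>z'\<in>{0..<p} - {z}. y z u ^ A * y z' u ^ B)
           = (\<Sum>z\<in>{0..<p}. \<Sum>z'\<in>{0..<p} - {z}. \<Sum>u\<in>torus k q. y z u ^ A * y z' u ^ B)"
          by (subst sum.swap, rule sum.cong[OF refl], rule sum.swap)
        moreover have "(\<Sum>u\<in>torus k q. \<Sum>z\<in>{0..<p}. y z u ^ (A + B))
            = (\<Sum>z\<in>{0..<p}. \<Sum>u\<in>torus k q. y z u ^ (A + B))"
          by (rule sum.swap)
        ultimately show ?thesis by (simp only: sum.distrib sum_distrib_left[symmetric])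
      qed
      also have "\<dots> \<le> (1 + \<epsilon>) * (\<Sum>z\<in>{0..<p}. V1 * E' z ^ triangle k)
          + K * (\<Sum>z\<in>{0..<p}. \<Sum>z'\<in>{0..<p} - {z}. V2 * E ^ triangle k)"
        using e K(1) by (intro add_mono mult_left_mono sum_mono 1 2) auto
      also have "\<dots> \<le> (1 + \<epsilon>) * (V1 * E ^ triangle k) + K * (real_of_int p * (real_of_int p
          * (V2 * E ^ triangle k)))"
      proof (intro add_mono mult_left_mono)
        have "(\<Sum>z\<in>{0..<p}. E' z ^ triangle k) \<le> E ^ triangle k"
          unfolding sumE[symmetric] using E0 dk by (intro sum_power_le_power_sum) auto
        then show "(\<Sum>z\<in>{0..<p}. V1 * E' z ^ triangle k) \<le> V1 * E ^ triangle k"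
          unfolding sum_distrib_left[symmetric] using V by (intro mult_left_mono) auto
        have "(\<Sum>z\<in>{0..<p}. \<Sum>z'\<in>{0..<p} - {z}. V2 * E ^ triangle k)
            \<le> (\<Sum>z\<in>{0..<p}. \<Sum>z'\<in>{0..<p}. V2 * E ^ triangle k)"
          using V E0 by (intro sum_mono sum_mono2) auto
        then show "(\<Sum>z\<in>{0..<p}. \<Sum>z'\<in>{0..<p} - {z}. V2 * E ^ triangle k)
            \<le> real_of_int p * (real_of_int p * (V2 * E ^ triangle k))"
          using p0 by simp
      qed (use e K in auto)
      also have "\<dots> = ((1 + \<epsilon>) * V1 + K * (real_of_int p * real_of_int p) * V2) * E ^ triangle k"
        by (simp add: algebra_simps)
      finally show "moment (p ^ (k * N)) k \<phi> c (\<lambda>_. 1) (triangle k) S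
          \<le> ((1 + \<epsilon>) * V1 + K * (real_of_int p * real_of_int p) * V2) * curve_energy p k N \<phi> c S ^
              triangle k"
        by (simp add: q_def E_def)
    qed
  qed
qed

section \<open>Iteration\<close>

definition decoupling_exponent :: "int \<Rightarrow> nat \<Rightarrow> real \<Rightarrow> bool" where
  "decoupling_exponent p k \<eta> \<longleftrightarrow> (\<exists>C>0. \<forall>N. decoupling p k N (C * real_of_int p powr (\<eta> * real N)))"

text \<open>
  After \<open>m\<close> rounds the bilinear form of index \<open>l\<close> has gained the factor \<open>p powr (saving k \<eta> m l * b)\<close>
  over the trivial bound. The recursion records the exponents \<open>1 / (k - l + 1)\<close> and
  \<open>(k - l) / (k - l + 1)\<close> of the interpolation and the change of scale from \<open>b\<close> to \<open>(k - l + 1) b / l\<close>.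
\<close>
fun saving :: "nat \<Rightarrow> real \<Rightarrow> nat \<Rightarrow> nat \<Rightarrow> real" where
  "saving k \<eta> 0 l = (if l = 0 then \<eta> else 0)"
| "saving k \<eta> (Suc m) l = (if l = 0 then \<eta> else
     saving k \<eta> m (k - l) / real l + real (k - l) / real (k - l + 1) * saving k \<eta> m (l - 1))"

lemma saving_zero [simp]: "saving k \<eta> m 0 = \<eta>"
  by (cases m) auto

text \<open>Linear growth in \<open>m\<close> is what rules out a positive exponent \<open>\<eta>\<close>.\<close>
lemma sum_saving:
  assumes k: "k \<ge> 1"
  shows "(\<Sum>l\<in>{1..<k}. saving k \<eta> m l) = real m * (real (k - 1) * \<eta> / real k)"
proof (induction m)
  case (Suc m)
  let ?s = "saving k \<eta> m"
  have "(\<Sum>l\<in>{1..<k}. saving k \<eta> (Suc m) l)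
     = (\<Sum>l\<in>{1..<k}. ?s (k - l) / real l) + (\<Sum>l\<in>{1..<k}. real (k - l) / real (k - l + 1)
         * ?s (l - 1))"
    by (simp add: sum.distrib)
  also have "(\<Sum>l\<in>{1..<k}. ?s (k - l) / real l) = (\<Sum>j\<in>{1..<k}. ?s j / real (k - j))"
    by (rule sum.reindex_bij_witness[of _ "\<lambda>j. k - j" "\<lambda>j. k - j"]) auto
  also have "(\<Sum>l\<in>{1..<k}. real (k - l) / real (k - l + 1) * ?s (l - 1))
     = (\<Sum>j\<in>{0..<k - 1}. real (k - 1 - j) / real (k - j) * ?s j)"
  proof (rule sum.reindex_bij_witness[of _ "\<lambda>j. j + 1" "\<lambda>l. l - 1"])
    fix l assume "l \<in> {1..<k}"
    then have "k - 1 - (l - 1) = k - l" "k - (l - 1) = k - l + 1" by auto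
    then show "real (k - 1 - (l - 1)) / real (k - (l - 1)) * ?s (l - 1)
        = real (k - l) / real (k - l + 1) * ?s (l - 1)"
      by simp
  qed auto
  \<comment> \<open>The coefficient \<open>k - 1 - j\<close> vanishes at \<open>j = k - 1\<close>,
    so the range may be extended.\<close>
  also have "\<dots> = (\<Sum>j\<in>{0..<k}. real (k - 1 - j) / real (k - j) * ?s j)"
    using k by (intro sum.mono_neutral_left) auto
  also have "{0..<k} = insert 0 {1..<k}" using k by auto
  also have "(\<Sum>j\<in>\<dots>. real (k - 1 - j) / real (k - j) * ?s j)
     = real (k - 1) * \<eta> / real k + (\<Sum>j\<in>{1..<k}. real (k - 1 - j) / real (k - j) * ?s j)"
    by simp
  also have "(\<Sum>j\<in>{1..<k}. ?s j / real (k - j)) + (real (k - 1) * \<eta> / real k +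
      (\<Sum>j\<in>{1..<k}. real (k - 1 - j) / real (k - j) * ?s j))
    = real (k - 1) * \<eta> / real k + (\<Sum>j\<in>{1..<k}. ?s j / real (k - j) + real (k - 1 - j) / real
        (k - j) * ?s j)"
    by (simp add: sum.distrib)
  \<comment> \<open>The two coefficients of \<open>?s j\<close> add up to 1: the recursion conserves
    the total saving apart from the contribution of index 0.\<close>
  also have "(\<Sum>j\<in>{1..<k}. ?s j / real (k - j) + real (k - 1 - j) / real (k - j) * ?s j)
      = (\<Sum>j\<in>{1..<k}. ?s j)"
  proof (rule sum.cong)
    fix j assume j: "j \<in> {1..<k}"
    have x: "y / x + (x - 1) / x * y = y" if "x > 0" for x y :: real using that
        by (simp add: field_simps)
    from j have "real (k - 1 - j) = real (k - j) - 1" "real (k - j) > 0" by auto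
    then show "?s j / real (k - j) + real (k - 1 - j) / real (k - j) * ?s j = ?s j"
      by (simp only: x)
  qed simp
  also have "real (k - 1) * \<eta> / real k + (\<Sum>j\<in>{1..<k}. ?s j)
      = real (Suc m) * (real (k - 1) * \<eta> / real k)"
    unfolding Suc.IH of_nat_Suc by (simp only: distrib_right mult_1)
  finally show ?case .
qed simp

text \<open>The factor \<open>fact k ^ m\<close> in \<open>b\<close> makes all the scales \<open>(k - l + 1) b / l\<close> of \<open>m\<close> rounds integers.\<close>
lemma bilinear_iterate:
  assumes p: "prime p" "int k < p" and k: "k \<ge> 2" and eta: "\<eta> \<ge> 0"
    and lower: "\<And>l \<epsilon>. 1 \<le> l \<Longrightarrow> l < k \<Longrightarrow> \<epsilon> > 0 \<Longrightarrow> decoupling_exponent p l \<epsilon>"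
    and cur: "\<And>\<epsilon>. \<epsilon> > 0 \<Longrightarrow> decoupling_exponent p k (\<eta> + \<epsilon>)"
  shows "l < k \<Longrightarrow> \<epsilon> > 0 \<Longrightarrow> \<exists>C>0. \<forall>N a t b. b = fact k ^ m * t \<longrightarrow> 1 \<le> a \<longrightarrow> 1 \<le> t \<longrightarrow>
     l * a \<le> (k - l + 1) * b \<longrightarrow> k ^ Suc m * b \<le> N \<longrightarrow>
     bilinear_decoupling p k N l a b (C * real_of_int p powr ((\<eta> + \<epsilon>) * real N - saving k \<eta> m l
         * real b))"
proof (induction m arbitrary: l \<epsilon>)
  have p1: "real_of_int p > 1" using p(1) prime_gt_1_int[of p] by simp
  have zero: "\<exists>C>0. \<forall>N a t b. b = fact k ^ m * t \<longrightarrow> 1 \<le> a \<longrightarrow> 1 \<le> t \<longrightarrow>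
     l * a \<le> (k - l + 1) * b \<longrightarrow> k ^ Suc m * b \<le> N \<longrightarrow>
     bilinear_decoupling p k N l a b (C * real_of_int p powr ((\<eta> + \<epsilon>) * real N - saving k \<eta> m l
         * real b))"
    if l: "l = 0" and e: "\<epsilon> > 0" for l m \<epsilon>
  proof -
    from cur[OF e] obtain C where C: "C > 0" "\<And>N. decoupling p k N (C * real_of_int p powr
        ((\<eta> + \<epsilon>) * real N))"
      unfolding decoupling_exponent_def by blast
    show ?thesis
    proof (intro exI[of _ C] conjI C(1) allI impI)
      fix N a t b :: nat
      assume "k ^ Suc m * b \<le> N"
      moreover have "1 * b \<le> k ^ Suc m * b" using k by (intro mult_right_mono) auto
      ultimately have b: "b \<le> N" by linarith
      have "bilinear_decoupling p k N 0 a b (C * real_of_int p powr ((\<eta> + \<epsilon>) * real (N - b)))"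
        using k C(1) by (intro bilinear_zero p C(2) b) auto
      then show "bilinear_decoupling p k N l a b (C * real_of_int p powr ((\<eta> + \<epsilon>) * real N -
          saving k \<eta> m l * real b))"
        unfolding l
      proof (rule bilinear_mono)
        have "(\<eta> + \<epsilon>) * real (N - b) \<le> (\<eta> + \<epsilon>) * real N - saving k \<eta> m 0 * real b"
          using b e by (simp add: of_nat_diff algebra_simps)
        then show "C * real_of_int p powr ((\<eta> + \<epsilon>) * real (N - b))
            \<le> C * real_of_int p powr ((\<eta> + \<epsilon>) * real N - saving k \<eta> m 0 * real b)"
          using C(1) p1 by (intro mult_left_mono powr_mono) auto
      qed
    qed
  qed
  {
    case 0
    show ?case
    proof (cases "l = 0")
      case True
      then show ?thesis using 0 by (intro zero)
    next
      case False
      from cur[OF 0(2)] obtain C where C: "C > 0" "\<And>N. decoupling p k N (C * real_of_int p powr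
          ((\<eta> + \<epsilon>) * real N))"
        unfolding decoupling_exponent_def by blast
      show ?thesis
      proof (intro exI[of _ C] conjI C(1) allI impI)
        fix N a t b :: nat
        assume h: "b = fact k ^ 0 * t" "1 \<le> a" "1 \<le> t" "l * a \<le> (k - l + 1) * b" "k ^ Suc 0 * b \<le> N"
        have kb: "k * b \<le> N" using h(5) by simp
        have "1 * b \<le> k * b" using k by (intro mult_right_mono) auto
        then have b: "b \<le> N" using kb by linarith
        have "1 * a \<le> l * a" using False by (intro mult_right_mono) auto
        also note h(4)
        also have "(k - l + 1) * b \<le> k * b" using False 0 by (intro mult_right_mono) auto
        finally have a: "a \<le> N" using kb by linarith
        define V where "V = C * real_of_int p powr ((\<eta> + \<epsilon>) * real N)"
        have V: "V > 0" using C(1) p1 by (simp add: V_def)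
        have dV: "decoupling p k (N - a) V" for a
        proof (rule decoupling_mono[OF C(2)])
          show "C * real_of_int p powr ((\<eta> + \<epsilon>) * real (N - a)) \<le> V"
            unfolding V_def using C(1) p1 0 eta by (intro mult_left_mono powr_mono) auto
        qed
        have "bilinear_decoupling p k N l a b (V powr (real (triangle l) / real (triangle k))
            * V powr (1 - real (triangle l) / real (triangle k)))"
          using False 0 V by (intro bilinear_trivial[OF p(1) _ _ dV dV _ _ a b]) auto
        also have "V powr (real (triangle l) / real (triangle k)) * V powr (1 - real (triangle l)
            / real (triangle k)) = V"
          using V by (simp add: powr_add[symmetric])
        finally show "bilinear_decoupling p k N l a b (C * real_of_int p powr ((\<eta> + \<epsilon>) * real N -
            saving k \<eta> 0 l * real b))"
          using False by (simp add: V_def)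
      qed
    qed
  next
    case (Suc m)
    show ?case
    proof (cases "l = 0")
      case True
      then show ?thesis using Suc.prems by (intro zero)
    next
      case False
      then have l: "1 \<le> l" "l < k" using Suc.prems by auto
      \<comment> \<open>One half pays for the lower-degree decoupling, the other for the bilinear
        bounds of the previous round.\<close>
      define \<epsilon>' where "\<epsilon>' = \<epsilon> / 2"
      have e': "\<epsilon>' > 0" using Suc.prems by (simp add: \<epsilon>'_def)
      from lower[OF l e'] obtain C0 where C0: "C0 > 0" "\<And>N. decoupling p l N (C0 * real_of_int p
          powr (\<epsilon>' * real N))"
        unfolding decoupling_exponent_def by blast
      have "k - l < k" using l by simp
      from Suc.IH[OF this e'] obtain C1 where C1: "C1 > 0" "\<And>N a t b. b = fact k ^ m * t \<Longrightarrow> 1 \<le> a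
          \<Longrightarrow> 1 \<le> t \<Longrightarrow>
        (k - l) * a \<le> (k - (k - l) + 1) * b \<Longrightarrow> k ^ Suc m * b \<le> N \<Longrightarrow>
        bilinear_decoupling p k N (k - l) a b (C1 * real_of_int p powr ((\<eta> + \<epsilon>') * real N - saving
            k \<eta> m (k - l) * real b))"
        by blast
      have "l - 1 < k" using l by simp
      from Suc.IH[OF this e'] obtain C2 where C2: "C2 > 0" "\<And>N a t b. b = fact k ^ m * t \<Longrightarrow> 1 \<le> a
          \<Longrightarrow> 1 \<le> t \<Longrightarrow>
        (l - 1) * a \<le> (k - (l - 1) + 1) * b \<Longrightarrow> k ^ Suc m * b \<le> N \<Longrightarrow>
        bilinear_decoupling p k N (l - 1) a b (C2 * real_of_int p powr ((\<eta> + \<epsilon>') * real N - saving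
            k \<eta> m (l - 1) * real b))"
        by blast
      define \<theta> where "\<theta> = 1 / real (k - l + 1)"
      have th: "1 - \<theta> = real (k - l) / real (k - l + 1)" by (simp add: \<theta>_def field_simps)
      define s1 where "s1 = saving k \<eta> m (k - l)"
      define s2 where "s2 = saving k \<eta> m (l - 1)"
      show ?thesis
      proof (intro exI[of _ "C0 * (C1 powr \<theta> * C2 powr (1 - \<theta>))"] conjI allI impI)
        show "0 < C0 * (C1 powr \<theta> * C2 powr (1 - \<theta>))" using C0 C1 C2 by simp
        fix N a t b :: nat
        assume h: "b = fact k ^ Suc m * t" "1 \<le> a" "1 \<le> t" "l * a
            \<le> (k - l + 1) * b" "k ^ Suc (Suc m) * b \<le> N"
        \<comment> \<open>One factor \<open>fact k\<close> of \<open>b\<close> is spent on dividing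
          by \<open>l\<close>, so that e = (k - l + 1) b / l is again \<open>fact k ^ m\<close>
          times an integer.\<close>
        define t1 where "t1 = (k - l + 1) * (fact k div l) * t"
        define e where "e = fact k ^ m * t1"
        have "l dvd fact k" using l by (intro dvd_fact) auto
        then have lf: "l * (fact k div l) = fact k" by simp
        have "fact k div l \<ge> 1" using lf
            by (metis One_nat_def Suc_leI fact_nonzero gr0I mult_0_right)
        then have t1: "t1 \<ge> 1" using h(3) by (simp add: t1_def Suc_le_eq)
        have le: "l * e = (k - l + 1) * b"
        proof -
          have "l * e = (k - l + 1) * (fact k ^ m * (l * (fact k div l)) * t)"
            by (simp only: e_def t1_def mult_ac)
          then show ?thesis by (simp only: lf h(1) power_Suc mult_ac)
        qed
        have b1: "b \<ge> 1" using h by (simp add: Suc_le_eq)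
        have e1: "e \<ge> 1" using t1 by (simp add: e_def Suc_le_eq)
        have ae: "a \<le> e" using h(4) l unfolding le[symmetric] by simp
        have "e \<le> l * e" using l by simp
        also have "\<dots> \<le> k * b" unfolding le using l by (intro mult_right_mono) auto
        finally have ekb: "e \<le> k * b" .
        have "k ^ Suc m * e \<le> k ^ Suc m * (k * b)" using ekb by (rule mult_left_mono) simp
        also have "\<dots> \<le> N" using h(5) by (simp add: mult_ac)
        finally have ke: "k ^ Suc m * e \<le> N" .
        have "1 * e \<le> k ^ Suc m * e" using k by (intro mult_right_mono) auto
        then have eN: "e \<le> N" using ke by linarith
        have "k ^ Suc m * b \<le> k ^ Suc (Suc m) * b" using k
            by (intro mult_right_mono power_increasing) auto
        then have kb: "k ^ Suc m * b \<le> N" using h(5) by (rule order.trans)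
        define V1 where "V1 = C1 * real_of_int p powr ((\<eta> + \<epsilon>') * real N - s1 * real e)"
        define V2 where "V2 = C2 * real_of_int p powr ((\<eta> + \<epsilon>') * real N - s2 * real b)"
        define W where "W = C0 * real_of_int p powr (\<epsilon>' * real N)"
        have pos: "V1 > 0" "V2 > 0" "W > 0" using C0 C1 C2 p1 by (auto simp: V1_def V2_def W_def)
        have bil1: "bilinear_decoupling p k N (k - l) b e V1"
          unfolding V1_def s1_def
        proof (rule C1(2)[OF e_def b1 t1 _ ke])
          have "(k - l) * b \<le> (k - l + 1) * b" by simp
          also have "\<dots> = l * e" by (rule le[symmetric])
          also have "\<dots> \<le> (k - (k - l) + 1) * e" using l by (intro mult_right_mono) auto
          finally show "(k - l) * b \<le> (k - (k - l) + 1) * e" .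
        qed
        have bil2: "bilinear_decoupling p k N (l - 1) e b V2"
          unfolding V2_def s2_def
        proof (rule C2(2)[OF _ e1 _ _ kb])
          show "b = fact k ^ m * (fact k * t)" using h(1) by simp
          show "1 \<le> fact k * t" using h(3) by (simp add: Suc_le_eq)
          have "(l - 1) * e \<le> l * e" by simp
          also have "\<dots> \<le> (k - (l - 1) + 1) * b" unfolding le using l by (intro mult_right_mono) auto
          finally show "(l - 1) * e \<le> (k - (l - 1) + 1) * b" .
        qed
        have bil3: "bilinear_decoupling p k N l e b (V1 powr \<theta> * V2 powr (1 - \<theta>))"
          using pos by (intro bilinear_Holder[OF l bil1 bil2 _ _ \<theta>_def]) auto
        have decW: "decoupling p l (e - a) W"
        proof (rule decoupling_mono[OF C0(2)])
          show "C0 * real_of_int p powr (\<epsilon>' * real (e - a)) \<le> W"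
            unfolding W_def using C0 p1 e' eN by (intro mult_left_mono powr_mono) auto
        qed
        have "bilinear_decoupling p k N l a b (W * (V1 powr \<theta> * V2 powr (1 - \<theta>)))"
          using pos by (intro bilinear_decouple[OF p l h(2) ae eN le decW bil3]) auto
        moreover have "W * (V1 powr \<theta> * V2 powr (1 - \<theta>)) = C0 * (C1 powr \<theta> * C2 powr (1 - \<theta>)) *
            real_of_int p powr ((\<eta> + \<epsilon>) * real N - saving k \<eta> (Suc m) l * real b)"
        proof -
          \<comment> \<open>The form of index \<open>k - l\<close> saves at scale \<open>e\<close>
            and enters with weight \<open>\<theta>\<close>; hence the division by \<open>l\<close>
            in \<open>saving\<close>.\<close>
          have th_e: "\<theta> * real e = real b / real l"
          proof -
            have "real l * real e = real (k - l + 1) * real b" using le by (metis of_nat_mult)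
            then show ?thesis using l by (simp add: \<theta>_def field_simps)
          qed
          have ex: "\<epsilon>' * real N + (((\<eta> + \<epsilon>') * real N - s1 * real e) * \<theta> + ((\<eta> + \<epsilon>') * real N - s2
              * real b) * (1 - \<theta>))
             = (\<eta> + \<epsilon>) * real N - saving k \<eta> (Suc m) l * real b"
          proof -
            have "\<epsilon>' * real N + (((\<eta> + \<epsilon>') * real N - s1 * real e) * \<theta> + ((\<eta> + \<epsilon>') * real N - s2
                * real b) * (1 - \<theta>))
               = (\<eta> + 2 * \<epsilon>') * real N - (s1 * (\<theta> * real e) + (1 - \<theta>) * s2 * real b)"
              by (simp add: algebra_simps)
            also have "s1 * (\<theta> * real e) + (1 - \<theta>) * s2 * real b = saving k \<eta> (Suc m) l * real b"
              unfolding th_e using False by (simp add: th s1_def s2_def algebra_simps)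
            finally show ?thesis by (simp add: \<epsilon>'_def)
          qed
          have "W * (V1 powr \<theta> * V2 powr (1 - \<theta>)) = C0 * (C1 powr \<theta> * C2 powr (1 - \<theta>)) *
             (real_of_int p powr (\<epsilon>' * real N) * (real_of_int p powr (((\<eta> + \<epsilon>') * real N - s1
                 * real e) * \<theta>) *
                real_of_int p powr (((\<eta> + \<epsilon>') * real N - s2 * real b) * (1 - \<theta>))))"
            using C0 C1 C2 p1 by (simp add: V1_def V2_def W_def powr_mult powr_powr mult_ac)
          then show ?thesis by (simp only: powr_add[symmetric] ex)
        qed
        ultimately show "bilinear_decoupling p k N l a b (C0 * (C1 powr \<theta> * C2 powr (1 - \<theta>)) *
            real_of_int p powr ((\<eta> + \<epsilon>) * real N - saving k \<eta> (Suc m) l * real b))"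
          by simp
      qed
    qed
  }
qed

text \<open>After enough rounds some index saves at least 2 d + 2, by averaging
  \<open>sum_saving\<close>. Returning to modulus \<open>p\<close> costs (2 d + 1) b, so a net gain
  p^b remains, where \<open>b\<close> is at least N / L - 1. The broad-narrow recursion transfers
  this gain to \<open>decoupling\<close>.\<close>

lemma decoupling_exponent_improve:
  assumes p: "prime p" "int k < p" and k: "k \<ge> 2" and eta: "\<eta> > 0"
    and lower: "\<And>l \<epsilon>. 1 \<le> l \<Longrightarrow> l < k \<Longrightarrow> \<epsilon> > 0 \<Longrightarrow> decoupling_exponent p l \<epsilon>"
    and cur: "\<And>\<epsilon>. \<epsilon> > 0 \<Longrightarrow> decoupling_exponent p k (\<eta> + \<epsilon>)"
  shows "\<exists>\<sigma>>0. decoupling_exponent p k (\<eta> - \<sigma>)"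
proof -
  have p1: "real_of_int p > 1" using p(1) prime_gt_1_int[of p] by simp
  define P where "P = real_of_int p"
  have P: "P > 1" using p1 by (simp add: P_def)
  define d where "d = triangle k"
  obtain m where m: "real m * (\<eta> / real k) \<ge> real (2 * d + 2)"
  proof -
    obtain m :: nat where "real (2 * d + 2) / (\<eta> / real k) \<le> real m" using real_arch_simple by blast
    then have "real (2 * d + 2) \<le> real m * (\<eta> / real k)" using eta k by (simp add: field_simps)
    then show thesis by (rule that)
  qed
  have m1: "m \<ge> 1" using m by (cases m) auto
  obtain l where l: "1 \<le> l" "l < k" and s: "saving k \<eta> m l \<ge> real (2 * d + 2)"
  proof -
    have "\<exists>l\<in>{1..<k}. saving k \<eta> m l \<ge> real (2 * d + 2)"
    proof (rule ccontr)
      assume "\<not> ?thesis"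
      then have "\<And>l. l \<in> {1..<k} \<Longrightarrow> saving k \<eta> m l < real (2 * d + 2)" by (meson not_le)
      then have "(\<Sum>l\<in>{1..<k}. saving k \<eta> m l) < (\<Sum>l\<in>{1..<k}. real (2 * d + 2))"
        using k by (intro sum_strict_mono) auto
      also have "\<dots> = real (k - 1) * real (2 * d + 2)" by simp
      also have "\<dots> \<le> real (k - 1) * (real m * (\<eta> / real k))" using m by (rule mult_left_mono) simp
      also have "\<dots> = (\<Sum>l\<in>{1..<k}. saving k \<eta> m l)"
        using k by (subst sum_saving) (auto simp: mult_ac)
      finally show False by simp
    qed
    then show thesis using that by auto
  qed
  \<comment> \<open>With \<open>b = fact k ^ m * t\<close>, the condition
    \<open>k ^ Suc m * b \<le> N\<close> reads \<open>L * t \<le> N\<close>, which allows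
    \<open>t = N div L\<close>.\<close>
  define L where "L = k ^ Suc m * fact k ^ m"
  have L: "L \<ge> 1" using k by (simp add: L_def Suc_le_eq)
  \<comment> \<open>Half of the gain N / L is given up as \<epsilon>-loss, which leaves the exponent
    \<open>\<eta> - \<epsilon>\<close>.\<close>
  define \<epsilon> where "\<epsilon> = 1 / (2 * real L)"
  have e: "\<epsilon> > 0" using L by (simp add: \<epsilon>_def)
  obtain C where C: "C > 0" "\<And>N a t b. b = fact k ^ m * t \<Longrightarrow> 1 \<le> a \<Longrightarrow> 1 \<le> t \<Longrightarrow>
     l * a \<le> (k - l + 1) * b \<Longrightarrow> k ^ Suc m * b \<le> N \<Longrightarrow>
     bilinear_decoupling p k N l a b (C * P powr ((\<eta> + \<epsilon>) * real N - saving k \<eta> m l * real b))"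
    using bilinear_iterate[OF p k less_imp_le[OF eta] lower cur l(2) e, of m] unfolding P_def
        by blast
  \<comment> \<open>The cut at \<open>\<eta> / 2\<close> keeps the new exponent positive, so that
    the ratio \<open>r\<close> exceeds 1 and the recursion grows geometrically.\<close>
  define \<sigma> where "\<sigma> = min \<epsilon> (\<eta> / 2)"
  have sig: "\<sigma> > 0" "\<sigma> \<le> \<epsilon>" "\<sigma> < \<eta>" using e eta by (auto simp: \<sigma>_def)
  define r where "r = P powr (\<eta> - \<sigma>)"
  have r: "r > 1" using P sig by (simp add: r_def)
  have rN: "r ^ N = P powr ((\<eta> - \<sigma>) * real N)" for N
    using P by (simp add: r_def powr_realpow[symmetric] powr_powr)
  \<comment> \<open>The additional \<open>P\<close> pays for rounding N / L down to
    \<open>N div L\<close>.\<close>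
  have bilr: "bilinear_decoupling p k N l 1 1 (C * P * r ^ N)" if N: "N \<ge> L" for N
  proof -
    define t where "t = N div L"
    have t: "t \<ge> 1" using N L by (simp add: t_def div_greater_zero_iff Suc_le_eq)
    define b where "b = fact k ^ m * t"
    have "k ^ Suc m * b = L * t" by (simp add: b_def L_def)
    also have "\<dots> \<le> N" by (simp add: t_def)
    finally have kb: "k ^ Suc m * b \<le> N" .
    have "1 * b \<le> k ^ Suc m * b" using k by (intro mult_right_mono) auto
    then have bN: "b \<le> N" using kb by linarith
    have bt: "b \<ge> t" by (simp add: b_def)
    have "k \<le> fact k" by (rule fact_ge_self)
    also have "(fact k :: nat) = fact k ^ 1 * 1" by simp
    also have "\<dots> \<le> b" unfolding b_def using m1 t by (intro mult_mono power_increasing) auto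
    finally have "k \<le> b" .
    then have "l * 1 \<le> 1 * b" using l by simp
    also have "\<dots> \<le> (k - l + 1) * b" by (intro mult_right_mono) auto
    finally have lb: "l * 1 \<le> (k - l + 1) * b" .
    have "bilinear_decoupling p k N l 1 b (C * P powr ((\<eta> + \<epsilon>) * real N - saving k \<eta> m l * real b))"
      by (rule C(2)[OF b_def _ t lb kb]) simp
    then have "bilinear_decoupling p k N l 1 1 (real_of_int (p ^ b) ^ (2 * triangle k + 1)
        * (C * P powr ((\<eta> + \<epsilon>) * real N - saving k \<eta> m l * real b)))"
      using l bt t bN C(1) by (intro bilinear_refine[OF p(1)]) auto
    then show ?thesis
    proof (rule bilinear_mono)
      have "real_of_int (p ^ b) ^ (2 * triangle k + 1) = P ^ (b * (2 * d + 1))"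
        by (simp only: P_def d_def of_int_power power_mult)
      also have "\<dots> = P powr real (b * (2 * d + 1))"
        using P by (intro powr_realpow[symmetric]) simp
      finally have "real_of_int (p ^ b) ^ (2 * triangle k + 1)
          * (C * P powr ((\<eta> + \<epsilon>) * real N - saving k \<eta> m l * real b))
        = C * P powr (real (b * (2 * d + 1)) + ((\<eta> + \<epsilon>) * real N - saving k \<eta> m l * real b))"
        by (simp only: powr_add mult_ac)
      also have "\<dots> \<le> C * P powr (1 + (\<eta> - \<sigma>) * real N)"
      proof (intro mult_left_mono powr_mono)
        have "real (2 * d + 2) * real b \<le> saving k \<eta> m l * real b" using s
            by (intro mult_right_mono) auto
        then have "real (b * (2 * d + 1)) + ((\<eta> + \<epsilon>) * real N - saving k \<eta> m l * real b)
            \<le> (\<eta> + \<epsilon>) * real N - real b"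
          by (simp add: algebra_simps)
        also have "\<dots> \<le> (\<eta> + \<epsilon>) * real N - real t" using bt by simp
        also have "\<dots> \<le> (\<eta> + \<epsilon>) * real N - (real N / real L - 1)"
        proof -
          have "N < L * t + L" using L
              by (simp add: t_def) (metis add.commute dividend_less_times_div less_le_trans
              mult.commute not_less_eq_eq One_nat_def Suc_le_lessD)
          then have "real N < real L * real t + real L"
              by (metis of_nat_add of_nat_less_iff of_nat_mult)
          then have "real N / real L < real t + 1" using L by (simp add: field_simps)
          then show ?thesis by simp
        qed
        also have "\<dots> = 1 + (\<eta> - \<epsilon>) * real N" using L by (simp add: \<epsilon>_def field_simps)
        also have "\<dots> \<le> 1 + (\<eta> - \<sigma>) * real N" using sig by (simp add: mult_right_mono)
        finally show "real (b * (2 * d + 1)) + ((\<eta> + \<epsilon>) * real N - saving k \<eta> m l * real b)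
            \<le> 1 + (\<eta> - \<sigma>) * real N" .
      qed (use P C in auto)
      also have "\<dots> = C * P * r ^ N" using P by (simp add: powr_add rN)
      finally show "real_of_int (p ^ b) ^ (2 * triangle k + 1)
          * (C * P powr ((\<eta> + \<epsilon>) * real N - saving k \<eta> m l * real b)) \<le> C * P * r ^ N" .
    qed
  qed
  \<comment> \<open>The narrow factor \<open>1 + (r - 1) / 2\<close> lies below \<open>r\<close> and
    leaves the room \<open>C' * ((r - 1) / 2) * r ^ (N - 1)\<close> for the bilinear term.\<close>
  have "(r - 1) / 2 > 0" using r by simp
  from decoupling_broad_narrow[OF p(1) l this] obtain K where K: "K \<ge> 0" "\<And>N V1 V2. 1 \<le> N \<Longrightarrow> V1 \<ge> 0
      \<Longrightarrow> V2 \<ge> 0 \<Longrightarrow>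
     decoupling p k (N - 1) V1 \<Longrightarrow> bilinear_decoupling p k N l 1 1 V2
         \<Longrightarrow> decoupling p k N ((1 + (r - 1) / 2) * V1 + K * V2)"
    by blast
  \<comment> \<open>The first summand covers \<open>N < L\<close> by the trivial bound; the second
    makes the bilinear term fit into the room left by the narrow one.\<close>
  define C' where "C' = P ^ (2 * d * L) + 2 * K * (C * P) * r / (r - 1)"
  have C'1: "C' \<ge> P ^ (2 * d * L)" using K C P r by (simp add: C'_def)
  have C'0: "C' > 0" using C'1 P by (meson less_le_trans zero_less_power less_trans zero_less_one)
  have C'2: "K * (C * P) * r \<le> C' * ((r - 1) / 2)"
  proof -
    have "2 * K * (C * P) * r / (r - 1) * ((r - 1) / 2) = K * (C * P) * r" using r by simp
    moreover have "2 * K * (C * P) * r / (r - 1) \<le> C'" using P by (simp add: C'_def)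
    then have "2 * K * (C * P) * r / (r - 1) * ((r - 1) / 2) \<le> C' * ((r - 1) / 2)"
      using r by (intro mult_right_mono) auto
    ultimately show ?thesis by simp
  qed
  have "decoupling p k N (C' * r ^ N)" for N
  proof (induction N rule: less_induct)
    case (less N)
    show ?case
    proof (cases "N < L")
      case True
      have "decoupling p k N (P ^ (2 * d * N))"
        unfolding P_def d_def using k by (intro decoupling_trivial p) auto
      then show ?thesis
      proof (rule decoupling_mono)
        have "P ^ (2 * d * N) \<le> P ^ (2 * d * L)" using P True by (intro power_increasing) auto
        also have "\<dots> \<le> C' * 1" using C'1 by simp
        also have "\<dots> \<le> C' * r ^ N" using C'0 r by (intro mult_left_mono one_le_power) auto
        finally show "P ^ (2 * d * N) \<le> C' * r ^ N" .
      qed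
    next
      case False
      then have N: "N \<ge> L" "N \<ge> 1" using L by auto
      have "decoupling p k N ((1 + (r - 1) / 2) * (C' * r ^ (N - 1)) + K * (C * P * r ^ N))"
        using N C'0 r C P by (intro K(2) less.IH bilr) auto
      then show ?thesis
      proof (rule decoupling_mono)
        have rr: "r ^ N = r * r ^ (N - 1)" using N by (simp add: power_eq_if)
        have "(1 + (r - 1) / 2) * (C' * r ^ (N - 1)) + K * (C * P * r ^ N)
           = ((1 + (r - 1) / 2) * C' + K * (C * P) * r) * r ^ (N - 1)"
          unfolding rr by (simp add: algebra_simps)
        also have "\<dots> \<le> ((1 + (r - 1) / 2) * C' + C' * ((r - 1) / 2)) * r ^ (N - 1)"
          using C'2 r by (intro mult_right_mono add_left_mono) auto
        also have "\<dots> = C' * r ^ N" unfolding rr by (simp add: field_simps)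
        finally show "(1 + (r - 1) / 2) * (C' * r ^ (N - 1)) + K * (C * P * r ^ N) \<le> C' * r ^ N" .
      qed
    qed
  qed
  then have "decoupling_exponent p k (\<eta> - \<sigma>)"
    unfolding decoupling_exponent_def using C'0 by (auto simp: rN P_def intro!: exI[of _ C'])
  then show ?thesis using sig by blast
qed

lemma decoupling_exponent_mono:
  assumes "prime p" "decoupling_exponent p k \<eta>" "\<eta> \<le> \<eta>'"
  shows "decoupling_exponent p k \<eta>'"
proof -
  have p1: "real_of_int p > 1" using assms(1) prime_gt_1_int[of p] by simp
  obtain C where C: "C > 0" "\<And>N. decoupling p k N (C * real_of_int p powr (\<eta> * real N))"
    using assms(2) unfolding decoupling_exponent_def by blast
  have "decoupling p k N (C * real_of_int p powr (\<eta>' * real N))" for N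
  proof (rule decoupling_mono[OF C(2)])
    show "C * real_of_int p powr (\<eta> * real N) \<le> C * real_of_int p powr (\<eta>' * real N)"
      using C(1) p1 assms(3) by (intro mult_left_mono powr_mono mult_right_mono) auto
  qed
  then show ?thesis unfolding decoupling_exponent_def using C(1) by blast
qed

text \<open>The infimum of the admissible exponents is approached from above, which is all that
  \<open>decoupling_exponent_improve\<close> asks for; were it positive, that lemma would undercut
  it.\<close>

lemma decoupling_exponent_step:
  assumes p: "prime p" "int k < p" and k: "k \<ge> 2" and e: "\<epsilon> > 0"
    and lower: "\<And>l \<epsilon>. 1 \<le> l \<Longrightarrow> l < k \<Longrightarrow> \<epsilon> > 0 \<Longrightarrow> decoupling_exponent p l \<epsilon>"
  shows "decoupling_exponent p k \<epsilon>"
proof -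
  have p1: "real_of_int p > 1" using p(1) prime_gt_1_int[of p] by simp
  define A where "A = {\<eta>. \<eta> \<ge> 0 \<and> decoupling_exponent p k \<eta>}"
  have "decoupling_exponent p k (real (2 * triangle k))"
    unfolding decoupling_exponent_def
  proof (intro exI[of _ 1] conjI allI)
    fix N
    have "real_of_int p ^ (2 * triangle k * N) = 1 * real_of_int p powr (real (2 * triangle k)
        * real N)"
      using p1 by (simp add: powr_realpow[symmetric])
    then show "decoupling p k N (1 * real_of_int p powr (real (2 * triangle k) * real N))"
      using decoupling_trivial[OF p(1), of k N] k by simp
  qed simp
  then have ne: "A \<noteq> {}" unfolding A_def by (metis (mono_tags, lifting) empty_iff mem_Collect_eq
      of_nat_0_le_iff)
  have bdd: "bdd_below A" by (rule bdd_belowI[of _ 0]) (simp add: A_def)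
  define \<eta> where "\<eta> = Inf A"
  have eta0: "\<eta> \<ge> 0" unfolding \<eta>_def using ne by (intro cInf_greatest) (auto simp: A_def)
  have cur: "decoupling_exponent p k (\<eta> + \<epsilon>)" if "\<epsilon> > 0" for \<epsilon>
  proof -
    have "Inf A < \<eta> + \<epsilon>" using that by (simp add: \<eta>_def)
    then obtain x where "x \<in> A" "x < \<eta> + \<epsilon>" using ne bdd by (auto simp: cInf_less_iff)
    then show ?thesis using decoupling_exponent_mono[OF p(1), of k x] by (auto simp: A_def)
  qed
  have "\<eta> = 0"
  proof (rule ccontr)
    assume "\<eta> \<noteq> 0"
    then have pos: "\<eta> > 0" using eta0 by simp
    from decoupling_exponent_improve[OF p k pos lower cur] obtain \<sigma> where s: "\<sigma> > 0"
        "decoupling_exponent p k (\<eta> - \<sigma>)"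
      by blast
    have "max (\<eta> - \<sigma>) 0 \<in> A" using decoupling_exponent_mono[OF p(1) s(2), of "max (\<eta> - \<sigma>) 0"]
        by (simp add: A_def)
    then have "\<eta> \<le> max (\<eta> - \<sigma>) 0" unfolding \<eta>_def using bdd by (rule cInf_lower)
    then show False using pos s by simp
  qed
  then show ?thesis using cur[OF e] by simp
qed

section \<open>Counting solutions\<close>

lemma ee_eq_1_iff:
  assumes "q > 0"
  shows "ee q z = 1 \<longleftrightarrow> q dvd z"
proof
  assume "ee q z = 1"
  then have "exp (\<i> * complex_of_real (2 * pi * (real_of_int z / real_of_int q))) = 1"
    by (simp add: ee_def cis_conv_exp)
  then obtain n :: int where n: "2 * pi * (real_of_int z / real_of_int q) = of_int (2 * n) * pi"
    by (auto simp: exp_eq_1)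
  have "2 * pi * (real_of_int z / real_of_int q) = 2 * pi * real_of_int n"
    using n by simp
  then have "real_of_int z / real_of_int q = real_of_int n"
    using pi_gt_zero by (simp only: mult_cancel_left) auto
  then have "real_of_int z = real_of_int (q * n)" using assms by (simp add: field_simps)
  then have "z = q * n" by (simp only: of_int_eq_iff)
  then show "q dvd z" by simp
qed (rule ee_dvd)

text \<open>If \<open>q\<close> does not divide some \<open>D i\<close>, translating coordinate
  \<open>i\<close> by 1 leaves the sum unchanged and also multiplies it by
  \<open>ee q (D i) \<noteq> 1\<close>.\<close>

lemma torus_orthogonality:
  assumes "q > 0"
  shows "(\<Sum>u\<in>torus k q. ee q (\<Sum>j=1..k. u j * D j))
       = (if \<forall>j\<in>{1..k}. q dvd D j then of_int q ^ k else 0)"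
proof (cases "\<forall>j\<in>{1..k}. q dvd D j")
  case True
  then have "ee q (\<Sum>j=1..k. u j * D j) = 1" for u by (intro ee_dvd dvd_sum) auto
  moreover have "complex_of_real (real (card (torus k q))) = of_int q ^ k"
    using assms by (simp add: card_torus)
  ultimately show ?thesis using True by simp
next
  case False
  then obtain i where i: "i \<in> {1..k}" "\<not> q dvd D i" by blast
  define G where "G u = ee q (\<Sum>j=1..k. u j * D j)" for u
  have "periodic k q G"
    unfolding periodic_def G_def by (intro allI impI ee_cong cong_sum cong_mult) auto
  from sum_torus_shift[OF assms this, of "\<lambda>j. if j = i then 1 else 0"]
  have "(\<Sum>u\<in>torus k q. G (\<lambda>j. u j + (if j = i then 1 else 0))) = (\<Sum>u\<in>torus k q. G u)" .
  moreover have "G (\<lambda>j. u j + (if j = i then 1 else 0)) = ee q (D i) * G u" for u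
  proof -
    have "(\<Sum>j=1..k. (u j + (if j = i then 1 else 0)) * D j) = D i + (\<Sum>j=1..k. u j * D j)"
    proof -
      have "(\<Sum>j=1..k. (u j + (if j = i then 1 else 0)) * D j) = (\<Sum>j=1..k. u j * D j) + (\<Sum>j=1..k.
          if j = i then D j else 0)"
        unfolding sum.distrib[symmetric] by (intro sum.cong) (auto simp: ring_distribs)
      then show ?thesis using i by simp
    qed
    then show ?thesis by (simp add: G_def ee_add)
  qed
  ultimately have "ee q (D i) * (\<Sum>u\<in>torus k q. G u) = (\<Sum>u\<in>torus k q. G u)"
    by (simp add: sum_distrib_left)
  moreover have "ee q (D i) \<noteq> 1" using i assms by (simp add: ee_eq_1_iff)
  ultimately have "(\<Sum>u\<in>torus k q. G u) = 0" by (metis mult_cancel_right1)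
  then show ?thesis unfolding if_not_P[OF False] by (simp add: G_def)
qed

lemma norm_exp_sum_square:
  "complex_of_real (norm (exp_sum q k \<phi> c S u) ^ 2)
     = (\<Sum>n\<in>S. \<Sum>n'\<in>S. c n * cnj (c n') * ee q (\<Sum>j=1..k. u j * (poly (\<phi> j) n - poly (\<phi> j) n')))"
proof -
  have cnj: "cnj (ee q z) = ee q (- z)" for z by (simp add: ee_def cis_cnj)
  have "complex_of_real (norm (exp_sum q k \<phi> c S u) ^ 2) = exp_sum q k \<phi> c S u
      * cnj (exp_sum q k \<phi> c S u)"
    by (rule complex_norm_square)
  also have "\<dots> = (\<Sum>n\<in>S. \<Sum>n'\<in>S. (c n * ee q (\<Sum>j=1..k. u j * poly (\<phi> j) n)) * (cnj (c n') * ee q (-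
      (\<Sum>j=1..k. u j * poly (\<phi> j) n'))))"
    by (simp add: exp_sum_def cnj sum_product)
  also have "\<dots> = (\<Sum>n\<in>S. \<Sum>n'\<in>S. c n * cnj (c n') * ee q (\<Sum>j=1..k. u j * (poly (\<phi> j) n - poly (\<phi> j)
      n')))"
  proof (intro sum.cong refl)
    fix n n'
    have "ee q (\<Sum>j=1..k. u j * (poly (\<phi> j) n - poly (\<phi> j) n'))
        = ee q (\<Sum>j=1..k. u j * poly (\<phi> j) n) * ee q (- (\<Sum>j=1..k. u j * poly (\<phi> j) n'))"
      unfolding ee_add[symmetric] by (simp add: sum_subtractf right_diff_distrib)
    then show "(c n * ee q (\<Sum>j=1..k. u j * poly (\<phi> j) n)) * (cnj (c n') * ee q (-
        (\<Sum>j=1..k. u j * poly (\<phi> j) n')))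
      = c n * cnj (c n') * ee q (\<Sum>j=1..k. u j * (poly (\<phi> j) n - poly (\<phi> j) n'))" by simp
  qed
  finally show ?thesis .
qed

lemma diff_dvd_poly_diff:
  fixes h :: "int poly"
  shows "x - y dvd poly h x - poly h y"
proof (induction h)
  case (pCons a h)
  have "poly (pCons a h) x - poly (pCons a h) y = (x - y) * poly h x + y * (poly h x - poly h y)"
    by (simp add: algebra_simps)
  then show ?case using pCons.IH by simp
qed simp

text \<open>As \<open>triangle 1 = 1\<close>, this is orthogonality in L^2: only pairs with equal
  \<open>\<phi> 1\<close> modulo \<open>p ^ N\<close> contribute, and these lie in a common class.
  Equality holds, hence the constant 1.\<close>

lemma decoupling_one:
  assumes p: "prime p"
  shows "decoupling p 1 N 1"
  unfolding decoupling_def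
proof (intro allI impI)
  fix \<phi> c S assume phi: "moment_like p 1 \<phi>" and S: "finite (S :: int set)"
  have p0: "p > 0" using p by (simp add: prime_gt_0_int)
  define q where "q = p ^ N"
  have q: "q > 0" using p0 by (simp add: q_def)
  have inj: "[n = n'] (mod q)" if "q dvd poly (\<phi> 1) n - poly (\<phi> 1) n'" for n n'
  proof -
    \<comment> \<open>Differences of values are differences of arguments times
      \<open>1 + p * w\<close>, which is a unit modulo \<open>q\<close>.\<close>
    from phi obtain h where "\<phi> 1 - monom 1 1 = [:p:] * h" by (auto simp: moment_like_def)
    then have "\<phi> 1 = monom 1 1 + [:p:] * h" by (simp add: algebra_simps)
    then have ev: "poly (\<phi> 1) x = x + p * poly h x" for x by (simp add: poly_monom)
    have "n - n' dvd poly h n - poly h n'" by (rule diff_dvd_poly_diff)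
    then obtain w where w: "poly h n - poly h n' = (n - n') * w" by blast
    have "poly (\<phi> 1) n - poly (\<phi> 1) n' = (n - n') + p * (poly h n - poly h n')"
      unfolding ev by (simp add: algebra_simps)
    also have "\<dots> = (n - n') * (1 + p * w)" by (simp add: w algebra_simps)
    finally have "q dvd (n - n') * (1 + p * w)" using that by simp
    moreover have "coprime q (1 + p * w)"
    proof -
      have "coprime p (1 + p * w)"
      proof (rule coprimeI)
        fix c assume "c dvd p" "c dvd 1 + p * w"
        then have "c dvd (1 + p * w) - p * w" by (intro dvd_diff[of c "1 + p * w"] dvd_mult2)
        then show "is_unit c" by simp
      qed
      then show ?thesis by (simp add: q_def)
    qed
    ultimately have "q dvd n - n'" by (simp add: coprime_dvd_mult_left_iff)
    then show ?thesis by (simp add: cong_iff_dvd_diff)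
  qed
  define g where "g n n' = c n * cnj (c n') * (if q dvd poly (\<phi> 1) n - poly (\<phi> 1) n' then of_int q
      else 0)" for n n'
  have momg: "complex_of_real (moment q 1 \<phi> c (\<lambda>_. 1) 1 R) = (\<Sum>n\<in>R. \<Sum>n'\<in>R. g n n')" for R
  proof -
    have "complex_of_real (moment q 1 \<phi> c (\<lambda>_. 1) 1 R) = (\<Sum>u\<in>torus 1 q. \<Sum>n\<in>R. \<Sum>n'\<in>R. c n
        * cnj (c n') * ee q (\<Sum>j=1..1. u j * (poly (\<phi> j) n - poly (\<phi> j) n')))"
      unfolding moment_def of_real_sum
      by (intro sum.cong refl) (simp only: mult_1 mult_1_right norm_exp_sum_square)
    also have "\<dots> = (\<Sum>n\<in>R. \<Sum>n'\<in>R. \<Sum>u\<in>torus 1 q. c n * cnj (c n') * ee q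
        (\<Sum>j=1..1. u j * (poly (\<phi> j) n - poly (\<phi> j) n')))"
      by (subst sum.swap, rule sum.cong[OF refl], rule sum.swap)
    also have "\<dots> = (\<Sum>n\<in>R. \<Sum>n'\<in>R. g n n')"
      unfolding sum_distrib_left[symmetric] torus_orthogonality[OF q]
          by (simp add: g_def cong: if_cong)
    finally show ?thesis .
  qed
  have r: "residue_part S q z = {n \<in> S. n mod q = z}" if "z \<in> {0..<q}" for z
    using that by (auto simp: residue_part_def cong_def)
  have "complex_of_real (\<Sum>z\<in>{0..<q}. moment q 1 \<phi> c (\<lambda>_. 1) 1 (residue_part S q z))
     = (\<Sum>z\<in>{0..<q}. \<Sum>n\<in>residue_part S q z. \<Sum>n'\<in>residue_part S q z. g n n')"
    by (simp only: of_real_sum momg)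
  also have "\<dots> = (\<Sum>z\<in>{0..<q}. \<Sum>n\<in>residue_part S q z. \<Sum>n'\<in>S. g n n')"
  proof (rule sum.cong[OF refl], rule sum.cong[OF refl], rule sum.mono_neutral_left[OF S],
      goal_cases)
    case (2 z n)
    show ?case
    proof
      fix n' assume z: "n' \<in> S - residue_part S q z"
      have "\<not> [n = n'] (mod q)"
        using z 2 by (auto simp: residue_part_def cong_def)
      then show "g n n' = 0" using inj[of n n'] by (auto simp: g_def)
    qed
  qed (auto simp: residue_part_def)
  also have "\<dots> = (\<Sum>z\<in>{0..<q}. \<Sum>n\<in>{n \<in> S. n mod q = z}. \<Sum>n'\<in>S. g n n')"
    by (rule sum.cong[OF refl]) (simp add: r)
  also have "\<dots> = (\<Sum>n\<in>S. \<Sum>n'\<in>S. g n n')"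
    using S q by (intro sum.group) auto
  also have "\<dots> = complex_of_real (moment q 1 \<phi> c (\<lambda>_. 1) 1 S)" by (rule momg[symmetric])
  finally have "moment q 1 \<phi> c (\<lambda>_. 1) 1 S
      = (\<Sum>z\<in>{0..<q}. moment q 1 \<phi> c (\<lambda>_. 1) 1 (residue_part S q z))"
    by (simp only: of_real_eq_iff)
  moreover have "triangle 1 = 1" by (simp add: triangle_def)
  moreover have "moment q 1 \<phi> c (\<lambda>_. 1) 1 R powr (1 / real 1) = moment q 1 \<phi> c (\<lambda>_. 1) 1 R" for R
    by (simp add: moment_nonneg)
  ultimately show "moment (p ^ (1 * N)) 1 \<phi> c (\<lambda>_. 1) (triangle 1) S
      \<le> 1 * curve_energy p 1 N \<phi> c S ^ triangle 1"
    unfolding energy_def q_def by simp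
qed

lemma decoupling_exponent_all:
  assumes p: "prime p"
  shows "1 \<le> k \<Longrightarrow> int k < p \<Longrightarrow> \<epsilon> > 0 \<Longrightarrow> decoupling_exponent p k \<epsilon>"
proof (induction k arbitrary: \<epsilon> rule: less_induct)
  case (less k)
  show ?case
  proof (cases "k = 1")
    case True
    have "decoupling_exponent p 1 0"
      unfolding decoupling_exponent_def using decoupling_one[OF p] prime_gt_1_int[OF p]
      by (intro exI[of _ 1]) simp
    then show ?thesis using decoupling_exponent_mono[OF p] less.prems True by simp
  next
    case False
    with less.prems have k: "k \<ge> 2" by simp
    show ?thesis
    proof (rule decoupling_exponent_step[OF p less.prems(2) k less.prems(3)])
      fix l and \<epsilon>' :: real assume "1 \<le> l" "l < k" "\<epsilon>' > 0"
      then show "decoupling_exponent p l \<epsilon>'" using less.prems(2) by (intro less.IH) auto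
    qed
  qed
qed

section \<open>From exponential sums to the number of solutions\<close>

lemma norm_exp_sum_power:
  assumes "finite S"
  shows "complex_of_real (norm (exp_sum q k \<phi> (\<lambda>_. 1) S u) ^ (2 * s))
     = (\<Sum>x\<in>{1..s} \<rightarrow>\<^sub>E S. \<Sum>y\<in>{1..s} \<rightarrow>\<^sub>E S.
          ee q (\<Sum>j=1..k. u j * ((\<Sum>i=1..s. poly (\<phi> j) (x i)) - (\<Sum>i=1..s. poly (\<phi> j) (y i)))))"
proof -
  have cnj: "cnj (ee q z) = ee q (- z)" for z by (simp add: ee_def cis_cnj)
  have ee_sum: "(\<Prod>i\<in>I. ee q (f i)) = ee q (\<Sum>i\<in>I. f i)" for f and I :: "nat set"
    by (induction I rule: infinite_finite_induct) (simp_all add: ee_add ee_dvd)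
  have pow: "exp_sum q k \<phi> (\<lambda>_. 1) S u ^ s
      = (\<Sum>x\<in>{1..s} \<rightarrow>\<^sub>E S. ee q (\<Sum>j=1..k. u j * (\<Sum>i=1..s. poly (\<phi> j) (x i))))"
  proof -
    have "exp_sum q k \<phi> (\<lambda>_. 1) S u ^ s = (\<Prod>i\<in>{1..s}. \<Sum>n\<in>S. ee q (\<Sum>j=1..k. u j * poly (\<phi> j) n))"
      by (simp add: exp_sum_def)
    also have "\<dots> = (\<Sum>x\<in>{1..s} \<rightarrow>\<^sub>E S. \<Prod>i\<in>{1..s}. ee q (\<Sum>j=1..k. u j * poly (\<phi> j) (x i)))"
      using assms by (intro prod_sum_PiE) auto
    also have "\<dots> = (\<Sum>x\<in>{1..s} \<rightarrow>\<^sub>E S. ee q (\<Sum>j=1..k. u j * (\<Sum>i=1..s. poly (\<phi> j) (x i))))"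
      unfolding ee_sum by (subst sum.swap) (simp add: sum_distrib_left)
    finally show ?thesis .
  qed
  have "complex_of_real (norm (exp_sum q k \<phi> (\<lambda>_. 1) S u) ^ (2 * s))
      = complex_of_real (norm (exp_sum q k \<phi> (\<lambda>_. 1) S u ^ s) ^ 2)"
    by (simp add: norm_power power_mult[symmetric] mult.commute)
  also have "\<dots> = exp_sum q k \<phi> (\<lambda>_. 1) S u ^ s * cnj (exp_sum q k \<phi> (\<lambda>_. 1) S u ^ s)"
    by (rule complex_norm_square)
  also have "\<dots> = (\<Sum>x\<in>{1..s} \<rightarrow>\<^sub>E S. \<Sum>y\<in>{1..s} \<rightarrow>\<^sub>E S.
      ee q (\<Sum>j=1..k. u j * (\<Sum>i=1..s. poly (\<phi> j) (x i))) * ee q (- (\<Sum>j=1..k. u j *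
          (\<Sum>i=1..s. poly (\<phi> j) (y i)))))"
    unfolding pow by (simp only: cnj_sum cnj sum_product)
  finally show ?thesis
    by (simp add: ee_add[symmetric] sum_subtractf right_diff_distrib)
qed

text \<open>By orthogonality the right side is \<open>q ^ k\<close> times the number of solutions of
  the system modulo \<open>q\<close>, and integral solutions are among these.\<close>

lemma vinogradov_J_le_moment:
  assumes q: "q > 0"
  shows "real (vinogradov_J s k X) * real_of_int q ^ k
     \<le> (\<Sum>u\<in>torus k q. norm (exp_sum q k (monom 1) (\<lambda>_. 1) {1..\<lfloor>X\<rfloor>} u) ^ (2 * s))"
proof -
  define S where "S = {1..\<lfloor>X\<rfloor>}"
  define F where "F = {1..s} \<rightarrow>\<^sub>E S"
  define D where "D x y j = (\<Sum>i=1..s. poly (monom 1 j) (x i)) - (\<Sum>i=1..s. poly (monom 1 j) (y i))"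
    for x y :: "nat \<Rightarrow> int" and j
  have fS: "finite S" by (simp add: S_def)
  then have fF: "finite F" by (simp add: F_def finite_PiE)
  have "complex_of_real (\<Sum>u\<in>torus k q. norm (exp_sum q k (monom 1) (\<lambda>_. 1) S u) ^ (2 * s))
     = (\<Sum>u\<in>torus k q. \<Sum>x\<in>F. \<Sum>y\<in>F. ee q (\<Sum>j=1..k. u j * D x y j))"
    unfolding of_real_sum norm_exp_sum_power[OF fS] F_def D_def ..
  also have "\<dots> = (\<Sum>x\<in>F. \<Sum>y\<in>F. \<Sum>u\<in>torus k q. ee q (\<Sum>j=1..k. u j * D x y j))"
    by (subst sum.swap, rule sum.cong[OF refl], rule sum.swap)
  also have "\<dots> = complex_of_real (\<Sum>x\<in>F. \<Sum>y\<in>F. if \<forall>j\<in>{1..k}. q dvd D x y j then real_of_int q ^ k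
      else 0)"
    unfolding torus_orthogonality[OF q] of_real_sum by (intro sum.cong refl) auto
  finally have eq: "(\<Sum>u\<in>torus k q. norm (exp_sum q k (monom 1) (\<lambda>_. 1) S u) ^ (2 * s))
    = (\<Sum>x\<in>F. \<Sum>y\<in>F. if \<forall>j\<in>{1..k}. q dvd D x y j then real_of_int q ^ k else 0)"
    by (simp only: of_real_eq_iff)
  have "{n. 1 \<le> n \<and> real_of_int n \<le> X} = S" by (auto simp: S_def le_floor_iff)
  then have sol: "vinogradov_solutions s k X = {z \<in> F \<times> F. \<forall>j\<in>{1..k}. D (fst z) (snd z) j = 0}"
    unfolding vinogradov_solutions_def F_def D_def by (auto simp: poly_monom)
  have "real (vinogradov_J s k X) * real_of_int q ^ k
      = (\<Sum>z\<in>vinogradov_solutions s k X. real_of_int q ^ k)"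
    by (simp add: vinogradov_J_def)
  also have "\<dots> = (\<Sum>z\<in>F \<times> F. if \<forall>j\<in>{1..k}. D (fst z) (snd z) j = 0 then real_of_int q ^ k else 0)"
    unfolding sol by (rule sum.inter_filter) (simp add: fF)
  also have "\<dots> \<le> (\<Sum>z\<in>F \<times> F. if \<forall>j\<in>{1..k}. q dvd D (fst z) (snd z) j then real_of_int q ^ k else 0)"
    by (rule sum_mono) (use q in auto)
  also have "\<dots> = (\<Sum>x\<in>F. \<Sum>y\<in>F. if \<forall>j\<in>{1..k}. q dvd D x y j then real_of_int q ^ k else 0)"
    by (simp add: sum.cartesian_product case_prod_unfold)
  finally show ?thesis unfolding eq[symmetric] S_def .
qed

text \<open>For p^(N - 1) \<le> X < p^N each class modulo p^N contains at most one integer of the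
  range, so the energy is explicit and decoupling bounds the critical moment. For larger
  \<open>s\<close> the additional factors are bounded by \<open>X\<close>.\<close>

lemma vinogradov_mean_value:
  assumes k: "k \<ge> 1" and s: "s \<ge> triangle k" and e: "\<epsilon> > 0"
  shows "\<exists>C. \<forall>X\<ge>1. real (vinogradov_J s k X) \<le> C * X powr (2 * real s - real (triangle k) + \<epsilon>)"
proof -
  obtain p0 :: nat where p0: "prime p0" "p0 > k" using bigger_prime by blast
  define p where "p = int p0"
  have p: "prime p" "int k < p" using p0 by (auto simp: p_def)
  define P where "P = real_of_int p"
  have P1: "P > 1" using prime_gt_1_int[OF p(1)] by (simp add: P_def)
  obtain C where C: "C > 0" "\<And>N. decoupling p k N (C * P powr (\<epsilon> * real N))"
    using decoupling_exponent_all[OF p(1) k p(2) e] unfolding decoupling_exponent_def P_def by blast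
  define d where "d = triangle k"
  have d: "d > 0" using k by (simp add: d_def triangle_pos)
  show ?thesis
  proof (intro exI[of _ "C * P powr \<epsilon>"] allI impI)
    fix X :: real assume X: "X \<ge> 1"
    obtain n where n: "P ^ n \<le> X" "X < P ^ (n + 1)"
    proof -
      define N where "N = (LEAST N. X < P ^ N)"
      have "\<exists>N. X < P ^ N" using P1 by (rule real_arch_pow)
      then have N: "X < P ^ N" unfolding N_def by (rule LeastI_ex)
      then obtain n where Suc: "N = Suc n" using X by (cases N) auto
      have "\<not> X < P ^ n" using not_less_Least[of n "\<lambda>N. X < P ^ N"] Suc by (simp add: N_def)
      then show thesis using that[of n] N Suc by simp
    qed
    define N where "N = n + 1"
    \<comment> \<open>As \<open>p\<close> is fixed, replacing \<open>P ^ N\<close> by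
      \<open>X\<close> costs only the constant \<open>P powr \<epsilon>\<close>.\<close>
    have PN: "P ^ N \<le> P * X" using n P1 by (simp add: N_def)
    define S where "S = {1..\<lfloor>X\<rfloor>}"
    have fS: "finite S" by (simp add: S_def)
    have cS: "real (card S) \<le> X" using X by (simp add: S_def)
    have SN: "S \<subseteq> {0..<p ^ N}"
    proof
      fix x assume "x \<in> S"
      then have "real_of_int x \<le> X" "x \<ge> 1" by (auto simp: S_def le_floor_iff)
      then have "real_of_int x < real_of_int (p ^ N)" using n by (simp add: N_def P_def)
      then show "x \<in> {0..<p ^ N}" using \<open>x \<ge> 1\<close> by simp
    qed
    define q where "q = p ^ (k * N)"
    have q: "q > 0" using prime_gt_0_int[OF p(1)] by (simp add: q_def)
    define Q where "Q = real_of_int q ^ k"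
    have Q: "Q > 0" using q by (simp add: Q_def)
    define f where "f u = norm (exp_sum q k (monom 1) (\<lambda>_. 1) S u)" for u
    have f0: "f u \<ge> 0" for u by (simp add: f_def)
    have fX: "f u \<le> X" for u
    proof -
      have "f u \<le> (\<Sum>n\<in>S. norm (1 * ee q (\<Sum>j=1..k. u j * poly (monom 1 j) n)))"
        unfolding f_def exp_sum_def by (rule norm_sum)
      also have "\<dots> = real (card S)" by simp
      finally show ?thesis using cS by simp
    qed
    have curve_energy: "curve_energy p k N (monom 1) (\<lambda>_. 1) S ^ d \<le> X ^ d * Q"
    proof -
      have "curve_energy p k N (monom 1) (\<lambda>_. 1) S
          = (\<Sum>z\<in>{0..<p ^ N}. if z \<in> S then Q powr (1 / real d) else 0)"
        unfolding energy_def q_def[symmetric] d_def[symmetric]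
      proof (rule sum.cong)
        fix z assume z: "z \<in> {0..<p ^ N}"
        have r: "residue_part S (p ^ N) z = (if z \<in> S then {z} else {})"
          using SN z by (force simp: residue_part_def cong_def)
        have "moment q k (monom 1) (\<lambda>_. 1) (\<lambda>_. 1) d {z} = Q"
          using q by (simp add: moment_def exp_sum_def card_torus Q_def)
        then show "moment q k (monom 1) (\<lambda>_. 1) (\<lambda>_. 1) d (residue_part S (p ^ N) z) powr
            (1 / real d) = (if z \<in> S then Q powr (1 / real d) else 0)"
          using d by (simp add: r moment_empty)
      qed simp
      also have "\<dots> = real (card ({0..<p ^ N} \<inter> S)) * Q powr (1 / real d)"
        by (simp add: sum.If_cases Int_def)
      also have "{0..<p ^ N} \<inter> S = S" using SN by blast
      finally have "curve_energy p k N (monom 1) (\<lambda>_. 1) S ^ d = real (card S) ^ d * Q"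
        using Q d by (simp add: power_mult_distrib powr_inverse_power)
      also have "\<dots> \<le> X ^ d * Q" using cS Q by (intro mult_right_mono power_mono) auto
      finally show ?thesis .
    qed
    have "moment_like p k (monom 1)" by (simp add: moment_like_def)
    then have "moment q k (monom 1) (\<lambda>_. 1) (\<lambda>_. 1) d S \<le> C * P powr (\<epsilon> * real N) * curve_energy p
        k N (monom 1) (\<lambda>_. 1) S ^ d"
      using C(2)[of N] fS unfolding decoupling_def q_def d_def by blast
    also have "\<dots> \<le> C * P powr (\<epsilon> * real N) * (X ^ d * Q)"
      using C curve_energy by (intro mult_left_mono) auto
    finally have moment: "(\<Sum>u\<in>torus k q. f u ^ (2 * d)) \<le> C * P powr (\<epsilon> * real N) * (X ^ d * Q)"
      by (simp add: moment_def f_def)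
    have "real (vinogradov_J s k X) * Q \<le> (\<Sum>u\<in>torus k q. f u ^ (2 * s))"
      using vinogradov_J_le_moment[OF q] by (simp add: Q_def f_def S_def)
    also have "\<dots> \<le> (\<Sum>u\<in>torus k q. X ^ (2 * (s - d)) * f u ^ (2 * d))"
    proof (rule sum_mono)
      fix u
      have "2 * s = 2 * (s - d) + 2 * d" using s by (simp add: d_def)
      then have "f u ^ (2 * s) = f u ^ (2 * (s - d)) * f u ^ (2 * d)" by (metis power_add)
      also have "\<dots> \<le> X ^ (2 * (s - d)) * f u ^ (2 * d)"
        using f0 fX by (intro mult_right_mono power_mono) auto
      finally show "f u ^ (2 * s) \<le> X ^ (2 * (s - d)) * f u ^ (2 * d)" .
    qed
    also have "\<dots> = X ^ (2 * (s - d)) * (\<Sum>u\<in>torus k q. f u ^ (2 * d))"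
        by (simp add: sum_distrib_left)
    also have "\<dots> \<le> X ^ (2 * (s - d)) * (C * P powr (\<epsilon> * real N) * (X ^ d * Q))"
      using X moment by (intro mult_left_mono) auto
    finally have "real (vinogradov_J s k X) \<le> C * (X ^ (2 * (s - d)) * X ^ d) * P powr (\<epsilon> * real N)"
      using Q by (simp add: mult_ac)
    also have "P powr (\<epsilon> * real N) = (P ^ N) powr \<epsilon>"
      using P1 by (simp add: powr_realpow[symmetric] powr_powr mult.commute)
    also have "C * (X ^ (2 * (s - d)) * X ^ d) * (P ^ N) powr \<epsilon> \<le> C * (X ^ (2 * (s - d)) * X ^ d)
        * (P * X) powr \<epsilon>"
      using C X PN P1 e by (intro mult_left_mono powr_mono2) auto
    also have "\<dots> = C * P powr \<epsilon> * X powr (2 * real s - real (triangle k) + \<epsilon>)"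
    proof -
      have "X ^ (2 * (s - d)) * X ^ d = X powr (real (2 * (s - d) + d))"
        using X by (simp add: powr_realpow power_add del: of_nat_add)
      also have "real (2 * (s - d) + d) = 2 * real s - real (triangle k)"
        using s by (simp add: d_def of_nat_diff)
      finally show ?thesis using X P1 by (simp add: powr_mult powr_add)
    qed
    finally show "real (vinogradov_J s k X)
        \<le> C * P powr \<epsilon> * X powr (2 * real s - real (triangle k) + \<epsilon>)" .
  qed
qed

section \<open>Inequalities between the parameters and the final deduction\<close>

lemma admissible_s_bounds:
  fixes k r s :: real
  assumes r: "r \<ge> 1" "r \<le> k - 2" "r \<le> (k + 1) / 2"
    and s: "s \<ge> k ^ 2 - r * k + r * (r + 3) / 2 - 1"
  shows "s \<ge> k * (k + 1) / 2" and "s - k + 1 > 0" and "3 * k - 2 * r - 5 \<ge> 0"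
proof -
  \<comment> \<open>In terms of \<open>y\<close> and \<open>r\<close> the excess of the lower bound
    for \<open>s\<close> over the critical value is visibly nonnegative.\<close>
  define y where "y = k - r"
  have y: "y \<ge> 2" "k = y + r" using r by (auto simp: y_def)
  have "k ^ 2 - r * k + r * (r + 3) / 2 - 1 - k * (k + 1) / 2 = y * (y - 1) / 2 + (r - 1)"
    unfolding y(2) by (simp add: field_simps power2_eq_square)
  moreover have "y * (y - 1) / 2 \<ge> 0" using y by simp
  ultimately show sk: "s \<ge> k * (k + 1) / 2" using s r by linarith
  have "k \<ge> 3" using r by linarith
  then have "k * (k + 1) / 2 \<ge> k" by (simp add: field_simps)
  then show "s - k + 1 > 0" using sk by linarith
  \<comment> \<open>By 2 r \<le> k + 1 the left side is at least 2 k - 6. This gives \<delta> \<ge>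
    0.\<close>
  show "3 * k - 2 * r - 5 \<ge> 0" using r \<open>k \<ge> 3\<close> by (simp add: field_simps)
qed

text \<open>Since the left side does not increase with \<open>s\<close>, the threshold value is the
  worst case. There, clearing denominators and writing k = y + r with y \<ge> 2 leaves a sum of
  nonnegative terms, the last one positive.\<close>

lemma delta_less:
  fixes k r s :: real
  assumes r: "r \<ge> 1" "r \<le> k - 2" and s: "s \<ge> (k - r / 2) ^ 2 + (r + 3) ^ 2 / 4" and sk: "s - k
      + 1 > 0"
  shows "r * (r - 1) * (3 * k - 2 * r - 5) / (6 * (s - k + 1)) < r ^ 2 / k"
proof -
  define y where "y = k - r"
  have y: "y \<ge> 2" "k = y + r" using r by (auto simp: y_def)
  define T where "T = (k - r / 2) ^ 2 + (r + 3) ^ 2 / 4 - k + 1"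
  have T: "T \<le> s - k + 1" using s by (simp add: T_def)
  have "6 * r * T - (r - 1) * (3 * k - 2 * r - 5) * k
     = 3 * r * y ^ 2 + 2 * r ^ 2 * y + 3 * r * y + 2 * r ^ 3 + 9 * r ^ 2 + y * (3 * y - 5)
         + 29 / 2 * r"
    unfolding T_def y(2) by (simp add: field_simps power2_eq_square power3_eq_cube)
  moreover have "3 * r * y ^ 2 + 2 * r ^ 2 * y + 3 * r * y + 2 * r ^ 3 + 9 * r ^ 2 + y
      * (3 * y - 5) + 29 / 2 * r > 0"
    using r y by (intro add_nonneg_pos add_nonneg_nonneg) auto
  ultimately have "(r - 1) * (3 * k - 2 * r - 5) * k < 6 * r * T" by linarith
  also have "\<dots> \<le> 6 * r * (s - k + 1)" using T r by (intro mult_left_mono) auto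
  finally have "r * ((r - 1) * (3 * k - 2 * r - 5) * k) < r * (6 * r * (s - k + 1))"
    using r by (intro mult_strict_left_mono) auto
  moreover have "k > 0" using r by linarith
  ultimately show ?thesis using sk by (simp add: divide_less_eq less_divide_eq power2_eq_square
      mult_ac)
qed

theorem theorem1p1:
  fixes k s :: nat
  assumes "k \<ge> 3" and "s \<ge> 1"
  shows
    "(\<forall>\<epsilon>>0. \<exists>C::real. \<forall>\<^sub>F X::real in at_top. \<forall>r::nat.
        r \<ge> 1 \<and>
        real r \<le> min (real k - 2) ((real k + 1) / 2) \<and>
        real s \<ge> real k ^ 2 - real r * real k + real r * (real r + 3) / 2 - 1 \<longrightarrow>
        real (vinogradov_J s k X) \<le>
          C * X powr (2 * real s - real k * (real k + 1) / 2 + vinogradov_delta s k r + \<epsilon>)) \<and>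
     (\<forall>r::nat.
        r \<ge> 1 \<and>
        real r \<le> min (real k - 2) ((real k + 1) / 2) \<and>
        real s \<ge> real k ^ 2 - real r * real k + real r * (real r + 3) / 2 - 1 \<and>
        real s \<ge> (real k - real r / 2) ^ 2 + (real r + 3) ^ 2 / 4 \<longrightarrow>
        vinogradov_delta s k r < real r ^ 2 / real k)"
proof (intro conjI allI impI)
  fix \<epsilon> :: real assume e: "\<epsilon> > 0"
  \<comment> \<open>\<open>C\<close> has to be chosen before \<open>r\<close>, and an admissible
    \<open>r\<close> exists only if \<open>triangle k \<le> s\<close>; hence the
    implication.\<close>
  obtain C where C: "triangle k \<le> s \<Longrightarrow> \<forall>X\<ge>1. real (vinogradov_J s k X)
      \<le> C * X powr (2 * real s - real (triangle k) + \<epsilon>)"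
    using vinogradov_mean_value[of k s \<epsilon>] assms e by (cases "triangle k \<le> s") auto
  show "\<exists>C::real. \<forall>\<^sub>F X::real in at_top. \<forall>r::nat.
        r \<ge> 1 \<and>
        real r \<le> min (real k - 2) ((real k + 1) / 2) \<and>
        real s \<ge> real k ^ 2 - real r * real k + real r * (real r + 3) / 2 - 1 \<longrightarrow>
        real (vinogradov_J s k X) \<le>
          C * X powr (2 * real s - real k * (real k + 1) / 2 + vinogradov_delta s k r + \<epsilon>)"
  \<comment> \<open>The sign of \<open>C\<close> is unknown; with its absolute value the power of
    \<open>X\<close> may be enlarged.\<close>
  proof (intro exI[of _ "\<bar>C\<bar>"] eventually_mono[OF eventually_ge_at_top[of 1]] allI impI)
    fix X :: real and r :: nat assume X: "1 \<le> X"
      and h: "r \<ge> 1 \<and> real r \<le> min (real k - 2) ((real k + 1) / 2) \<and>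
        real s \<ge> real k ^ 2 - real r * real k + real r * (real r + 3) / 2 - 1"
    have r: "real r \<ge> 1" "real r \<le> real k - 2" "real r \<le> (real k + 1) / 2"
      and s: "real s \<ge> real k ^ 2 - real r * real k + real r * (real r + 3) / 2 - 1" using h by auto
    note b = admissible_s_bounds[OF r s]
    have "real (triangle k) \<le> real s" unfolding real_triangle using b(1) .
    then have "real (vinogradov_J s k X) \<le> C * X powr (2 * real s - real (triangle k) + \<epsilon>)"
      using C X by simp
    also have "\<dots> \<le> \<bar>C\<bar> * X powr (2 * real s - real (triangle k) + \<epsilon>)"
      by (intro mult_right_mono) auto
    also have "\<dots> \<le> \<bar>C\<bar> * X powr (2 * real s - real k * (real k + 1) / 2 + vinogradov_delta s k r
        + \<epsilon>)"
    proof (intro mult_left_mono powr_mono X)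
      have "vinogradov_delta s k r \<ge> 0"
        unfolding vinogradov_delta_def using r b by (intro divide_nonneg_pos mult_nonneg_nonneg)
            auto
      then show "2 * real s - real (triangle k) + \<epsilon> \<le> 2 * real s - real k * (real k + 1) / 2
          + vinogradov_delta s k r + \<epsilon>"
        unfolding real_triangle by simp
    qed simp
    finally show "real (vinogradov_J s k X) \<le>
          \<bar>C\<bar> * X powr (2 * real s - real k * (real k + 1) / 2 + vinogradov_delta s k r + \<epsilon>)" .
  qed
next
  fix r :: nat
  assume h: "r \<ge> 1 \<and> real r \<le> min (real k - 2) ((real k + 1) / 2) \<and>
        real s \<ge> real k ^ 2 - real r * real k + real r * (real r + 3) / 2 - 1 \<and>
        real s \<ge> (real k - real r / 2) ^ 2 + (real r + 3) ^ 2 / 4"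
  then have r: "real r \<ge> 1" "real r \<le> real k - 2" "real r \<le> (real k + 1) / 2"
    and s: "real s \<ge> real k ^ 2 - real r * real k + real r * (real r + 3) / 2 - 1" by auto
  show "vinogradov_delta s k r < real r ^ 2 / real k"
    unfolding vinogradov_delta_def
    using delta_less[OF r(1,2) _ admissible_s_bounds(2)[OF r s]] h by blast
qed

end
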